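(* Let $G$ be a Cohen-Macaulay forest of dimension $m$ without isolated vertices. Then $\nu(G)=m$ and $$\operatorname{depth}\bigl(R/I(G)^{[k]}\bigr)=m+k-1\qquad\text{for all } 1\le k\le \nu(G)=m.$$
   Context: All graphs are finite and simple. Fix a field $\mathbb{K}$. For a graph $G$ with vertex set $V(G)$ (vertices are identified with indeterminates), $R=\mathbb{K}[x\mid x\in V(G)]$ and $I(G)=\langle xy\mid \{x,y\}\in E(G)\rangle\subseteq R$ is the edge ideal. A matching of $G$ is a set of pairwise disjoint edges; a $k$-matching is a matching with $k$ edges; $\nu(G)$ is the maximum cardinality of a matching. The $k$-th square-free power $I(G)^{[k]}$ is the ideal of $R$ generated by the square-free monomials of $I(G)^k$; equivalently it is generated by the products $\prod_{x\in \bigcup_{e\in M}e}x$ over all $k$-matchings $M$ of $G$ (so it is $0$ if $k>\nu(G)$). A forest is a graph with no cycles. The dimension of $G$ is the Krull dimension of $R/I(G)$, and $G$ is called Cohen-Macaulay if $\operatorname{depth}(R/I(G))=\dim (R/I(G))$. *)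

theory Defs
  imports
    "HOL-Algebra.Algebra"
    "HOL-Library.Poly_Mapping"
    "HOL-Library.Extended_Nat"
begin

section \<open>Graphs\<close>

text \<open>A graph is given by its vertex set \<open>V\<close> and its set \<open>E\<close> of edges, each edge being a
  two-element set of vertices.\<close>

definition simple_graph :: "'v set \<Rightarrow> 'v set set \<Rightarrow> bool" where
  "simple_graph V E \<longleftrightarrow> finite V \<and> (\<forall>e\<in>E. e \<subseteq> V \<and> card e = 2)"

definition graph_cycle :: "'v set set \<Rightarrow> 'v list \<Rightarrow> bool" where
  "graph_cycle E c \<longleftrightarrow>
     3 \<le> length c \<and> distinct c \<and> (\<forall>i<length c. {c ! i, c ! (Suc i mod length c)} \<in> E)"

definition forest_graph :: "'v set \<Rightarrow> 'v set set \<Rightarrow> bool" where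
  "forest_graph V E \<longleftrightarrow> simple_graph V E \<and> (\<nexists>c. graph_cycle E c)"

definition isolated_vertex :: "'v set \<Rightarrow> 'v set set \<Rightarrow> 'v \<Rightarrow> bool" where
  "isolated_vertex V E v \<longleftrightarrow> v \<in> V \<and> (\<forall>e\<in>E. v \<notin> e)"

definition matching :: "'v set set \<Rightarrow> 'v set set \<Rightarrow> bool" where
  "matching E M \<longleftrightarrow> M \<subseteq> E \<and> disjoint M"

definition matching_number :: "'v set set \<Rightarrow> nat" where
  "matching_number E = Max {card M | M. matching E M}"


section \<open>Krull dimension and depth\<close>

text \<open>The supremum is taken in \<^typ>\<open>enat\<close>, so that rings of infinite dimension have dimension
  \<open>\<infinity>\<close>.  The zero ring, which has no prime ideals, gets dimension \<open>0\<close>.\<close>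

definition krull_dim :: "('a, 'b) ring_scheme \<Rightarrow> enat" where
  "krull_dim A =
     Sup {enat n | n. \<exists>P. (\<forall>i\<le>n. primeideal (P i) A) \<and> (\<forall>i<n. P i \<subset> P (Suc i))}"

text \<open>The submodule \<open>(x\<^sub>1, \<dots>, x\<^sub>n) M\<close> of a module \<open>M\<close> over a commutative ring.\<close>

definition seq_submodule :: "('a, 'b, 'c) module_scheme \<Rightarrow> 'a list \<Rightarrow> 'b set" where
  "seq_submodule M xs =
     {\<Oplus>\<^bsub>M\<^esub>i\<in>{..<length xs}. (xs ! i) \<odot>\<^bsub>M\<^esub> u i | u. u \<in> {..<length xs} \<rightarrow> carrier M}"

text \<open>A sequence is \<open>M\<close>-regular if each entry \<open>x\<^sub>i\<close> is a nonzerodivisor on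
  \<open>M / (x\<^sub>1, \<dots>, x\<^sub>i\<^sub>-\<^sub>1) M\<close> and \<open>M \<noteq> (x\<^sub>1, \<dots>, x\<^sub>n) M\<close>.\<close>

definition regular_sequence :: "('a, 'b, 'c) module_scheme \<Rightarrow> 'a list \<Rightarrow> bool" where
  "regular_sequence M xs \<longleftrightarrow>
     (\<forall>i<length xs. \<forall>u\<in>carrier M.
        (xs ! i) \<odot>\<^bsub>M\<^esub> u \<in> seq_submodule M (take i xs) \<longrightarrow> u \<in> seq_submodule M (take i xs)) \<and>
     seq_submodule M xs \<noteq> carrier M"

text \<open>Supremum of the lengths of the \<open>M\<close>-regular sequences contained in the ideal \<open>\<mm>\<close>.\<close>

definition depth :: "'a set \<Rightarrow> ('a, 'b, 'c) module_scheme \<Rightarrow> enat" where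
  "depth \<mm> M = Sup {enat (length xs) | xs. set xs \<subseteq> \<mm> \<and> regular_sequence M xs}"

text \<open>The quotient \<open>R / I\<close> of the library, viewed as an \<open>R\<close>-module.\<close>

definition quot_module :: "('a, 'b) ring_scheme \<Rightarrow> 'a set \<Rightarrow> ('a, 'a set) module" where
  "quot_module R I =
     ring.extend (R Quot I)
       (module.fields (\<lambda>r C. (I +>\<^bsub>R\<^esub> r) \<otimes>\<^bsub>R Quot I\<^esub> C))"

lemma quot_module_simps [simp]:
  "carrier (quot_module R I) = carrier (R Quot I)"
  "monoid.mult (quot_module R I) = monoid.mult (R Quot I)"
  "monoid.one (quot_module R I) = monoid.one (R Quot I)"
  "ring.zero (quot_module R I) = ring.zero (R Quot I)"
  "ring.add (quot_module R I) = ring.add (R Quot I)"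
  "r \<odot>\<^bsub>quot_module R I\<^esub> C = (I +>\<^bsub>R\<^esub> r) \<otimes>\<^bsub>R Quot I\<^esub> C"
  by (simp_all add: quot_module_def ring.defs module.defs)

lemma module_quot_module:
  assumes "cring R" "ideal I R"
  shows "module R (quot_module R I)"
proof -
  interpret R: cring R by fact
  interpret I: ideal I R by fact
  interpret Q: ring "R Quot I" by (rule I.quotient_is_ring)
  interpret h: ring_hom_ring R "R Quot I" "(+>\<^bsub>R\<^esub>) I" by (rule I.rcos_ring_hom_ring)
  have "abelian_group (quot_module R I)"
    by (rule abelian_groupI) (auto simp: Q.a_ac intro: Q.l_neg Q.a_inv_closed)
  with assms(1) show ?thesis
    by (rule moduleI) (auto simp: Q.l_distr Q.r_distr Q.m_assoc)
qed


section \<open>Polynomial rings\<close>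

text \<open>Exponent vectors are finitely supported functions \<^typ>\<open>'v \<Rightarrow>\<^sub>0 nat\<close>; the multiplication of
  \<open>HOL-Library.Poly_Mapping\<close> on \<open>('v \<Rightarrow>\<^sub>0 nat) \<Rightarrow>\<^sub>0 'k\<close> is polynomial multiplication.\<close>

type_synonym ('v, 'k) mpoly = "('v \<Rightarrow>\<^sub>0 nat) \<Rightarrow>\<^sub>0 'k"

definition polys_in :: "'v set \<Rightarrow> ('v, 'k::field) mpoly set" where
  "polys_in V = {p. \<forall>t\<in>Poly_Mapping.keys p. Poly_Mapping.keys t \<subseteq> V}"

definition mpoly_ring :: "'v set \<Rightarrow> ('v, 'k::field) mpoly ring" where
  "mpoly_ring V =
     \<lparr>carrier = polys_in V, monoid.mult = (*), monoid.one = 1, ring.zero = 0, ring.add = (+)\<rparr>"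

definition monomial :: "('v \<Rightarrow>\<^sub>0 nat) \<Rightarrow> ('v, 'k::field) mpoly" where
  "monomial t = Poly_Mapping.single t 1"

definition indet :: "'v \<Rightarrow> ('v, 'k::field) mpoly" where
  "indet x = monomial (Poly_Mapping.single x 1)"

definition squarefree_exponent :: "('v \<Rightarrow>\<^sub>0 nat) \<Rightarrow> bool" where
  "squarefree_exponent t \<longleftrightarrow> (\<forall>x. Poly_Mapping.lookup t x \<le> 1)"

lemma cring_mpoly_ring: "cring (mpoly_ring V :: ('v, 'k::field) mpoly ring)"
proof -
  have add: "p + q \<in> polys_in V" if "p \<in> polys_in V" "q \<in> polys_in V" for p q :: "('v, 'k) mpoly"
    using that Poly_Mapping.keys_add[of p q] unfolding polys_in_def by blast
  have mult: "p * q \<in> polys_in V" if "p \<in> polys_in V" "q \<in> polys_in V" for p q :: "('v, 'k) mpoly"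
    unfolding polys_in_def
  proof (intro CollectI ballI)
    fix t assume "t \<in> Poly_Mapping.keys (p * q)"
    then obtain a b where ab: "a \<in> Poly_Mapping.keys p" "b \<in> Poly_Mapping.keys q" "t = a + b"
      using Poly_Mapping.keys_mult[of p q] by blast
    then have "Poly_Mapping.keys a \<subseteq> V" "Poly_Mapping.keys b \<subseteq> V"
      using that unfolding polys_in_def by auto
    then show "Poly_Mapping.keys t \<subseteq> V"
      using Poly_Mapping.keys_add[of a b] ab(3) by blast
  qed
  have zero: "0 \<in> (polys_in V :: ('v, 'k) mpoly set)" and one: "1 \<in> (polys_in V :: ('v, 'k) mpoly set)"
    by (simp_all add: polys_in_def)
  have uminus: "- p \<in> polys_in V" if "p \<in> polys_in V" for p :: "('v, 'k) mpoly"
    using that by (simp add: polys_in_def)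
  have "abelian_group (mpoly_ring V :: ('v, 'k) mpoly ring)"
    unfolding mpoly_ring_def
    by (rule abelian_groupI)
       (use add zero uminus in \<open>auto simp: add_ac intro!: bexI[where x = "- x" for x]\<close>)
  moreover have "Group.comm_monoid (mpoly_ring V :: ('v, 'k) mpoly ring)"
    unfolding mpoly_ring_def
    by (rule comm_monoidI) (use mult one in \<open>auto simp: mult_ac\<close>)
  ultimately show ?thesis
    by (rule cringI) (simp add: mpoly_ring_def distrib_right)
qed

definition irrelevant_ideal :: "'v set \<Rightarrow> ('v, 'k::field) mpoly set" where
  "irrelevant_ideal V = Idl\<^bsub>mpoly_ring V\<^esub> (indet ` V)"

text \<open>As usual for quotients by homogeneous ideals, \<open>depth (R / I)\<close> is taken with respect to the
  graded maximal ideal; entries of regular sequences need not be homogeneous.\<close>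

definition depth_quot :: "'v set \<Rightarrow> ('v, 'k::field) mpoly set \<Rightarrow> enat" where
  "depth_quot V I = depth (irrelevant_ideal V) (quot_module (mpoly_ring V) I)"


section \<open>Edge ideals\<close>

definition edge_ideal :: "'v set \<Rightarrow> 'v set set \<Rightarrow> ('v, 'k::field) mpoly set" where
  "edge_ideal V E = Idl\<^bsub>mpoly_ring V\<^esub> {indet x * indet y | x y. {x, y} \<in> E}"

text \<open>The ordinary power \<open>I\<^sup>k\<close> is the power in the library's monoid of ideals.\<close>

definition squarefree_power ::
    "'v set \<Rightarrow> ('v, 'k::field) mpoly set \<Rightarrow> nat \<Rightarrow> ('v, 'k) mpoly set" where
  "squarefree_power V I k =
     Idl\<^bsub>mpoly_ring V\<^esub> {monomial t | t.
       squarefree_exponent t \<and> monomial t \<in> I [^]\<^bsub>ideals_set (mpoly_ring V)\<^esub> k}"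

text \<open>The first argument only fixes the coefficient field, which the type of a graph does not
  determine.\<close>

definition graph_dim :: "'k::field itself \<Rightarrow> 'v set \<Rightarrow> 'v set set \<Rightarrow> enat" where
  "graph_dim K V E = krull_dim (mpoly_ring V Quot (edge_ideal V E :: ('v, 'k) mpoly set))"

definition cohen_macaulay_graph :: "'k::field itself \<Rightarrow> 'v set \<Rightarrow> 'v set set \<Rightarrow> bool" where
  "cohen_macaulay_graph K V E \<longleftrightarrow>
     depth_quot V (edge_ideal V E :: ('v, 'k) mpoly set) = graph_dim K V E"

end

theory Submission
  imports Defs
begin

text \<open>
  The faces of the Stanley--Reisner complex of \<open>I(G)\<^sup>[\<^sup>k\<^sup>]\<close> are the vertex sets that contain no
  \<open>k\<close>-matching.  Two facts bound the depth of a Stanley--Reisner ring.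

  Upper bound: the depth is at most the size of every facet \<open>W\<close>.  If \<open>f\<^sub>1, \<dots>, f\<^sub>r\<close> is regular with
  \<open>r > card W\<close>, then the \<open>f\<^sub>i\<^sup>a\<close> are regular too and algebraically dependent modulo the prime of \<open>W\<close>, which
  is the annihilator of \<open>x\<^sup>W\<close>.  Such a relation forces \<open>x\<^sup>W \<in> (f\<^sub>1\<^sup>a, \<dots>, f\<^sub>r\<^sup>a)\<close>, which is
  impossible for large \<open>a\<close>.

  Lower bound: the elementary symmetric polynomials \<open>e\<^sub>1, \<dots>, e\<^sub>r\<close> in all variables are regular on
  \<open>K[W]\<close> whenever \<open>r \<le> card W\<close>.  As this sequence does not depend on \<open>W\<close>, it stays regular
  along the exact sequences \<open>0 \<rightarrow> R / (I : x) \<rightarrow> R / I \<rightarrow> R / (I + xR) \<rightarrow> 0\<close>, that is, for every complex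
  that splits, by stars and deletions of vertices, into simplices with at least \<open>r\<close> vertices.

  For \<open>k = 1\<close> the upper bound, together with \<open>dim \<ge> card W\<close> for all faces \<open>W\<close>, shows that all maximal
  independent sets of a Cohen-Macaulay graph have \<open>m\<close> elements.  A forest with this property and
  without isolated vertices arises from a forest on \<open>m\<close> vertices by attaching a whisker to each
  vertex, and for such graphs both bounds equal \<open>m + k - 1\<close>.
\<close>

section \<open>Regular sequences in commutative rings\<close>

text \<open>Regular sequences may be inhomogeneous, and both bounds are reached by ideal membership
  alone. In the upper bound, degree enters only because every term of an entry has positive degree,
  so that all terms of an \<open>a\<close>-th power have degree at least \<open>a\<close>. In the
  lower bound, the exact sequence transfers regularity only for a sequence that is regular at both
  ends, so one sequence has to serve all faces at once. Modulo the variables outside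
  \<open>W\<close>, the e_i become the elementary symmetric polynomials of \<open>W\<close>; the
  last one is the product of the variables of \<open>W\<close>, and setting a variable to zero gives
  the same situation for a smaller face. The number m + k - 1 is the size of a facet made of all m
  whisker tips and k - 1 base vertices. To reach it from below, the forest is used a second time:
  the induction splits at a leaf of the base. Once this leaf is chosen and its tip deleted, at most
  one edge at it remains, and that edge is pendant, so that one more split leads back to whiskered
  graphs.\<close>

locale ring_carrier =
  fixes R :: "'a::comm_ring_1 set"
  assumes zero_mem [simp]: "0 \<in> R"
    and one_mem [simp]: "1 \<in> R"
    and add_mem [simp]: "a \<in> R \<Longrightarrow> b \<in> R \<Longrightarrow> a + b \<in> R"
    and mult_mem [simp]: "a \<in> R \<Longrightarrow> b \<in> R \<Longrightarrow> a * b \<in> R"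
    and uminus_mem [simp]: "a \<in> R \<Longrightarrow> - a \<in> R"
begin

lemma power_mem [simp]: "a \<in> R \<Longrightarrow> a ^ n \<in> R"
  by (induction n) auto

lemma diff_mem [simp]: "a \<in> R \<Longrightarrow> b \<in> R \<Longrightarrow> a - b \<in> R"
  using add_mem[of a "- b"] by simp

lemma sum_mem: "(\<And>i. i \<in> A \<Longrightarrow> f i \<in> R) \<Longrightarrow> sum f A \<in> R"
  by (induction A rule: infinite_finite_induct) auto

lemma prod_mem: "(\<And>i. i \<in> A \<Longrightarrow> f i \<in> R) \<Longrightarrow> prod f A \<in> R"
  by (induction A rule: infinite_finite_induct) auto

definition is_ideal :: "'a set \<Rightarrow> bool" where
  "is_ideal I \<longleftrightarrow>
     I \<subseteq> R \<and> 0 \<in> I \<and> (\<forall>a\<in>I. \<forall>b\<in>I. a + b \<in> I) \<and> (\<forall>r\<in>R. \<forall>a\<in>I. r * a \<in> I)"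

definition adj :: "'a set \<Rightarrow> 'a \<Rightarrow> 'a set" where
  "adj I x = {a + x * b | a b. a \<in> I \<and> b \<in> R}"

definition colon :: "'a set \<Rightarrow> 'a \<Rightarrow> 'a set" where
  "colon I x = {u \<in> R. x * u \<in> I}"

definition nzd :: "'a set \<Rightarrow> 'a \<Rightarrow> bool" where
  "nzd I x \<longleftrightarrow> (\<forall>u\<in>R. x * u \<in> I \<longrightarrow> u \<in> I)"

definition gen :: "'a set \<Rightarrow> 'a list \<Rightarrow> 'a set" where
  "gen = foldl adj"

lemma gen_simps [simp]: "gen I [] = I" "gen I (x # xs) = gen (adj I x) xs"
  by (simp_all add: gen_def)

lemma gen_append: "gen I (xs @ ys) = gen (gen I xs) ys"
  by (simp add: gen_def)

text \<open>Weak regularity on \<open>R / I\<close>: properness of \<open>gen I xs\<close> is not required.\<close>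

fun wreg :: "'a set \<Rightarrow> 'a list \<Rightarrow> bool" where
  "wreg I [] \<longleftrightarrow> True"
| "wreg I (x # xs) \<longleftrightarrow> nzd I x \<and> wreg (adj I x) xs"

lemma wreg_append: "wreg I (xs @ ys) \<longleftrightarrow> wreg I xs \<and> wreg (gen I xs) ys"
  by (induction xs arbitrary: I) auto

lemma wreg_iff_nth:
  "wreg I xs \<longleftrightarrow> (\<forall>i<length xs. nzd (gen I (take i xs)) (xs ! i))"
proof (induction xs rule: rev_induct)
  case (snoc x xs)
  then show ?case
    by (auto simp: wreg_append less_Suc_eq nth_append)
qed simp

lemma idealD:
  assumes "is_ideal I"
  shows ideal_sub: "a \<in> I \<Longrightarrow> a \<in> R"
    and ideal_zero: "0 \<in> I"
    and ideal_add: "a \<in> I \<Longrightarrow> b \<in> I \<Longrightarrow> a + b \<in> I"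
    and ideal_mult: "r \<in> R \<Longrightarrow> a \<in> I \<Longrightarrow> r * a \<in> I"
    and ideal_mult': "r \<in> R \<Longrightarrow> a \<in> I \<Longrightarrow> a * r \<in> I"
  using assms by (auto simp: is_ideal_def mult.commute[of a])

lemma ideal_diff:
  assumes "is_ideal I" "a \<in> I" "b \<in> I"
  shows "a - b \<in> I"
proof -
  have "(- 1) * b \<in> I"
    by (intro ideal_mult assms) simp
  then show ?thesis
    using ideal_add[OF assms(1,2), of "- b"] by simp
qed

lemma ideal_sum:
  "is_ideal I \<Longrightarrow> (\<And>i. i \<in> A \<Longrightarrow> f i \<in> I) \<Longrightarrow> sum f A \<in> I"
  by (induction A rule: infinite_finite_induct) (auto intro: ideal_zero ideal_add)

lemma adjI: "a \<in> I \<Longrightarrow> b \<in> R \<Longrightarrow> a + x * b \<in> adj I x"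
  by (auto simp: adj_def)

lemma adjE:
  assumes "p \<in> adj I x"
  obtains a b where "a \<in> I" "b \<in> R" "p = a + x * b"
  using assms by (auto simp: adj_def)

lemma subset_adj: "I \<subseteq> adj I x"
proof
  fix a assume "a \<in> I"
  then show "a \<in> adj I x" using adjI[of a I 0 x] by simp
qed

lemma mult_mem_adj: "is_ideal I \<Longrightarrow> b \<in> R \<Longrightarrow> x * b \<in> adj I x"
  using adjI[of 0 I b x] ideal_zero by simp

lemma is_ideal_adj:
  assumes I: "is_ideal I" and x: "x \<in> R"
  shows "is_ideal (adj I x)"
  unfolding is_ideal_def
proof (intro conjI ballI)
  show "adj I x \<subseteq> R"
    using x ideal_sub[OF I] by (auto elim!: adjE)
  show "0 \<in> adj I x"
    using subset_adj ideal_zero[OF I] by blast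
next
  fix p q assume "p \<in> adj I x" "q \<in> adj I x"
  then obtain a b a' b' where "a \<in> I" "b \<in> R" "p = a + x * b" "a' \<in> I" "b' \<in> R" "q = a' + x * b'"
    by (elim adjE)
  then have "p + q = (a + a') + x * (b + b')" "a + a' \<in> I" "b + b' \<in> R"
    by (auto simp: algebra_simps intro: ideal_add[OF I])
  then show "p + q \<in> adj I x"
    by (metis adjI)
next
  fix r p assume r: "r \<in> R" "p \<in> adj I x"
  then obtain a b where "a \<in> I" "b \<in> R" "p = a + x * b"
    by (elim adjE)
  then have "r * p = r * a + x * (r * b)" "r * a \<in> I" "r * b \<in> R"
    using r ideal_mult[OF I, of r a] by (simp_all add: distrib_left mult.left_commute)
  then show "r * p \<in> adj I x"
    by (metis adjI)
qed

lemma is_ideal_gen: "is_ideal I \<Longrightarrow> set xs \<subseteq> R \<Longrightarrow> is_ideal (gen I xs)"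
  by (induction xs arbitrary: I) (auto intro: is_ideal_adj)

lemma subset_gen: "I \<subseteq> gen I xs"
proof (induction xs arbitrary: I)
  case (Cons x xs)
  then show ?case using subset_adj[of I x] by fastforce
qed simp

lemma adj_minimal: "is_ideal J \<Longrightarrow> I \<subseteq> J \<Longrightarrow> x \<in> J \<Longrightarrow> adj I x \<subseteq> J"
  by (auto elim!: adjE intro!: ideal_add ideal_mult')

lemma gen_minimal: "is_ideal J \<Longrightarrow> I \<subseteq> J \<Longrightarrow> set xs \<subseteq> J \<Longrightarrow> gen I xs \<subseteq> J"
  by (induction xs arbitrary: I) (auto dest: adj_minimal)

lemma self_mem_adj: "is_ideal I \<Longrightarrow> x \<in> adj I x"
  using mult_mem_adj[of I 1 x] by simp

lemma adj_commute:
  assumes "is_ideal I" "x \<in> R" "y \<in> R"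
  shows "adj (adj I x) y = adj (adj I y) x"
proof -
  have "adj (adj I x) y \<subseteq> adj (adj I y) x" if "x \<in> R" "y \<in> R" for x y
    using that assms(1) subset_adj[of I y] subset_adj[of "adj I y" x] self_mem_adj[of I y]
      self_mem_adj[of "adj I y" x]
    by (intro adj_minimal is_ideal_adj) (auto intro: is_ideal_adj)
  with assms show ?thesis by blast
qed

lemma gen_adj:
  assumes "is_ideal I" "x \<in> R" "set xs \<subseteq> R"
  shows "gen (adj I x) xs = adj (gen I xs) x"
  using assms
proof (induction xs arbitrary: I)
  case (Cons y xs)
  then show ?case
    by (simp add: adj_commute[of I x y] is_ideal_adj)
qed simp

lemma nzd_mult: "nzd I x \<Longrightarrow> nzd I y \<Longrightarrow> y \<in> R \<Longrightarrow> nzd I (x * y)"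
  by (auto simp: nzd_def mult.assoc)

lemma nzd_prod:
  "(\<And>i. i \<in> A \<Longrightarrow> nzd I (f i) \<and> f i \<in> R) \<Longrightarrow> nzd I (prod f A)"
proof (induction A rule: infinite_finite_induct)
  case (insert i A)
  then show ?case by (simp add: nzd_mult prod_mem)
qed (simp_all add: nzd_def)

lemma nzd_power: "nzd I x \<Longrightarrow> x \<in> R \<Longrightarrow> nzd I (x ^ n)"
proof (induction n)
  case (Suc n)
  then show ?case by (simp add: nzd_mult)
qed (simp add: nzd_def)

lemma colon_nzd: "is_ideal I \<Longrightarrow> x \<in> R \<Longrightarrow> nzd I x \<Longrightarrow> colon I x = I"
  by (auto simp: colon_def nzd_def dest: ideal_sub intro: ideal_mult)

lemma nzd_iff_colon: "is_ideal I \<Longrightarrow> x \<in> R \<Longrightarrow> nzd I x \<longleftrightarrow> colon I x = I"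
  by (rule iffI[OF colon_nzd]) (auto simp: colon_def nzd_def)

text \<open>The exactness of 0 -> R/(I : x) -> R/I -> R/(I + xR) -> 0 survives reduction modulo
  \<open>f\<close>. If x g = a + f w, then f w lies in I + xR, hence so does w = b + x w', and g - f
  w' lies in I : x.\<close>

lemma colon_adj:
  assumes I: "is_ideal I" and x: "x \<in> R" and f: "f \<in> R" and nzd: "nzd (adj I x) f"
  shows "colon (adj I f) x = adj (colon I x) f"
proof
  show "adj (colon I x) f \<subseteq> colon (adj I f) x"
  proof
    fix p assume "p \<in> adj (colon I x) f"
    then obtain a b where p: "a \<in> R" "x * a \<in> I" "b \<in> R" "p = a + f * b"
      by (auto elim!: adjE simp: colon_def)
    then have "x * p = x * a + f * (x * b)"
      by (simp add: algebra_simps)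
    with p x f show "p \<in> colon (adj I f) x"
      by (auto simp: colon_def intro: adjI)
  qed
  show "colon (adj I f) x \<subseteq> adj (colon I x) f"
  proof
    fix g assume g: "g \<in> colon (adj I f) x"
    then obtain a w where a: "a \<in> I" "w \<in> R" "x * g = a + f * w"
      by (auto simp: colon_def elim: adjE)
    have gR: "g \<in> R" using g by (simp add: colon_def)
    have "f * w = x * g - a" using a by simp
    also have "\<dots> \<in> adj I x"
      using a gR x subset_adj[of I x] I
      by (intro ideal_diff[OF is_ideal_adj] mult_mem_adj) auto
    finally have "w \<in> adj I x"
      using nzd a by (auto simp: nzd_def)
    then obtain b w' where w: "b \<in> I" "w' \<in> R" "w = b + x * w'"
      by (elim adjE)
    have "x * (g - f * w') = a + f * b"
      using a w by (simp add: algebra_simps)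
    also have "\<dots> \<in> I"
      using a w f I by (intro ideal_add ideal_mult)
    finally have "g - f * w' \<in> colon I x"
      using gR w f by (simp add: colon_def)
    then have "(g - f * w') + f * w' \<in> adj (colon I x) f"
      using w by (intro adjI)
    then show "g \<in> adj (colon I x) f" by simp
  qed
qed

text \<open>Regularity passes to the middle term of
  \<open>0 \<rightarrow> R / (I : x) \<rightarrow> R / I \<rightarrow> R / (I + xR) \<rightarrow> 0\<close>.\<close>

lemma wreg_colon_adj:
  assumes "is_ideal I" "x \<in> R" "set fs \<subseteq> R" "wreg (colon I x) fs" "wreg (adj I x) fs"
  shows "wreg I fs"
  using assms
proof (induction fs arbitrary: I)
  case (Cons f fs)
  have I: "is_ideal I" and x: "x \<in> R" and f: "f \<in> R" using Cons.prems by auto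
  have n1: "nzd (colon I x) f" and n2: "nzd (adj I x) f" using Cons.prems by auto
  have "nzd I f"
    unfolding nzd_def
  proof (intro ballI impI)
    fix u assume u: "u \<in> R" "f * u \<in> I"
    then have "u \<in> adj I x"
      using n2 subset_adj[of I x] by (auto simp: nzd_def)
    then obtain a v where a: "a \<in> I" "v \<in> R" "u = a + x * v"
      by (elim adjE)
    have "x * (f * v) = f * u - f * a"
      using a by (simp add: algebra_simps)
    also have "\<dots> \<in> I"
      by (rule ideal_diff[OF I u(2) ideal_mult[OF I f a(1)]])
    finally have "f * v \<in> colon I x"
      using a f by (simp add: colon_def)
    then have "v \<in> colon I x"
      using n1 a by (simp add: nzd_def)
    then have "x * v \<in> I"
      by (simp add: colon_def)
    then show "u \<in> I"
      unfolding a(3) using a(1) by (intro ideal_add[OF I])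
  qed
  \<comment> \<open>Modulo \<open>f\<close> the same situation recurs: \<open>colon_adj\<close>
    identifies the new colon ideal and \<open>adj_commute\<close> the new sum.\<close>
  moreover have "wreg (adj I f) fs"
  proof (rule Cons.IH)
    show "is_ideal (adj I f)" "x \<in> R" "set fs \<subseteq> R"
      using I x f Cons.prems by (auto intro: is_ideal_adj)
    show "wreg (colon (adj I f) x) fs"
      using Cons.prems by (simp add: colon_adj[OF I x f n2])
    show "wreg (adj (adj I f) x) fs"
      using Cons.prems by (simp add: adj_commute[OF I f x])
  qed
  ultimately show ?case by simp
qed simp

text \<open>Moves \<open>x\<close> from the front of a regular sequence to its end. Of the
  permutability of regular sequences this half holds without a grading: by \<open>colon_adj\<close>,
  the equation I : x = I persists when \<open>f\<close> is added to I.\<close>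

lemma nzd_gen:
  assumes "is_ideal I" "x \<in> R" "set fs \<subseteq> R" "nzd I x" "wreg (adj I x) fs"
  shows "nzd (gen I fs) x"
  using assms
proof (induction fs arbitrary: I)
  case (Cons f fs)
  have I: "is_ideal I" and x: "x \<in> R" and f: "f \<in> R" and n2: "nzd (adj I x) f"
    using Cons.prems by auto
  have "colon (adj I f) x = adj I f"
    using Cons.prems by (simp add: colon_adj[OF I x f n2] colon_nzd)
  then have "nzd (adj I f) x"
    using I f x by (simp add: nzd_iff_colon is_ideal_adj)
  then show ?case
    using Cons I f x by (auto simp: is_ideal_adj adj_commute[of I f x])
qed simp

text \<open>Induction on \<open>n\<close> along 0 -> R/(I + fR) -> R/(I + f^(n+1) R) -> R/(I + f^n
  R) -> 0, whose first map is multiplication by f^n. Since f^n is a nonzerodivisor modulo I, the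
  colon ideal of I + f^(n+1) R by f^n is I + fR.\<close>

lemma wreg_power_Cons:
  assumes I: "is_ideal I" and f: "f \<in> R" and fs: "set fs \<subseteq> R" and reg: "wreg I (f # fs)" and "n > 0"
  shows "wreg (adj I (f ^ n)) fs"
  using \<open>n > 0\<close>
proof (induction n rule: nat_induct_non_zero)
  case 1
  then show ?case using reg by simp
next
  case (Suc n)
  have nzd: "nzd I (f ^ n)" using reg f by (simp add: nzd_power)
  let ?J = "adj I (f ^ Suc n)"
  have J: "is_ideal ?J" using I f by (intro is_ideal_adj) auto
  show ?case
  proof (rule wreg_colon_adj[OF J, of "f ^ n"])
    have "colon ?J (f ^ n) = adj I f"
    proof
      show "adj I f \<subseteq> colon ?J (f ^ n)"
      proof
        fix p assume "p \<in> adj I f"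
        then obtain a b where p: "a \<in> I" "b \<in> R" "p = a + f * b" by (elim adjE)
        then have "f ^ n * p = f ^ n * a + f ^ Suc n * b" by (simp add: algebra_simps)
        also have "\<dots> \<in> ?J" using p f I by (intro adjI ideal_mult) auto
        finally show "p \<in> colon ?J (f ^ n)"
          using p f ideal_sub[OF I] by (auto simp: colon_def)
      qed
      show "colon ?J (f ^ n) \<subseteq> adj I f"
      proof
        fix p assume p: "p \<in> colon ?J (f ^ n)"
        then obtain a b where a: "a \<in> I" "b \<in> R" "f ^ n * p = a + f ^ Suc n * b"
          by (auto simp: colon_def elim: adjE)
        then have "f ^ n * (p - f * b) \<in> I" by (simp add: algebra_simps)
        then have "p - f * b \<in> I" using nzd a p f by (auto simp: nzd_def colon_def)
        then show "p \<in> adj I f" using adjI[of "p - f * b" I b f] a by simp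
      qed
    qed
    then show "wreg (colon ?J (f ^ n)) fs" using reg by simp
    have "f ^ Suc n \<in> adj I (f ^ n)"
      using mult_mem_adj[OF I, of f "f ^ n"] f by (simp add: mult.commute)
    then have "adj (adj I (f ^ n)) (f ^ Suc n) = adj I (f ^ n)"
      using subset_adj[of "adj I (f ^ n)" "f ^ Suc n"]
        adj_minimal[OF is_ideal_adj[OF I power_mem[OF f, of n]] subset_refl, of "f ^ Suc n"] by blast
    moreover have "adj ?J (f ^ n) = adj (adj I (f ^ n)) (f ^ Suc n)"
      using I f by (intro adj_commute) auto
    ultimately show "wreg (adj ?J (f ^ n)) fs" using Suc.IH by simp
  qed (use f fs in auto)
qed

lemma wreg_map_power:
  assumes "is_ideal I" "set fs \<subseteq> R" "wreg I fs" "n > 0"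
  shows "wreg I (map (\<lambda>f. f ^ n) fs)"
  using assms
proof (induction fs arbitrary: I)
  case (Cons f fs)
  have "wreg (adj I (f ^ n)) fs"
    using Cons.prems by (intro wreg_power_Cons) auto
  then have "wreg (adj I (f ^ n)) (map (\<lambda>f. f ^ n) fs)"
    using Cons.prems by (intro Cons.IH is_ideal_adj) auto
  then show ?case
    using Cons.prems by (simp add: nzd_power)
qed simp

text \<open>Exponents are lists so that they shrink together with the sequence when its first entry
  is divided out.\<close>

definition mpow :: "'a list \<Rightarrow> nat list \<Rightarrow> 'a" where
  "mpow fs al = prod_list (map2 (^) fs al)"

lemma mpow_simps [simp]: "mpow [] al = 1" "mpow (f # fs) (a # al) = f ^ a * mpow fs al"
  by (simp_all add: mpow_def)

lemma mpow_mem: "set fs \<subseteq> R \<Longrightarrow> mpow fs al \<in> R"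
proof (induction fs arbitrary: al)
  case Cons1: (Cons f fs)
  show ?case
  proof (cases al)
    case (Cons a be)
    then show ?thesis using Cons1.prems Cons1.IH[of be] by simp
  qed (simp add: mpow_def)
qed simp

text \<open>Look at the lexicographically smallest exponent in the relation.\<close>

lemma wreg_relation:
  assumes "is_ideal I" "set fs \<subseteq> R" "wreg I fs" "u \<in> R"
    and "finite A" "\<And>al. al \<in> A \<Longrightarrow> length al = length fs"
    and "\<And>al. al \<in> A \<Longrightarrow> c al \<in> R" "\<And>al. al \<in> A \<Longrightarrow> \<exists>d\<in>R. d * c al = 1"
    and "A \<noteq> {}" "(\<Sum>al\<in>A. c al * mpow fs al * u) \<in> I"
  shows "u \<in> gen I fs"
  using assms
proof (induction fs arbitrary: I A c)
  case Nil
  have A: "A = {[]}" using Nil(6,9) by auto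
  \<comment> \<open>The last coefficient has to be cancelled, hence the requirement that
    coefficients be units of \<open>R\<close>.\<close>
  obtain d where d: "d \<in> R" "d * c [] = 1" using Nil(8)[of "[]"] A by blast
  have "c [] * u \<in> I" using Nil(10) A by simp
  then have "d * (c [] * u) \<in> I" using ideal_mult[OF Nil(1) d(1)] by blast
  then show ?case using d by (simp add: mult.assoc[symmetric])
next
  case (Cons f fs)
  have I: "is_ideal I" and f: "f \<in> R" and fs: "set fs \<subseteq> R" and nzd: "nzd I f"
    and u: "u \<in> R" using Cons.prems by auto
  have len: "length al = Suc (length fs)" if "al \<in> A" for al using Cons.prems that by auto
  define j where "j = Min (hd ` A)"
  have fin: "finite A" "A \<noteq> {}" using Cons.prems by auto
  then have "j \<in> hd ` A" unfolding j_def by (intro Min_in) auto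
  have jle: "j \<le> hd al" if "al \<in> A" for al unfolding j_def using that fin by auto
  define A1 where "A1 = {al \<in> A. hd al = j}"
  \<comment> \<open>\<open>S1\<close> collects the terms with minimal first exponent
    \<open>j\<close>, \<open>S2\<close> the others after division by f^(j+1). The relation says that
    f^j (f S2 + S1) lies in I; cancelling f^j leaves \<open>S1\<close> as a relation modulo
    \<open>adj I f\<close> for the tail of the sequence.\<close>
  define S1 where "S1 = (\<Sum>al\<in>A1. c al * mpow fs (tl al) * u)"
  define S2 where "S2 = (\<Sum>al\<in>A - A1. c al * f ^ (hd al - Suc j) * mpow fs (tl al) * u)"
  have mp: "mpow (f # fs) al = f ^ hd al * mpow fs (tl al)" if "al \<in> A" for al
    using len[OF that] by (cases al) auto
  have S1: "S1 \<in> R" and S2: "S2 \<in> R"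
    unfolding S1_def S2_def A1_def using Cons.prems fs f mpow_mem by (auto intro!: sum_mem mult_mem)
  have "(\<Sum>al\<in>A. c al * mpow (f # fs) al * u) =
      (\<Sum>al\<in>A - A1. c al * mpow (f # fs) al * u) + (\<Sum>al\<in>A1. c al * mpow (f # fs) al * u)"
    using fin by (intro sum.subset_diff) (auto simp: A1_def)
  also have "(\<Sum>al\<in>A1. c al * mpow (f # fs) al * u) = f ^ j * S1"
    unfolding S1_def sum_distrib_left by (rule sum.cong) (auto simp: mp A1_def mult_ac)
  also have "(\<Sum>al\<in>A - A1. c al * mpow (f # fs) al * u) = f ^ j * (f * S2)"
    unfolding S2_def sum_distrib_left
  proof (rule sum.cong)
    fix al assume al: "al \<in> A - A1"
    then have "hd al = j + 1 + (hd al - Suc j)" using jle[of al] by (auto simp: A1_def)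
    then have "f ^ hd al = f ^ j * f * f ^ (hd al - Suc j)"
      by (metis power_add power_one_right)
    then show "c al * mpow (f # fs) al * u =
        f ^ j * (f * (c al * f ^ (hd al - Suc j) * mpow fs (tl al) * u))"
      using al by (simp add: mp mult_ac)
  qed simp
  finally have "f ^ j * (f * S2 + S1) \<in> I"
    using Cons.prems(10) by (simp add: algebra_simps)
  then have "f * S2 + S1 \<in> I"
    using nzd_power[OF nzd f, of j] S1 S2 f by (simp add: nzd_def)
  then have "f * S2 + S1 \<in> adj I f" using subset_adj[of I f] by blast
  moreover have "f * S2 \<in> adj I f" using S2 I by (rule mult_mem_adj[rotated])
  ultimately have S1I: "S1 \<in> adj I f"
    using ideal_diff[OF is_ideal_adj[OF I f], of "f * S2 + S1" "f * S2"] by simp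
  have inj: "inj_on tl A1"
  proof (rule inj_onI)
    fix a b assume "a \<in> A1" "b \<in> A1" "tl a = tl b"
    then show "a = b" using len[of a] len[of b] by (cases a; cases b) (auto simp: A1_def)
  qed
  have hdtl: "j # tl al = al" if "al \<in> A1" for al
    using that len[of al] by (cases al) (auto simp: A1_def)
  have S1': "S1 = (\<Sum>be\<in>tl ` A1. c (j # be) * mpow fs be * u)"
    unfolding S1_def sum.reindex[OF inj] by (rule sum.cong) (auto simp: hdtl)
  have "u \<in> gen (adj I f) fs"
  proof (rule Cons.IH[of "adj I f" "tl ` A1" "\<lambda>be. c (j # be)"])
    show "tl ` A1 \<noteq> {}" using \<open>j \<in> hd ` A\<close> by (auto simp: A1_def)
    show "(\<Sum>al\<in>tl ` A1. c (j # al) * mpow fs al * u) \<in> adj I f" using S1I S1' by simp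
    show "finite (tl ` A1)" using fin by (auto simp: A1_def)
    show "length al = length fs" if "al \<in> tl ` A1" for al
      using that len by (auto simp: A1_def)
    have mem: "j # be \<in> A" if "be \<in> tl ` A1" for be
      using that hdtl by (auto simp: A1_def)
    show "c (j # al) \<in> R" "\<exists>d\<in>R. d * c (j # al) = 1" if "al \<in> tl ` A1" for al
      using mem[OF that] Cons.prems(7,8) by blast+
  qed (use I f fs u Cons.prems in \<open>auto intro: is_ideal_adj\<close>)
  then show ?case by simp
qed

end

text \<open>Gaussian elimination: the equation \<open>j\<close>, solved for an unknown
  \<open>p\<close> with nonzero coefficient, is substituted into the others, which leaves one
  equation and one unknown fewer.\<close>

lemma homogeneous_system_solution:
  fixes a :: "'i \<Rightarrow> 'j \<Rightarrow> 'k::field"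
  assumes "finite B" "finite A" "card B < card A"
  shows "\<exists>c. (\<exists>i\<in>A. c i \<noteq> 0) \<and> (\<forall>j\<in>B. (\<Sum>i\<in>A. c i * a i j) = 0)"
  using assms
proof (induction B arbitrary: A a rule: finite_induct)
  case empty
  then have "A \<noteq> {}" by auto
  then show ?case by (intro exI[of _ "\<lambda>_. 1"]) auto
next
  case (insert j B)
  show ?case
  proof (cases "\<forall>i\<in>A. a i j = 0")
    case True
    from insert have "card B < card A" by auto
    from insert.IH[OF insert.prems(1) this, of a] True show ?thesis by auto
  next
    case False
    then obtain p where p: "p \<in> A" "a p j \<noteq> 0" by auto
    have cA: "card B < card (A - {p})" using insert p by auto
    define a' where "a' i l = a i l - a i j * a p l / a p j" for i l
    obtain c where c: "\<exists>i\<in>A - {p}. c i \<noteq> 0" "\<forall>l\<in>B. (\<Sum>i\<in>A - {p}. c i * a' i l) = 0"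
      using insert.IH[OF _ cA, of a'] insert.prems by auto
    define s where "s = (\<Sum>i\<in>A - {p}. c i * a i j)"
    define c' where "c' = c(p := - s / a p j)"
    have eq: "(\<Sum>i\<in>A. c' i * a i l) = - s * a p l / a p j + (\<Sum>i\<in>A - {p}. c i * a i l)" for l
      using p insert.prems by (simp add: sum.remove[of A p] c'_def)
    have "(\<Sum>i\<in>A. c' i * a i l) = 0" if "l \<in> B" for l
    proof -
      have "0 = (\<Sum>i\<in>A - {p}. c i * a i l - c i * a i j * (a p l / a p j))"
        using c(2) that by (simp add: a'_def algebra_simps)
      also have "\<dots> = (\<Sum>i\<in>A - {p}. c i * a i l) - s * (a p l / a p j)"
        by (simp add: sum_subtractf s_def sum_distrib_right sum_divide_distrib)
      finally show ?thesis by (simp add: eq)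
    qed
    moreover have "(\<Sum>i\<in>A. c' i * a i j) = 0"
      using p by (simp add: eq s_def)
    moreover have "\<exists>i\<in>A. c' i \<noteq> 0" using c(1) by (auto simp: c'_def)
    ultimately show ?thesis by blast
  qed
qed


section \<open>Stanley--Reisner ideals and elementary symmetric polynomials\<close>

lemma keys_plus_nat: "Poly_Mapping.keys (a + b) = Poly_Mapping.keys a \<union> Poly_Mapping.keys b"
  for a b :: "'v \<Rightarrow>\<^sub>0 nat"
  by (auto simp: in_keys_iff lookup_add)

lemma poly_mapping_sum_single:
  "p = (\<Sum>t\<in>Poly_Mapping.keys p. Poly_Mapping.single t (Poly_Mapping.lookup p t))"
  by (rule poly_mapping_eqI)
     (auto simp: lookup_sum lookup_single when_def in_keys_iff sum.delta if_distrib)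

lemma lookup_mult_finite:
  fixes p q :: "'a::comm_monoid_add \<Rightarrow>\<^sub>0 'b::comm_semiring_0"
  assumes "finite A" "Poly_Mapping.keys p \<subseteq> A" "finite B" "Poly_Mapping.keys q \<subseteq> B"
  shows "Poly_Mapping.lookup (p * q) k =
    (\<Sum>a\<in>A. \<Sum>b\<in>B. (Poly_Mapping.lookup p a * Poly_Mapping.lookup q b when a + b = k))"
proof -
  have ext: "r = (\<Sum>t\<in>C. Poly_Mapping.single t (Poly_Mapping.lookup r t))"
    if "finite C" "Poly_Mapping.keys r \<subseteq> C" for C and r :: "'a \<Rightarrow>\<^sub>0 'b"
    by (subst poly_mapping_sum_single, rule sum.mono_neutral_left) (use that in \<open>auto simp: in_keys_iff\<close>)
  have "p * q = (\<Sum>a\<in>A. \<Sum>b\<in>B.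
      Poly_Mapping.single (a + b) (Poly_Mapping.lookup p a * Poly_Mapping.lookup q b))"
    by (subst ext[OF assms(1,2)], subst ext[OF assms(3,4)]) (simp add: sum_product mult_single)
  then show ?thesis
    by (simp add: lookup_sum lookup_single)
qed

text \<open>If \<open>a + b\<close> arises from the two supports in one way only, nothing can cancel
  there. This serves for multiplication by a variable and for products of leading terms.\<close>

lemma lookup_mult_unique:
  fixes p q :: "'a::comm_monoid_add \<Rightarrow>\<^sub>0 'b::comm_semiring_0"
  assumes "a \<in> Poly_Mapping.keys p" "b \<in> Poly_Mapping.keys q"
    and "\<And>a' b'. a' \<in> Poly_Mapping.keys p \<Longrightarrow> b' \<in> Poly_Mapping.keys q \<Longrightarrow> a' + b' = a + b \<Longrightarrow> a' = a \<and> b' = b"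
  shows "Poly_Mapping.lookup (p * q) (a + b) = Poly_Mapping.lookup p a * Poly_Mapping.lookup q b"
proof -
  have "Poly_Mapping.lookup (p * q) (a + b) = (\<Sum>a'\<in>Poly_Mapping.keys p. \<Sum>b'\<in>Poly_Mapping.keys q.
      (Poly_Mapping.lookup p a' * Poly_Mapping.lookup q b' when a' + b' = a + b))"
    by (rule lookup_mult_finite) auto
  also have "\<dots> = (\<Sum>a'\<in>Poly_Mapping.keys p. if a' = a then \<Sum>b'\<in>Poly_Mapping.keys q.
      if b' = b then Poly_Mapping.lookup p a * Poly_Mapping.lookup q b else 0 else 0)"
  proof (rule sum.cong[OF refl])
    fix a' assume a': "a' \<in> Poly_Mapping.keys p"
    show "(\<Sum>b'\<in>Poly_Mapping.keys q.
        (Poly_Mapping.lookup p a' * Poly_Mapping.lookup q b' when a' + b' = a + b)) =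
      (if a' = a then \<Sum>b'\<in>Poly_Mapping.keys q.
        if b' = b then Poly_Mapping.lookup p a * Poly_Mapping.lookup q b else 0 else 0)"
    proof (cases "a' = a")
      case True
      have "(\<Sum>b'\<in>Poly_Mapping.keys q.
          (Poly_Mapping.lookup p a' * Poly_Mapping.lookup q b' when a' + b' = a + b)) =
        (\<Sum>b'\<in>Poly_Mapping.keys q.
          if b' = b then Poly_Mapping.lookup p a * Poly_Mapping.lookup q b else 0)"
        by (rule sum.cong) (use True assms(3)[OF a'] in \<open>auto simp: when_def\<close>)
      with True show ?thesis by simp
    next
      case False
      then have "a' + b' \<noteq> a + b" if "b' \<in> Poly_Mapping.keys q" for b'
        using assms(3)[OF a' that] by blast
      with False show ?thesis by (simp add: when_def)
    qed
  qed
  also have "\<dots> = Poly_Mapping.lookup p a * Poly_Mapping.lookup q b"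
    using assms(1,2) by simp
  finally show ?thesis .
qed

text \<open>The carrier is a subset of the type, so that arithmetic stays with the type class and
  only closure depends on \<open>V\<close>.\<close>

interpretation mp: ring_carrier "polys_in V :: ('v, 'k::field) mpoly set" for V
proof -
  interpret R: cring "mpoly_ring V :: ('v, 'k) mpoly ring"
    by (rule cring_mpoly_ring)
  show "ring_carrier (polys_in V :: ('v, 'k) mpoly set)"
  proof
    show "0 \<in> (polys_in V :: ('v, 'k) mpoly set)" "1 \<in> (polys_in V :: ('v, 'k) mpoly set)"
      using R.zero_closed R.one_closed by (simp_all add: mpoly_ring_def)
    show "a + b \<in> polys_in V" "a * b \<in> polys_in V"
      if "a \<in> polys_in V" "b \<in> polys_in V" for a b :: "('v, 'k) mpoly"
      using that R.a_closed[of a b] R.m_closed[of a b] by (simp_all add: mpoly_ring_def)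
    show "- a \<in> polys_in V" if "a \<in> polys_in V" for a :: "('v, 'k) mpoly"
      using that by (simp add: polys_in_def)
  qed
qed

lemma single_mem_polys_in:
  "Poly_Mapping.keys t \<subseteq> V \<Longrightarrow> Poly_Mapping.single t c \<in> polys_in V"
  by (auto simp: polys_in_def)

lemma indet_mem: "x \<in> V \<Longrightarrow> indet x \<in> polys_in V"
  unfolding indet_def monomial_def by (rule single_mem_polys_in) simp

lemma mem_ideal_if_terms:
  assumes "mp.is_ideal V J"
    and "\<And>t. t \<in> Poly_Mapping.keys p \<Longrightarrow> Poly_Mapping.single t (Poly_Mapping.lookup p t) \<in> J"
  shows "p \<in> J"
  by (subst poly_mapping_sum_single) (rule mp.ideal_sum[OF assms])

text \<open>An ideal if \<open>T\<close> is stable under adding exponents; membership is a condition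
  on single terms.\<close>

definition mono_ideal :: "'v set \<Rightarrow> ('v \<Rightarrow>\<^sub>0 nat) set \<Rightarrow> ('v, 'k::field) mpoly set" where
  "mono_ideal V T = {p \<in> polys_in V. Poly_Mapping.keys p \<subseteq> T}"

lemma is_ideal_mono_ideal:
  assumes "\<And>s t. t \<in> T \<Longrightarrow> s + t \<in> T"
  shows "mp.is_ideal V (mono_ideal V T)"
proof -
  have add: "a + b \<in> mono_ideal V T" if "a \<in> mono_ideal V T" "b \<in> mono_ideal V T" for a b
    using that Poly_Mapping.keys_add[of a b] by (auto simp: mono_ideal_def)
  have mult: "r * a \<in> mono_ideal V T" if "r \<in> polys_in V" "a \<in> mono_ideal V T" for r a
  proof -
    have "Poly_Mapping.keys (r * a) \<subseteq> T"
    proof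
      fix t assume "t \<in> Poly_Mapping.keys (r * a)"
      then obtain s t' where "s \<in> Poly_Mapping.keys r" "t' \<in> Poly_Mapping.keys a" "t = s + t'"
        using Poly_Mapping.keys_mult[of r a] by blast
      then show "t \<in> T" using that assms by (auto simp: mono_ideal_def)
    qed
    then show ?thesis using that by (simp add: mono_ideal_def)
  qed
  show ?thesis
    unfolding mp.is_ideal_def
  proof (intro conjI ballI)
    show "mono_ideal V T \<subseteq> polys_in V" "0 \<in> mono_ideal V T"
      by (auto simp: mono_ideal_def)
  qed (fact add mult)+
qed

text \<open>The span of the monomials whose support is no face. The void complex \<open>{}\<close>
  gives the unit ideal, in contrast to \<open>{{}}\<close>, which gives the ideal of all variables
  in \<open>V\<close>.\<close>

definition sr_ideal :: "'v set \<Rightarrow> 'v set set \<Rightarrow> ('v, 'k::field) mpoly set" where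
  "sr_ideal V D = mono_ideal V {t. Poly_Mapping.keys t \<notin> D}"

definition down_closed :: "'v set set \<Rightarrow> bool" where
  "down_closed D \<longleftrightarrow> (\<forall>A\<in>D. \<forall>B. B \<subseteq> A \<longrightarrow> B \<in> D)"

text \<open>The star and not the link: the colon ideal (I : x) lives in the same ring, where
  \<open>x\<close> becomes a cone point.\<close>

definition star :: "'v \<Rightarrow> 'v set set \<Rightarrow> 'v set set" where
  "star x D = {W. insert x W \<in> D}"

definition del :: "'v \<Rightarrow> 'v set set \<Rightarrow> 'v set set" where
  "del x D = {W \<in> D. x \<notin> W}"

lemma mem_sr_ideal_iff:
  "p \<in> sr_ideal V D \<longleftrightarrow> p \<in> polys_in V \<and> (\<forall>t\<in>Poly_Mapping.keys p. Poly_Mapping.keys t \<notin> D)"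
  by (auto simp: sr_ideal_def mono_ideal_def)

lemma is_ideal_sr_ideal: "down_closed D \<Longrightarrow> mp.is_ideal V (sr_ideal V D)"
  unfolding sr_ideal_def
  by (rule is_ideal_mono_ideal) (auto simp: keys_plus_nat down_closed_def)

lemma down_closed_Pow [simp]: "down_closed (Pow W)"
  by (auto simp: down_closed_def)

lemma down_closed_star: "down_closed D \<Longrightarrow> down_closed (star x D)"
proof (unfold down_closed_def, intro ballI allI impI)
  fix A B assume D: "\<forall>A\<in>D. \<forall>B. B \<subseteq> A \<longrightarrow> B \<in> D" and "A \<in> star x D" "B \<subseteq> A"
  then have "insert x A \<in> D" "insert x B \<subseteq> insert x A" by (auto simp: star_def)
  with D show "B \<in> star x D" by (simp add: star_def)
qed

lemma down_closed_del: "down_closed D \<Longrightarrow> down_closed (del x D)"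
  unfolding down_closed_def del_def by blast

lemma star_Pow: "x \<in> W \<Longrightarrow> star x (Pow W) = Pow W"
  by (auto simp: star_def)

lemma del_Pow: "del x (Pow W) = Pow (W - {x})"
  by (auto simp: del_def)

lemma keys_indet_mult:
  "Poly_Mapping.keys (indet x * p) = (+) (Poly_Mapping.single x 1) ` Poly_Mapping.keys p"
  for p :: "('v, 'k::field) mpoly"
proof
  show "Poly_Mapping.keys (indet x * p) \<subseteq> (+) (Poly_Mapping.single x 1) ` Poly_Mapping.keys p"
    using Poly_Mapping.keys_mult[of "indet x" p] by (auto simp: indet_def monomial_def)
  show "(+) (Poly_Mapping.single x 1) ` Poly_Mapping.keys p \<subseteq> Poly_Mapping.keys (indet x * p)"
  proof
    fix t assume "t \<in> (+) (Poly_Mapping.single x 1) ` Poly_Mapping.keys p"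
    then obtain s where s: "s \<in> Poly_Mapping.keys p" "t = Poly_Mapping.single x 1 + s" by auto
    have "Poly_Mapping.lookup (indet x * p) (Poly_Mapping.single x 1 + s) =
        Poly_Mapping.lookup (indet x :: ('v, 'k) mpoly) (Poly_Mapping.single x 1) * Poly_Mapping.lookup p s"
      by (rule lookup_mult_unique) (use s in \<open>auto simp: indet_def monomial_def\<close>)
    with s show "t \<in> Poly_Mapping.keys (indet x * p)"
      by (simp add: in_keys_iff indet_def monomial_def)
  qed
qed

lemma colon_sr_ideal:
  assumes "x \<in> V"
  shows "mp.colon V (sr_ideal V D) (indet x) = sr_ideal V (star x D)"
proof -
  have "indet x * u \<in> polys_in V" if "u \<in> polys_in V" for u :: "('a, 'b) mpoly"
    using that assms by (simp add: indet_mem)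
  then show ?thesis
    by (auto simp: mp.colon_def mem_sr_ideal_iff star_def keys_indet_mult keys_plus_nat)
qed

text \<open>A monomial supported on a nonface of \<open>del x D\<close> is divisible by
  \<open>x\<close> or is supported on a nonface of \<open>D\<close>.\<close>

lemma adj_sr_ideal:
  assumes "x \<in> V" and D: "down_closed D"
  shows "mp.adj V (sr_ideal V D) (indet x) = sr_ideal V (del x D)"
proof
  note I = is_ideal_sr_ideal[OF D, of V] and I' = is_ideal_sr_ideal[OF down_closed_del[OF D, of x], of V]
  show "mp.adj V (sr_ideal V D) (indet x) \<subseteq> sr_ideal V (del x D)"
  proof (rule mp.adj_minimal[OF I'])
    show "sr_ideal V D \<subseteq> sr_ideal V (del x D)" by (auto simp: mem_sr_ideal_iff del_def)
    show "indet x \<in> sr_ideal V (del x D)"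
      using indet_mem[OF assms(1)] by (auto simp: mem_sr_ideal_iff del_def indet_def monomial_def)
  qed
  show "sr_ideal V (del x D) \<subseteq> mp.adj V (sr_ideal V D) (indet x)"
  proof
    fix p assume p: "p \<in> sr_ideal V (del x D)"
    show "p \<in> mp.adj V (sr_ideal V D) (indet x)"
    proof (rule mem_ideal_if_terms)
      show "mp.is_ideal V (mp.adj V (sr_ideal V D) (indet x))"
        using I assms by (intro mp.is_ideal_adj indet_mem)
      fix t assume t: "t \<in> Poly_Mapping.keys p"
      then have tV: "Poly_Mapping.keys t \<subseteq> V" using p by (auto simp: mem_sr_ideal_iff polys_in_def)
      let ?c = "Poly_Mapping.lookup p t"
      show "Poly_Mapping.single t ?c \<in> mp.adj V (sr_ideal V D) (indet x)"
      proof (cases "x \<in> Poly_Mapping.keys t")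
        case True
        define s where "s = t - Poly_Mapping.single x 1"
        have ts: "t = Poly_Mapping.single x 1 + s"
          by (rule poly_mapping_eqI)
             (use True in \<open>auto simp: s_def lookup_add lookup_minus lookup_single when_def in_keys_iff\<close>)
        then have "Poly_Mapping.keys s \<subseteq> V" using tV by (auto simp: keys_plus_nat)
        moreover have "Poly_Mapping.single t ?c = indet x * Poly_Mapping.single s ?c"
          by (simp add: indet_def monomial_def mult_single ts[symmetric] del: One_nat_def)
        ultimately show ?thesis
          by (simp only: mp.mult_mem_adj[OF I single_mem_polys_in])
      next
        case False
        then have "Poly_Mapping.keys t \<notin> D" using p t by (auto simp: mem_sr_ideal_iff del_def)
        then have "Poly_Mapping.single t ?c \<in> sr_ideal V D"
          using single_mem_polys_in[OF tV] by (auto simp: mem_sr_ideal_iff)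
        then show ?thesis using mp.subset_adj by blast
      qed
    qed
  qed
qed

text \<open>The equation \<open>star x D = D\<close> says that \<open>D\<close> is a cone with apex
  \<open>x\<close>.\<close>

lemma nzd_sr_ideal:
  assumes "x \<in> V" "down_closed D" "star x D = D"
  shows "mp.nzd V (sr_ideal V D) (indet x)"
  using assms mp.nzd_iff_colon[OF is_ideal_sr_ideal indet_mem] colon_sr_ideal by metis

section \<open>Grading by total degree\<close>

definition tdeg :: "'v set \<Rightarrow> ('v \<Rightarrow>\<^sub>0 nat) \<Rightarrow> nat" where
  "tdeg V t = (\<Sum>x\<in>V. Poly_Mapping.lookup t x)"

lemma tdeg_add: "tdeg V (s + t) = tdeg V s + tdeg V t"
  by (simp add: tdeg_def lookup_add sum.distrib)

definition hcomp :: "'v set \<Rightarrow> nat \<Rightarrow> ('v, 'k::field) mpoly \<Rightarrow> ('v, 'k) mpoly" where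
  "hcomp V d = Poly_Mapping.mapp (\<lambda>t c. c when tdeg V t = d)"

lemma lookup_hcomp: "Poly_Mapping.lookup (hcomp V d p) t = (Poly_Mapping.lookup p t when tdeg V t = d)"
  by (auto simp: hcomp_def lookup_mapp in_keys_iff when_def)

lemma keys_hcomp: "Poly_Mapping.keys (hcomp V d p) = {t \<in> Poly_Mapping.keys p. tdeg V t = d}"
  by (auto simp: in_keys_iff lookup_hcomp)

lemma hcomp_mem: "p \<in> polys_in V \<Longrightarrow> hcomp V d p \<in> polys_in V"
  by (auto simp: polys_in_def keys_hcomp)

lemma hcomp_add: "hcomp V d (p + q) = hcomp V d p + hcomp V d q"
  by (rule poly_mapping_eqI) (simp add: lookup_hcomp lookup_add when_def)

definition homogeneous :: "'v set \<Rightarrow> nat \<Rightarrow> ('v, 'k::field) mpoly \<Rightarrow> bool" where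
  "homogeneous V d p \<longleftrightarrow> (\<forall>t\<in>Poly_Mapping.keys p. tdeg V t = d)"

lemma hcomp_mult:
  assumes "homogeneous V e f"
  shows "hcomp V d (f * p) = (if e \<le> d then f * hcomp V (d - e) p else 0)"
proof (rule poly_mapping_eqI)
  fix k
  have "Poly_Mapping.lookup (hcomp V d (f * p)) k = (\<Sum>a\<in>Poly_Mapping.keys f. \<Sum>b\<in>Poly_Mapping.keys p.
      (Poly_Mapping.lookup f a * Poly_Mapping.lookup p b when a + b = k \<and> tdeg V k = d))"
    unfolding lookup_hcomp by (subst lookup_mult_finite[of "Poly_Mapping.keys f" _ "Poly_Mapping.keys p"])
      (auto simp: when_def intro!: sum.cong)
  also have "\<dots> = (\<Sum>a\<in>Poly_Mapping.keys f. \<Sum>b\<in>Poly_Mapping.keys p.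
      (Poly_Mapping.lookup f a * Poly_Mapping.lookup (hcomp V (d - e) p) b when a + b = k \<and> e \<le> d))"
    using assms by (intro sum.cong refl) (auto simp: when_def lookup_hcomp homogeneous_def tdeg_add)
  also have "\<dots> = Poly_Mapping.lookup (if e \<le> d then f * hcomp V (d - e) p else 0) k"
    by (cases "e \<le> d", simp_all,
        subst lookup_mult_finite[of "Poly_Mapping.keys f" _ "Poly_Mapping.keys p"])
       (auto simp: when_def keys_hcomp)
  finally show "Poly_Mapping.lookup (hcomp V d (f * p)) k =
      Poly_Mapping.lookup (if e \<le> d then f * hcomp V (d - e) p else 0) k" .
qed

definition homogeneous_ideal :: "'v set \<Rightarrow> ('v, 'k::field) mpoly set \<Rightarrow> bool" where
  "homogeneous_ideal V J \<longleftrightarrow> mp.is_ideal V J \<and> (\<forall>p\<in>J. \<forall>d. hcomp V d p \<in> J)"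

lemma homogeneous_ideal_sr_ideal: "down_closed D \<Longrightarrow> homogeneous_ideal V (sr_ideal V D)"
  unfolding homogeneous_ideal_def
  by (auto simp: is_ideal_sr_ideal mem_sr_ideal_iff hcomp_mem keys_hcomp)

lemma homogeneous_ideal_adj:
  assumes J: "homogeneous_ideal V J" and f: "f \<in> polys_in V" "homogeneous V e f"
  shows "homogeneous_ideal V (mp.adj V J f)"
  unfolding homogeneous_ideal_def
proof (intro conjI ballI allI)
  have I: "mp.is_ideal V J" using J by (simp add: homogeneous_ideal_def)
  then show "mp.is_ideal V (mp.adj V J f)" using f by (intro mp.is_ideal_adj)
  fix p d assume "p \<in> mp.adj V J f"
  then obtain a b where p: "a \<in> J" "b \<in> polys_in V" "p = a + f * b" by (elim mp.adjE)
  have "hcomp V d a \<in> J" using J p by (simp add: homogeneous_ideal_def)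
  moreover have "hcomp V d p = hcomp V d a + f * (if e \<le> d then hcomp V (d - e) b else 0)"
    using p f by (simp add: hcomp_add hcomp_mult)
  moreover have "(if e \<le> d then hcomp V (d - e) b else 0) \<in> polys_in V"
    using p by (simp add: hcomp_mem)
  ultimately show "hcomp V d p \<in> mp.adj V J f"
    by (simp only: mp.adjI)
qed

lemma homogeneous_ideal_gen:
  assumes "homogeneous_ideal V J" "\<And>f. f \<in> set fs \<Longrightarrow> f \<in> polys_in V \<and> (\<exists>e. homogeneous V e f)"
  shows "homogeneous_ideal V (mp.gen V J fs)"
  using assms
proof (induction fs arbitrary: J)
  case (Cons f fs)
  from Cons.prems(2)[of f] obtain e where "f \<in> polys_in V" "homogeneous V e f" by auto
  then show ?case using Cons by (auto intro!: Cons.IH homogeneous_ideal_adj)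
qed simp

lemma mem_ideal_if_hcomp:
  assumes "mp.is_ideal V J" "\<And>d. hcomp V d p \<in> J"
  shows "p \<in> J"
proof -
  have "p = (\<Sum>d\<in>tdeg V ` Poly_Mapping.keys p. hcomp V d p)"
    by (rule poly_mapping_eqI)
       (auto simp: lookup_sum lookup_hcomp when_def sum.delta in_keys_iff image_iff)
  also have "\<dots> \<in> J" using assms by (intro mp.ideal_sum)
  finally show ?thesis .
qed

lemma homogeneous_indet: "finite V \<Longrightarrow> x \<in> V \<Longrightarrow> homogeneous V 1 (indet x)"
  by (auto simp: homogeneous_def indet_def monomial_def tdeg_def lookup_single when_def sum.delta)

text \<open>A form of graded Nakayama: dividing a relation modulo \<open>J\<close> by \<open>x\<close> lowers its degree.\<close>

lemma nzd_if_nzd_adj: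
  assumes V: "finite V" and x: "x \<in> V" and J: "homogeneous_ideal V J"
    and f: "f \<in> polys_in V" "homogeneous V e f"
    and nzx: "mp.nzd V J (indet x)" and nzf: "mp.nzd V (mp.adj V J (indet x)) f"
  shows "mp.nzd V J f"
proof -
  have I: "mp.is_ideal V J" and hJ: "\<And>p d. p \<in> J \<Longrightarrow> hcomp V d p \<in> J"
    using J by (auto simp: homogeneous_ideal_def)
  have hx: "homogeneous V 1 (indet x)" using V x by (rule homogeneous_indet)
  have hcomp_case: "hcomp V d u \<in> J" if "u \<in> polys_in V" "f * hcomp V d u \<in> J" for d u
    using that
  proof (induction d arbitrary: u)
    case (0 u)
    have "hcomp V 0 u \<in> mp.adj V J (indet x)"
      using nzf 0 mp.subset_adj[of J V "indet x"] hcomp_mem[OF 0(1)] by (auto simp: mp.nzd_def)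
    then obtain a v where a: "a \<in> J" "v \<in> polys_in V" "hcomp V 0 u = a + indet x * v" by (elim mp.adjE)
    have "hcomp V 0 u = hcomp V 0 (hcomp V 0 u)" by (rule poly_mapping_eqI) (simp add: lookup_hcomp when_def)
    \<comment> \<open>A multiple of \<open>indet x\<close> has no component of degree 0, which
      starts the induction.\<close>
    also have "\<dots> = hcomp V 0 a" using a(3) hcomp_mult[OF hx, of 0] by (simp add: hcomp_add)
    also have "\<dots> \<in> J" using a hJ by simp
    finally show ?case .
  next
    case (Suc d u)
    have "hcomp V (Suc d) u \<in> mp.adj V J (indet x)"
      using nzf Suc.prems mp.subset_adj[of J V "indet x"] hcomp_mem[OF Suc.prems(1)] by (auto simp: mp.nzd_def)
    then obtain a v where a: "a \<in> J" "v \<in> polys_in V" "hcomp V (Suc d) u = a + indet x * v" by (elim mp.adjE)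
    have "hcomp V (Suc d) u = hcomp V (Suc d) (hcomp V (Suc d) u)"
      by (rule poly_mapping_eqI) (simp add: lookup_hcomp when_def)
    also have "\<dots> = hcomp V (Suc d) a + indet x * hcomp V d v"
      using a(3) hcomp_mult[OF hx, of "Suc d"] by (simp add: hcomp_add)
    finally have u: "hcomp V (Suc d) u = hcomp V (Suc d) a + indet x * hcomp V d v" .
    \<comment> \<open>Multiplying by \<open>f\<close> and cancelling \<open>indet x\<close> modulo
      \<open>J\<close> brings the component of degree \<open>d\<close> of \<open>v\<close> under the
      induction hypothesis.\<close>
    have "indet x * (f * hcomp V d v) = f * hcomp V (Suc d) u - f * hcomp V (Suc d) a"
      using u by (simp add: algebra_simps)
    also have "\<dots> \<in> J"
      by (rule mp.ideal_diff[OF I Suc.prems(2) mp.ideal_mult[OF I f(1) hJ[OF a(1)]]])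
    finally have "f * hcomp V d v \<in> J"
      using nzx f hcomp_mem[OF a(2)] by (auto simp: mp.nzd_def)
    from Suc.IH[OF a(2) this] have "indet x * hcomp V d v \<in> J"
      by (rule mp.ideal_mult[OF I indet_mem[OF x]])
    then show ?case unfolding u by (rule mp.ideal_add[OF I hJ[OF a(1)]])
  qed
  show ?thesis
    unfolding mp.nzd_def
  proof (intro ballI impI)
    fix u assume u: "u \<in> polys_in V" "f * u \<in> J"
    show "u \<in> J"
    proof (rule mem_ideal_if_hcomp[OF I])
      fix d
      have "hcomp V (e + d) (f * u) \<in> J" using u hJ by simp
      then show "hcomp V d u \<in> J" using hcomp_mult[OF f(2), of "e + d" u] hcomp_case[OF u(1)] by simp
    qed
  qed
qed

section \<open>Elementary symmetric polynomials\<close>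

definition ind :: "'v set \<Rightarrow> ('v \<Rightarrow>\<^sub>0 nat)" where
  "ind S = (\<Sum>x\<in>S. Poly_Mapping.single x 1)"

lemma lookup_ind: "finite S \<Longrightarrow> Poly_Mapping.lookup (ind S) x = (if x \<in> S then 1 else 0)"
  by (simp add: ind_def lookup_sum lookup_single when_def)

lemma keys_ind: "finite S \<Longrightarrow> Poly_Mapping.keys (ind S) = S"
  by (simp add: set_eq_iff in_keys_iff lookup_ind)

lemma tdeg_ind: "finite V \<Longrightarrow> S \<subseteq> V \<Longrightarrow> tdeg V (ind S) = card S"
  using finite_subset[of S V] by (simp add: tdeg_def lookup_ind sum.If_cases Int_absorb1)

lemma monomial_add: "monomial (s + t) = monomial s * monomial t"
  by (simp add: monomial_def mult_single)

lemma monomial_zero: "monomial 0 = 1"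
  by (simp add: monomial_def)

lemma monomial_ind: "monomial (ind S) = (\<Prod>x\<in>S. indet x)"
  unfolding ind_def indet_def
  by (induction S rule: infinite_finite_induct)
     (simp_all add: monomial_add monomial_zero del: One_nat_def)

definition esym :: "'v set \<Rightarrow> nat \<Rightarrow> ('v, 'k::field) mpoly" where
  "esym V i = (\<Sum>S | S \<subseteq> V \<and> card S = i. monomial (ind S))"

lemma esym_mem: "finite V \<Longrightarrow> esym V i \<in> polys_in V"
  unfolding esym_def monomial_def
  by (intro mp.sum_mem single_mem_polys_in) (auto simp: keys_ind finite_subset)

lemma homogeneous_esym: "finite V \<Longrightarrow> homogeneous V i (esym V i)"
  unfolding homogeneous_def esym_def
  by (auto simp: monomial_def tdeg_ind dest!: subsetD[OF keys_sum])

text \<open>Every other subset of the same size leaves \<open>W\<close>, so its monomial vanishes in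
  K[W].\<close>

lemma esym_card:
  assumes V: "finite V" and W: "W \<subseteq> V"
  shows "esym V (card W) - (\<Prod>x\<in>W. indet x) \<in> sr_ideal V (Pow W)"
proof -
  let ?A = "{S. S \<subseteq> V \<and> card S = card W}"
  have "finite ?A" using V by simp
  then have "esym V (card W) - (\<Prod>x\<in>W. indet x) = (\<Sum>S\<in>?A - {W}. monomial (ind S))"
    using W by (simp add: esym_def monomial_ind sum.remove[of ?A W])
  also have "\<dots> \<in> sr_ideal V (Pow W)"
  proof (rule mp.ideal_sum[OF is_ideal_sr_ideal[OF down_closed_Pow]])
    fix S assume S: "S \<in> ?A - {W}"
    then have fin: "finite S" "finite W" using V W by (auto simp: finite_subset)
    then have "\<not> S \<subseteq> W" using S card_subset_eq[of W S] by auto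
    then show "monomial (ind S) \<in> sr_ideal V (Pow W)"
      using S fin by (auto simp: mem_sr_ideal_iff monomial_def keys_ind intro!: single_mem_polys_in)
  qed
  finally show ?thesis .
qed

text \<open>Induction on \<open>card W\<close>; dividing by a variable x of \<open>W\<close> turns
  K[W] into K[W - {x}]. There e_1, ..., e_i are regular for i < card W, so by \<open>nzd_gen\<close>
  each variable of \<open>W\<close> is a nonzerodivisor modulo e_1, ..., e_i. If i + 1 = card W,
  then e_(i+1) is the product of these variables in K[W]. Otherwise it is a nonzerodivisor on
  K[W - {x}] modulo the earlier entries, which lifts to K[W] by
  \<open>nzd_if_nzd_adj\<close>.\<close>

lemma wreg_esym_Pow:
  assumes V: "finite V" and "W \<subseteq> V" "r \<le> card W"
  shows "mp.wreg V (sr_ideal V (Pow W) :: ('v, 'k::field) mpoly set) (map (esym V) [1..<Suc r])"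
  using assms(2,3)
proof (induction "card W" arbitrary: W r rule: less_induct)
  case less
  let ?P = "sr_ideal V (Pow W) :: ('v, 'k) mpoly set"
  have P: "mp.is_ideal V ?P" "homogeneous_ideal V ?P"
    by (simp_all add: is_ideal_sr_ideal homogeneous_ideal_sr_ideal)
  have finW: "finite W" using less V finite_subset by blast
  have es: "set (map (esym V) xs) \<subseteq> polys_in V" for xs using V esym_mem by auto
  show ?case using \<open>r \<le> card W\<close>
  proof (induction r)
    case (Suc i)
    let ?es = "map (esym V) [1..<Suc i] :: ('v, 'k) mpoly list"
    let ?Q = "mp.gen V ?P ?es"
    have sub: "mp.wreg V (mp.adj V ?P (indet x)) (map (esym V) [1..<Suc j])"
      if "x \<in> W" "j < card W" for x j
    proof -
      have "mp.wreg V (sr_ideal V (Pow (W - {x})) :: ('v, 'k) mpoly set) (map (esym V) [1..<Suc j])"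
        using that less.prems finW by (intro less.hyps) auto
      then show ?thesis using that less.prems by (auto simp: adj_sr_ideal del_Pow)
    qed
    have nzx: "mp.nzd V ?Q (indet x)" if "x \<in> W" for x
    proof (rule mp.nzd_gen)
      show "mp.nzd V ?P (indet x)"
        using that less.prems by (intro nzd_sr_ideal) (auto simp: star_Pow)
      show "mp.wreg V (mp.adj V ?P (indet x)) ?es"
        using sub[OF that, of i] Suc.prems by simp
      show "indet x \<in> polys_in V" using that less.prems by (auto simp: indet_mem)
    qed (rule P es)+
    have "mp.nzd V ?Q (esym V (Suc i))"
    proof (cases "Suc i = card W")
      case True
      have Q: "mp.is_ideal V ?Q" using P es by (intro mp.is_ideal_gen)
      have prod: "mp.nzd V ?Q (\<Prod>x\<in>W. indet x)"
        using nzx less.prems by (intro mp.nzd_prod) (auto simp: indet_mem)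
      have diff: "esym V (Suc i) - (\<Prod>x\<in>W. indet x) \<in> ?Q"
        using esym_card[OF V less.prems(1)] mp.subset_gen[of ?P V ?es] True by auto
      show ?thesis
        unfolding mp.nzd_def
      proof (intro ballI impI)
        fix u assume u: "u \<in> polys_in V" "esym V (Suc i) * u \<in> ?Q"
        have "(\<Prod>x\<in>W. indet x) * u = esym V (Suc i) * u - (esym V (Suc i) - (\<Prod>x\<in>W. indet x)) * u"
          by (simp add: algebra_simps)
        also have "\<dots> \<in> ?Q"
          by (rule mp.ideal_diff[OF Q u(2) mp.ideal_mult'[OF Q u(1) diff]])
        finally show "u \<in> ?Q" using prod u by (simp add: mp.nzd_def)
      qed
    next
      case False
      then have lt: "Suc i < card W" using Suc.prems by simp
      then obtain x where x: "x \<in> W" by fastforce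
      have "mp.nzd V (mp.gen V (mp.adj V ?P (indet x)) ?es) (esym V (Suc i))"
        using sub[OF x lt] by (simp add: mp.wreg_append)
      also have "mp.gen V (mp.adj V ?P (indet x)) ?es = mp.adj V ?Q (indet x)"
        using x less.prems by (intro mp.gen_adj P es indet_mem) auto
      finally have "mp.nzd V (mp.adj V ?Q (indet x)) (esym V (Suc i))" .
      moreover have "homogeneous_ideal V ?Q"
        using P V by (intro homogeneous_ideal_gen) (auto simp: esym_mem intro: homogeneous_esym)
      ultimately show ?thesis
        using nzd_if_nzd_adj[OF V _ _ esym_mem[OF V] homogeneous_esym[OF V] nzx[OF x]] x less.prems
        by blast
    qed
    then show ?case using Suc by (simp add: mp.wreg_append)
  qed simp
qed

text \<open>Akin to vertex decomposability, but with a size bound in place of purity and shedding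
  conditions, because the exact sequences only have to transport a lower bound. \<open>void\<close>
  covers the star of a vertex that lies in no face.\<close>

inductive decomposable :: "'v set \<Rightarrow> nat \<Rightarrow> 'v set set \<Rightarrow> bool" for V r where
  void: "decomposable V r {}"
| simplex: "W \<subseteq> V \<Longrightarrow> r \<le> card W \<Longrightarrow> decomposable V r (Pow W)"
| split: "x \<in> V \<Longrightarrow> decomposable V r (star x D) \<Longrightarrow> decomposable V r (del x D) \<Longrightarrow> decomposable V r D"

text \<open>\<open>colon_sr_ideal\<close> and \<open>adj_sr_ideal\<close> turn a split of the
  complex into the hypotheses of \<open>wreg_colon_adj\<close>.\<close>

lemma wreg_esym_decomposable:
  assumes "finite V" "decomposable V r D" "down_closed D"
  shows "mp.wreg V (sr_ideal V D :: ('v, 'k::field) mpoly set) (map (esym V) [1..<Suc r])"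
  using assms(2,3)
proof (induction rule: decomposable.induct)
  case void
  \<comment> \<open>Over the unit ideal the quotient is zero and every sequence is weakly regular;
    this is why properness is kept out of \<open>wreg\<close>.\<close>
  have top: "mp.wreg V (polys_in V) xs" if "set xs \<subseteq> polys_in V" for xs :: "('v, 'k) mpoly list"
    using that
  proof (induction xs)
    case (Cons f xs)
    have "mp.is_ideal V (polys_in V :: ('v, 'k) mpoly set)" by (simp add: mp.is_ideal_def)
    then have "mp.adj V (polys_in V) f = polys_in V"
      using Cons.prems mp.subset_adj[of "polys_in V" V f] mp.adj_minimal[of V "polys_in V" "polys_in V" f]
      by auto
    then show ?case using Cons by (simp add: mp.nzd_def)
  qed simp
  have "sr_ideal V {} = (polys_in V :: ('v, 'k) mpoly set)" by (auto simp: mem_sr_ideal_iff)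
  moreover have "set (map (esym V) [1..<Suc r]) \<subseteq> (polys_in V :: ('v, 'k) mpoly set)"
    using assms(1) esym_mem by auto
  ultimately show ?case using top by simp
next
  case (simplex W)
  then show ?case by (intro wreg_esym_Pow assms)
next
  case (split x D)
  let ?es = "map (esym V) [1..<Suc r] :: ('v, 'k) mpoly list"
  show ?case
  proof (rule mp.wreg_colon_adj)
    show "mp.is_ideal V (sr_ideal V D :: ('v, 'k) mpoly set)" "indet x \<in> (polys_in V :: ('v, 'k) mpoly set)"
      "set ?es \<subseteq> polys_in V"
      using split assms(1) by (auto simp: is_ideal_sr_ideal indet_mem esym_mem)
    show "mp.wreg V (mp.colon V (sr_ideal V D) (indet x)) ?es"
      using split.IH(1)[OF down_closed_star[OF split.prems]] split.hyps by (simp only: colon_sr_ideal)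
    show "mp.wreg V (mp.adj V (sr_ideal V D) (indet x)) ?es"
      using split.IH(2)[OF down_closed_del[OF split.prems]] split.hyps split.prems
      by (simp only: adj_sr_ideal)
  qed
qed


section \<open>Regular sequences are no longer than facets\<close>

lemma tdeg_pos: "finite V \<Longrightarrow> Poly_Mapping.keys t \<subseteq> V \<Longrightarrow> t \<noteq> 0 \<Longrightarrow> 1 \<le> tdeg V t"
proof -
  assume V: "finite V" "Poly_Mapping.keys t \<subseteq> V" "t \<noteq> 0"
  then obtain x where "x \<in> Poly_Mapping.keys t" by (metis keys_eq_empty ex_in_conv)
  then have "x \<in> V" "Poly_Mapping.lookup t x \<ge> 1" using V by (auto simp: in_keys_iff Suc_le_eq)
  then show ?thesis
    unfolding tdeg_def using V(1) by (meson le_trans member_le_sum zero_le)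
qed

lemma tdeg_power_ge:
  assumes "\<And>t. t \<in> Poly_Mapping.keys f \<Longrightarrow> 1 \<le> tdeg V t" "t \<in> Poly_Mapping.keys (f ^ n)"
  shows "n \<le> tdeg V t"
  using assms(2)
proof (induction n arbitrary: t)
  case (Suc n)
  then obtain a b where "a \<in> Poly_Mapping.keys f" "b \<in> Poly_Mapping.keys (f ^ n)" "t = a + b"
    using Poly_Mapping.keys_mult[of f "f ^ n"] by auto
  then show ?case using assms(1)[of a] Suc.IH[of b] by (simp add: tdeg_add)
qed simp

definition tdeg_le :: "'v set \<Rightarrow> nat \<Rightarrow> ('v, 'k::field) mpoly \<Rightarrow> bool" where
  "tdeg_le V n p \<longleftrightarrow> (\<forall>t\<in>Poly_Mapping.keys p. tdeg V t \<le> n)"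

lemma tdeg_le_mult: "tdeg_le V m p \<Longrightarrow> tdeg_le V n q \<Longrightarrow> tdeg_le V (m + n) (p * q)"
  unfolding tdeg_le_def using Poly_Mapping.keys_mult[of p q] by (fastforce simp: tdeg_add)

lemma tdeg_le_one: "tdeg_le V n 1"
  by (simp add: tdeg_le_def tdeg_def)

lemma tdeg_le_power: "tdeg_le V m p \<Longrightarrow> tdeg_le V (n * m) (p ^ n)"
  by (induction n) (simp_all add: tdeg_le_one tdeg_le_mult)

lemma tdeg_le_mono: "tdeg_le V m p \<Longrightarrow> m \<le> n \<Longrightarrow> tdeg_le V n p"
  by (auto simp: tdeg_le_def)

lemma tdeg_le_mpow:
  assumes "\<And>g. g \<in> set gs \<Longrightarrow> tdeg_le V d g" "set al \<subseteq> {..<N}" "length al = length gs"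
  shows "tdeg_le V (length gs * (N * d)) (mp.mpow gs al)"
  using assms
proof (induction gs arbitrary: al)
  case (Cons g gs)
  then obtain a be where al: "al = a # be" by (cases al) auto
  have "tdeg_le V (a * d) (g ^ a)" using Cons.prems by (intro tdeg_le_power) auto
  then have "tdeg_le V (N * d) (g ^ a)" using Cons.prems al by (elim tdeg_le_mono) auto
  moreover have "tdeg_le V (length gs * (N * d)) (mp.mpow gs be)"
    using Cons.prems al by (intro Cons.IH) auto
  ultimately show ?case unfolding al by (simp add: tdeg_le_mult del: distrib_right)
qed (simp add: tdeg_le_one)

lemma ex_tdeg_le: "\<exists>d. \<forall>g\<in>set gs. tdeg_le V d g"
proof -
  have "\<forall>g\<in>set gs. tdeg_le V (Max (insert 0 (tdeg V ` (\<Union>g\<in>set gs. Poly_Mapping.keys g)))) g"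
    by (auto simp: tdeg_le_def intro!: Max_ge)
  then show ?thesis by blast
qed

lemma lookup_const_mult: "Poly_Mapping.lookup (Poly_Mapping.single 0 c * p) t = c * Poly_Mapping.lookup p t"
  for p :: "('v, 'k::field) mpoly"
proof -
  have "Poly_Mapping.lookup (Poly_Mapping.single 0 c * p) t =
    (\<Sum>a\<in>{0}. \<Sum>b\<in>Poly_Mapping.keys p.
      (Poly_Mapping.lookup (Poly_Mapping.single 0 c) a * Poly_Mapping.lookup p b when a + b = t))"
    by (rule lookup_mult_finite) auto
  also have "\<dots> = c * Poly_Mapping.lookup p t"
    by (auto simp: when_def in_keys_iff)
  finally show ?thesis .
qed

lemma card_bounded_exponents:
  assumes "finite W"
  shows "finite {t :: 'v \<Rightarrow>\<^sub>0 nat. Poly_Mapping.keys t \<subseteq> W \<and> (\<forall>x\<in>W. Poly_Mapping.lookup t x \<le> L)}" (is "finite ?B")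
    and "card {t :: 'v \<Rightarrow>\<^sub>0 nat. Poly_Mapping.keys t \<subseteq> W \<and> (\<forall>x\<in>W. Poly_Mapping.lookup t x \<le> L)} \<le> Suc L ^ card W"
proof -
  let ?r = "\<lambda>t :: 'v \<Rightarrow>\<^sub>0 nat. restrict (Poly_Mapping.lookup t) W"
  have inj: "inj_on ?r ?B"
  proof (rule inj_onI)
    fix s t assume st: "s \<in> ?B" "t \<in> ?B" "?r s = ?r t"
    show "s = t"
    proof (rule poly_mapping_eqI)
      fix x
      show "Poly_Mapping.lookup s x = Poly_Mapping.lookup t x"
      proof (cases "x \<in> W")
        case True
        then show ?thesis using fun_cong[OF st(3), of x] by simp
      next
        case False
        then have "x \<notin> Poly_Mapping.keys s" "x \<notin> Poly_Mapping.keys t" using st by auto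
        then show ?thesis by (simp add: in_keys_iff)
      qed
    qed
  qed
  have sub: "?r ` ?B \<subseteq> W \<rightarrow>\<^sub>E {..L}" by auto
  have fin: "finite (W \<rightarrow>\<^sub>E {..L})" using assms by (intro finite_PiE) auto
  show "finite ?B" using inj sub fin by (meson finite_imageD finite_subset)
  have "card ?B \<le> card (W \<rightarrow>\<^sub>E {..L})" using inj sub fin by (rule card_inj_on_le)
  then show "card ?B \<le> Suc L ^ card W" using assms by (simp add: card_PiE)
qed

text \<open>The polynomials \<open>mpow gs al\<close> with \<open>al \<in> {..<N}\<^sup>r\<close> have degree \<open>O(N)\<close>, so modulo the primary
  component of \<open>W\<close> they live in a space of dimension \<open>O(N ^ card W)\<close>.\<close>

lemma exists_relation_modulo_Pow:
  fixes gs :: "('v, 'k::field) mpoly list"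
  assumes V: "finite V" and W: "W \<subseteq> V" and gs: "set gs \<subseteq> polys_in V" and lt: "card W < length gs"
  obtains A c where "finite A" "A \<noteq> {}" "\<And>al. al \<in> A \<Longrightarrow> length al = length gs"
    "\<And>al. al \<in> A \<Longrightarrow> c al \<noteq> (0 :: 'k)"
    "(\<Sum>al\<in>A. Poly_Mapping.single 0 (c al) * mp.mpow gs al) \<in> sr_ideal V (Pow W)"
proof -
  let ?r = "length gs" and ?w = "card W"
  obtain d where d: "\<And>g. g \<in> set gs \<Longrightarrow> tdeg_le V d g" using ex_tdeg_le by blast
  \<comment> \<open>With r = \<open>length gs\<close> and w = \<open>card W\<close>, there are N^r
    unknowns and at most (r d N + 1)^w \<le> N^w (r d + 1)^w equations. Any N > (r d + 1)^w makes
    the latter smaller than N^(w+1), and w + 1 \<le> r.\<close>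
  define N where "N = Suc ((?r * d + 1) ^ ?w)"
  define L where "L = ?r * (N * d)"
  define A where "A = {al. set al \<subseteq> {..<N} \<and> length al = ?r}"
  define B where "B = {t. Poly_Mapping.keys t \<subseteq> W \<and> (\<forall>x\<in>W. Poly_Mapping.lookup t x \<le> L)}"
  have finW: "finite W" using W V finite_subset by blast
  have fA: "finite A" and cA: "card A = N ^ ?r"
    unfolding A_def by (simp_all add: finite_lists_length_eq card_lists_length_eq)
  have fB: "finite B" and cB: "card B \<le> Suc L ^ ?w"
    unfolding B_def using card_bounded_exponents[OF finW] by auto
  have "Suc L \<le> N * (?r * d + 1)" unfolding L_def N_def by (simp add: algebra_simps)
  then have "Suc L ^ ?w \<le> N ^ ?w * (?r * d + 1) ^ ?w"
    by (metis power_mono power_mult_distrib zero_le)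
  also have "\<dots> < N ^ ?w * N" unfolding N_def by simp
  also have "\<dots> = N ^ Suc ?w" by simp
  also have "\<dots> \<le> N ^ ?r" using lt by (intro power_increasing) (auto simp: N_def)
  finally have "card B < card A" using cA cB by simp
  then obtain c where c: "\<exists>al\<in>A. c al \<noteq> (0::'k)"
    "\<forall>t\<in>B. (\<Sum>al\<in>A. c al * Poly_Mapping.lookup (mp.mpow gs al) t) = 0"
    using homogeneous_system_solution[OF fB fA, of "\<lambda>al. Poly_Mapping.lookup (mp.mpow gs al)"] by blast
  \<comment> \<open>Discarding zero coefficients makes the remaining ones units, as
    \<open>wreg_relation\<close> demands.\<close>
  let ?A = "{al \<in> A. c al \<noteq> 0}"
  let ?p = "\<Sum>al\<in>?A. Poly_Mapping.single 0 (c al) * mp.mpow gs al"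
  have mem: "mp.mpow gs al \<in> polys_in V" for al using gs by (rule mp.mpow_mem)
  have pV: "?p \<in> polys_in V"
    by (intro mp.sum_mem mp.mult_mem mem single_mem_polys_in) auto
  have lookup_p: "Poly_Mapping.lookup ?p t = (\<Sum>al\<in>A. c al * Poly_Mapping.lookup (mp.mpow gs al) t)" for t
    unfolding lookup_sum lookup_const_mult
    by (rule sum.mono_neutral_left) (use fA in auto)
  have p: "?p \<in> sr_ideal V (Pow W)"
    unfolding mem_sr_ideal_iff
  proof (intro conjI pV ballI)
    fix t assume t: "t \<in> Poly_Mapping.keys ?p"
    then have nz: "(\<Sum>al\<in>A. c al * Poly_Mapping.lookup (mp.mpow gs al) t) \<noteq> 0"
      by (simp only: in_keys_iff lookup_p not_False_eq_True)
    then obtain al where "al \<in> A" "c al * Poly_Mapping.lookup (mp.mpow gs al) t \<noteq> 0"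
      by (rule sum.not_neutral_contains_not_neutral)
    then have al: "al \<in> A" "t \<in> Poly_Mapping.keys (mp.mpow gs al)"
      by (auto simp: in_keys_iff)
    have "tdeg_le V L (mp.mpow gs al)"
      unfolding L_def by (rule tdeg_le_mpow) (use al(1) d in \<open>simp_all add: A_def\<close>)
    then have "tdeg V t \<le> L"
      using al(2) by (simp add: tdeg_le_def)
    \<comment> \<open>An exponent of degree at most \<open>L\<close> supported in \<open>W\<close>
      would lie in \<open>B\<close>, where all coefficients of the relation vanish.\<close>
    have "Poly_Mapping.lookup t x \<le> L" if "x \<in> W" for x
    proof -
      have "Poly_Mapping.lookup t x \<le> tdeg V t"
        unfolding tdeg_def using that W V by (intro member_le_sum) auto
      with \<open>tdeg V t \<le> L\<close> show ?thesis by simp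
    qed
    moreover have "t \<notin> B" using c(2) nz by blast
    ultimately show "Poly_Mapping.keys t \<notin> Pow W" by (simp add: B_def)
  qed
  have A': "finite ?A" "?A \<noteq> {}" using fA c(1) by auto
  show ?thesis by (rule that[OF A' _ _ p]) (auto simp: A_def)
qed

theorem wreg_length_le_facet:
  fixes fs :: "('v, 'k::field) mpoly list"
  assumes V: "finite V" and D: "down_closed D" and W: "W \<in> D" "W \<subseteq> V"
    and facet: "\<And>x. x \<in> V - W \<Longrightarrow> insert x W \<notin> D"
    and fs: "set fs \<subseteq> mono_ideal V {t. t \<noteq> 0}" and reg: "mp.wreg V (sr_ideal V D) fs"
  shows "length fs \<le> card W"
proof (rule ccontr)
  assume len: "\<not> length fs \<le> card W"
  \<comment> \<open>Exceeds \<open>card W\<close>, the degree of x^W.\<close>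
  define a where "a = Suc (card W)"
  define gs where "gs = map (\<lambda>f. f ^ a) fs"
  let ?I = "sr_ideal V D :: ('v, 'k) mpoly set"
  have I: "mp.is_ideal V ?I" using D by (rule is_ideal_sr_ideal)
  have fsV: "set fs \<subseteq> polys_in V" using fs by (auto simp: mono_ideal_def)
  have gs: "set gs \<subseteq> polys_in V" using fsV by (auto simp: gs_def)
  have reg': "mp.wreg V ?I gs"
    unfolding gs_def using I fsV reg by (rule mp.wreg_map_power) (simp add: a_def)
  have finW: "finite W" using W V finite_subset by blast
  obtain A c where A: "finite A" "A \<noteq> {}" "\<And>al. al \<in> A \<Longrightarrow> length al = length gs"
    and c: "\<And>al. al \<in> A \<Longrightarrow> c al \<noteq> (0 :: 'k)"
    and rel: "(\<Sum>al\<in>A. Poly_Mapping.single 0 (c al) * mp.mpow gs al) \<in> sr_ideal V (Pow W)"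
    using exists_relation_modulo_Pow[OF V W(2) gs] len by (auto simp: gs_def)
  let ?p = "\<Sum>al\<in>A. Poly_Mapping.single 0 (c al) * mp.mpow gs al"
  define u :: "('v, 'k) mpoly" where "u = monomial (ind W)"
  have u: "u \<in> polys_in V"
    unfolding u_def monomial_def using W finW by (intro single_mem_polys_in) (simp add: keys_ind)
  \<comment> \<open>Every term of \<open>?p\<close> involves a variable outside \<open>W\<close>,
    and \<open>W\<close> together with this vertex is a nonface by maximality.\<close>
  have pu: "?p * u \<in> ?I"
    unfolding mem_sr_ideal_iff
  proof (intro conjI ballI)
    show "?p * u \<in> polys_in V" using rel u by (intro mp.mult_mem) (auto simp: mem_sr_ideal_iff)
    fix t assume "t \<in> Poly_Mapping.keys (?p * u)"
    then obtain s where s: "s \<in> Poly_Mapping.keys ?p" "t = s + ind W"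
      using Poly_Mapping.keys_mult[of ?p u] by (auto simp: u_def monomial_def)
    then have "Poly_Mapping.keys s \<subseteq> V" "\<not> Poly_Mapping.keys s \<subseteq> W"
      using rel by (auto simp: mem_sr_ideal_iff polys_in_def)
    then obtain x where "x \<in> V - W" "x \<in> Poly_Mapping.keys s" by auto
    then have "insert x W \<notin> D" "insert x W \<subseteq> Poly_Mapping.keys t"
      using facet s finW by (auto simp: keys_plus_nat keys_ind)
    then show "Poly_Mapping.keys t \<notin> D" using D by (auto simp: down_closed_def)
  qed
  have "u \<in> mp.gen V ?I gs"
  proof (rule mp.wreg_relation[OF I gs reg' u A(1) A(3) _ _ A(2)])
    show "Poly_Mapping.single 0 (c al) \<in> polys_in V" for al by (rule single_mem_polys_in) simp
    show "\<exists>d\<in>polys_in V. d * Poly_Mapping.single 0 (c al) = 1" if "al \<in> A" for al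
      using c[OF that]
      by (intro bexI[of _ "Poly_Mapping.single 0 (inverse (c al))"] single_mem_polys_in)
         (auto simp: mult_single)
    show "(\<Sum>al\<in>A. Poly_Mapping.single 0 (c al) * mp.mpow gs al * u) \<in> ?I"
      using pu by (simp add: sum_distrib_right)
  qed
  \<comment> \<open>The monomials with nonface support or degree at least \<open>a\<close> span an
    ideal that contains \<open>?I\<close> and the powers, but not x^W.\<close>
  moreover have "mp.gen V ?I gs \<subseteq> mono_ideal V {t. Poly_Mapping.keys t \<notin> D \<or> a \<le> tdeg V t}"
  proof (rule mp.gen_minimal[OF is_ideal_mono_ideal])
    show "s + t \<in> {t. Poly_Mapping.keys t \<notin> D \<or> a \<le> tdeg V t}"
      if "t \<in> {t. Poly_Mapping.keys t \<notin> D \<or> a \<le> tdeg V t}" for s t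
      using that D by (auto simp: down_closed_def keys_plus_nat tdeg_add)
    show "?I \<subseteq> mono_ideal V {t. Poly_Mapping.keys t \<notin> D \<or> a \<le> tdeg V t}"
      by (auto simp: mem_sr_ideal_iff mono_ideal_def)
    show "set gs \<subseteq> mono_ideal V {t. Poly_Mapping.keys t \<notin> D \<or> a \<le> tdeg V t}"
    proof
      fix g assume "g \<in> set gs"
      then obtain f where f: "f \<in> set fs" "g = f ^ a" by (auto simp: gs_def)
      have f1: "1 \<le> tdeg V t" if "t \<in> Poly_Mapping.keys f" for t
        using that f fs V by (intro tdeg_pos) (auto simp: mono_ideal_def polys_in_def)
      have "a \<le> tdeg V t" if "t \<in> Poly_Mapping.keys g" for t
        using tdeg_power_ge[OF f1] that f(2) by simp
      then show "g \<in> mono_ideal V {t. Poly_Mapping.keys t \<notin> D \<or> a \<le> tdeg V t}"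
        using f fsV by (auto simp: mono_ideal_def)
    qed
  qed
  ultimately have "W \<notin> D \<or> a \<le> card W"
    using W finW V by (auto simp: u_def monomial_def mono_ideal_def keys_ind tdeg_ind)
  then show False using W by (simp add: a_def)
qed


section \<open>Depth and Krull dimension of Stanley--Reisner rings\<close>

lemma mpoly_ring_simps [simp]:
  "carrier (mpoly_ring V) = polys_in V"
  "monoid.mult (mpoly_ring V) = (*)" "monoid.one (mpoly_ring V) = 1"
  "ring.zero (mpoly_ring V) = 0" "ring.add (mpoly_ring V) = (+)"
  by (simp_all add: mpoly_ring_def)

lemma uminus_mpoly_ring: "a \<in> polys_in V \<Longrightarrow> \<ominus>\<^bsub>mpoly_ring V\<^esub> a = - a"
  for a :: "('v, 'k::field) mpoly"
proof -
  interpret R: cring "mpoly_ring V :: ('v, 'k) mpoly ring" by (rule cring_mpoly_ring)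
  assume "a \<in> polys_in V"
  then show ?thesis by (intro R.minus_equality) auto
qed

lemma ideal_mpoly_ring_iff: "ideal I (mpoly_ring V) \<longleftrightarrow> mp.is_ideal V I"
  for I :: "('v, 'k::field) mpoly set"
proof
  interpret R: cring "mpoly_ring V :: ('v, 'k) mpoly ring" by (rule cring_mpoly_ring)
  assume "ideal I (mpoly_ring V)"
  then interpret ideal I "mpoly_ring V" .
  show "mp.is_ideal V I"
    unfolding mp.is_ideal_def using a_subset zero_closed a_closed I_l_closed by simp
next
  interpret R: cring "mpoly_ring V :: ('v, 'k) mpoly ring" by (rule cring_mpoly_ring)
  assume I: "mp.is_ideal V I"
  show "ideal I (mpoly_ring V)"
  proof (rule idealI)
    show "subgroup I (add_monoid (mpoly_ring V))"
    proof (rule R.add.subgroupI)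
      show "I \<subseteq> carrier (mpoly_ring V)" "I \<noteq> {}"
        using mp.ideal_sub[OF I] mp.ideal_zero[OF I] by auto
      show "a \<oplus>\<^bsub>mpoly_ring V\<^esub> b \<in> I" if "a \<in> I" "b \<in> I" for a b
        using that mp.ideal_add[OF I] by simp
      fix a assume a: "a \<in> I"
      then have "\<ominus>\<^bsub>mpoly_ring V\<^esub> a = - a"
        using mp.ideal_sub[OF I] by (intro uminus_mpoly_ring) simp
      also have "\<dots> \<in> I" using mp.ideal_diff[OF I mp.ideal_zero[OF I] a] by simp
      finally show "\<ominus>\<^bsub>mpoly_ring V\<^esub> a \<in> I" .
    qed
  qed (use mp.ideal_mult[OF I] mp.ideal_mult'[OF I] in \<open>auto intro: R.ring_axioms\<close>)
qed

context
  fixes V :: "'v set" and I :: "('v, 'k::field) mpoly set"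
  assumes I: "mp.is_ideal V I"
begin

interpretation R: cring "mpoly_ring V :: ('v, 'k) mpoly ring"
  by (rule cring_mpoly_ring)

interpretation ideal I "mpoly_ring V"
  using I by (simp add: ideal_mpoly_ring_iff)

interpretation Q: module "mpoly_ring V" "quot_module (mpoly_ring V) I"
  by (rule module_quot_module[OF cring_mpoly_ring is_ideal])

private abbreviation coset :: "('v, 'k) mpoly \<Rightarrow> ('v, 'k) mpoly set" where
  "coset p \<equiv> I +>\<^bsub>mpoly_ring V\<^esub> p"

lemma carrier_quot_module: "carrier (quot_module (mpoly_ring V) I) = coset ` polys_in V"
  by (auto simp: FactRing_def A_RCOSETS_def')

lemma coset_eq_iff: "p \<in> polys_in V \<Longrightarrow> q \<in> polys_in V \<Longrightarrow> coset p = coset q \<longleftrightarrow> p - q \<in> I"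
  using R.quotient_eq_iff_same_a_r_cos[OF is_ideal, of p q]
  by (simp add: a_minus_def uminus_mpoly_ring)

lemma coset_add:
  "p \<in> polys_in V \<Longrightarrow> q \<in> polys_in V \<Longrightarrow>
    coset p \<oplus>\<^bsub>quot_module (mpoly_ring V) I\<^esub> coset q = coset (p + q)"
  using ring_hom_add[OF rcos_ring_hom, of p q] by simp

lemma smult_coset:
  "p \<in> polys_in V \<Longrightarrow> q \<in> polys_in V \<Longrightarrow>
    p \<odot>\<^bsub>quot_module (mpoly_ring V) I\<^esub> coset q = coset (p * q)"
  using ring_hom_mult[OF rcos_ring_hom, of p q] by simp

text \<open>Splitting off the last summand of the linear combination matches one step of
  \<open>gen\<close>; the empty list gives the zero submodule, which is the image of
  \<open>I\<close>.\<close>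

lemma seq_submodule_quot_module:
  assumes "set xs \<subseteq> polys_in V"
  shows "seq_submodule (quot_module (mpoly_ring V) I) xs = coset ` mp.gen V I xs"
  using assms
proof (induction xs rule: rev_induct)
  case Nil
  have eq: "coset p = coset 0" if "p \<in> I" for p
    using that mp.ideal_sub[OF I that] coset_eq_iff[of p 0] by simp
  have zero: "\<zero>\<^bsub>quot_module (mpoly_ring V) I\<^esub> = coset 0"
    using ring_hom_zero[OF rcos_ring_hom R.ring_axioms quotient_is_ring] by simp
  have "coset ` I = (\<lambda>_. coset 0) ` I"
    by (rule image_cong[OF refl eq])
  also have "\<dots> = {\<zero>\<^bsub>quot_module (mpoly_ring V) I\<^esub>}"
    unfolding zero using mp.ideal_zero[OF I] by blast
  also have "\<dots> = seq_submodule (quot_module (mpoly_ring V) I) []"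
    by (simp add: seq_submodule_def del: quot_module_simps)
  finally show ?case by simp
next
  case (snoc x xs)
  let ?M = "quot_module (mpoly_ring V) I" and ?n = "length xs"
  have xs: "set xs \<subseteq> polys_in V" and x: "x \<in> polys_in V" using snoc.prems by auto
  have xsi: "xs ! i \<in> polys_in V" if "i < ?n" for i using that xs by auto
  have sum: "(\<Oplus>\<^bsub>?M\<^esub>i\<in>{..<Suc ?n}. (xs @ [x]) ! i \<odot>\<^bsub>?M\<^esub> u i) =
      x \<odot>\<^bsub>?M\<^esub> u ?n \<oplus>\<^bsub>?M\<^esub> (\<Oplus>\<^bsub>?M\<^esub>i\<in>{..<?n}. xs ! i \<odot>\<^bsub>?M\<^esub> u i)"
    if "u \<in> {..<Suc ?n} \<rightarrow> carrier ?M" for u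
  proof -
    have "(\<Oplus>\<^bsub>?M\<^esub>i\<in>{..<Suc ?n}. (xs @ [x]) ! i \<odot>\<^bsub>?M\<^esub> u i) =
        (xs @ [x]) ! ?n \<odot>\<^bsub>?M\<^esub> u ?n \<oplus>\<^bsub>?M\<^esub> (\<Oplus>\<^bsub>?M\<^esub>i\<in>{..<?n}. (xs @ [x]) ! i \<odot>\<^bsub>?M\<^esub> u i)"
      unfolding lessThan_Suc
      by (rule Q.finsum_insert) (use that xsi x in \<open>auto intro!: Q.smult_closed simp: nth_append simp del: quot_module_simps\<close>)
    also have "(\<Oplus>\<^bsub>?M\<^esub>i\<in>{..<?n}. (xs @ [x]) ! i \<odot>\<^bsub>?M\<^esub> u i) = (\<Oplus>\<^bsub>?M\<^esub>i\<in>{..<?n}. xs ! i \<odot>\<^bsub>?M\<^esub> u i)"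
      by (rule Q.finsum_cong') (use that xsi in \<open>auto intro!: Q.smult_closed simp: nth_append simp del: quot_module_simps\<close>)
    finally show ?thesis by simp
  qed
  have gen: "mp.gen V I xs \<subseteq> polys_in V"
    using mp.is_ideal_gen[OF I xs] mp.ideal_sub by blast
  show ?case
  proof
    show "seq_submodule ?M (xs @ [x]) \<subseteq> coset ` mp.gen V I (xs @ [x])"
    proof
      fix s assume "s \<in> seq_submodule ?M (xs @ [x])"
      then obtain u where u: "u \<in> {..<Suc ?n} \<rightarrow> carrier ?M"
        "s = (\<Oplus>\<^bsub>?M\<^esub>i\<in>{..<Suc ?n}. (xs @ [x]) ! i \<odot>\<^bsub>?M\<^esub> u i)"
        by (auto simp: seq_submodule_def)
      have "(\<Oplus>\<^bsub>?M\<^esub>i\<in>{..<?n}. xs ! i \<odot>\<^bsub>?M\<^esub> u i) \<in> seq_submodule ?M xs"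
        using u(1) unfolding seq_submodule_def by (auto simp: Pi_def)
      then obtain a where a: "a \<in> mp.gen V I xs" "(\<Oplus>\<^bsub>?M\<^esub>i\<in>{..<?n}. xs ! i \<odot>\<^bsub>?M\<^esub> u i) = coset a"
        using snoc.IH[OF xs] by auto
      have "u ?n \<in> coset ` polys_in V"
        using u(1) by (auto simp: Pi_def carrier_quot_module[symmetric])
      then obtain b where b: "b \<in> polys_in V" "u ?n = coset b" by auto
      have "s = coset (a + x * b)"
        unfolding u(2) sum[OF u(1)] a(2) b(2) using a(1) b(1) x gen
        by (subst smult_coset) (auto simp: coset_add add.commute simp del: quot_module_simps)
      then show "s \<in> coset ` mp.gen V I (xs @ [x])"
        using a b by (auto simp: mp.gen_append intro: mp.adjI)
    qed
    show "coset ` mp.gen V I (xs @ [x]) \<subseteq> seq_submodule ?M (xs @ [x])"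
    proof
      fix s assume "s \<in> coset ` mp.gen V I (xs @ [x])"
      then obtain a b where ab: "a \<in> mp.gen V I xs" "b \<in> polys_in V" "s = coset (a + x * b)"
        by (auto simp: mp.gen_append elim!: mp.adjE)
      then have "coset a \<in> seq_submodule ?M xs" using snoc.IH[OF xs] by blast
      then obtain u where u: "u \<in> {..<?n} \<rightarrow> carrier ?M"
        "coset a = (\<Oplus>\<^bsub>?M\<^esub>i\<in>{..<?n}. xs ! i \<odot>\<^bsub>?M\<^esub> u i)"
        by (auto simp: seq_submodule_def)
      define u' where "u' = u(?n := coset b)"
      have u': "u' \<in> {..<Suc ?n} \<rightarrow> carrier ?M"
        using u(1) ab(2) unfolding carrier_quot_module u'_def by (fastforce simp: less_Suc_eq Pi_def)
      have "(\<Oplus>\<^bsub>?M\<^esub>i\<in>{..<?n}. xs ! i \<odot>\<^bsub>?M\<^esub> u' i) = (\<Oplus>\<^bsub>?M\<^esub>i\<in>{..<?n}. xs ! i \<odot>\<^bsub>?M\<^esub> u i)"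
        by (rule Q.finsum_cong') (use u(1) xsi in \<open>auto intro!: Q.smult_closed simp: u'_def simp del: quot_module_simps\<close>)
      then have "s = (\<Oplus>\<^bsub>?M\<^esub>i\<in>{..<Suc ?n}. (xs @ [x]) ! i \<odot>\<^bsub>?M\<^esub> u' i)"
        unfolding sum[OF u'] u(2)[symmetric] ab(3) using ab gen x
        by (simp add: u'_def smult_coset coset_add add.commute subset_iff del: quot_module_simps)
      then show "s \<in> seq_submodule ?M (xs @ [x])"
        using u' by (auto simp: seq_submodule_def)
    qed
  qed
qed

lemma coset_mem_image_iff:
  assumes "mp.is_ideal V J" "I \<subseteq> J" "p \<in> polys_in V"
  shows "coset p \<in> coset ` J \<longleftrightarrow> p \<in> J"
proof
  assume "coset p \<in> coset ` J"
  then obtain q where q: "q \<in> J" "coset p = coset q" by auto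
  then have "p - q \<in> I" using coset_eq_iff assms mp.ideal_sub by metis
  then show "p \<in> J" using mp.ideal_add[OF assms(1) _ q(1), of "p - q"] assms(2) by auto
qed simp

text \<open>A coset modulo \<open>I\<close> lies in the image of a larger ideal exactly if its
  representatives lie in that ideal, so both conditions can be tested in the polynomial
  ring.\<close>

lemma regular_sequence_quot_module_iff:
  assumes xs: "set xs \<subseteq> polys_in V"
  shows "regular_sequence (quot_module (mpoly_ring V) I) xs \<longleftrightarrow>
    mp.wreg V I xs \<and> mp.gen V I xs \<noteq> polys_in V"
proof -
  have ideal: "mp.is_ideal V (mp.gen V I (take i xs))" for i
    using xs set_take_subset[of i xs] by (intro mp.is_ideal_gen I) blast
  have sub: "I \<subseteq> mp.gen V I (take i xs)" for i by (rule mp.subset_gen)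
  have seq: "seq_submodule (quot_module (mpoly_ring V) I) (take i xs) = coset ` mp.gen V I (take i xs)" for i
    using xs set_take_subset[of i xs] by (intro seq_submodule_quot_module) blast
  have "(\<forall>u\<in>carrier (quot_module (mpoly_ring V) I).
        xs ! i \<odot>\<^bsub>quot_module (mpoly_ring V) I\<^esub> u \<in> seq_submodule (quot_module (mpoly_ring V) I) (take i xs) \<longrightarrow>
        u \<in> seq_submodule (quot_module (mpoly_ring V) I) (take i xs)) \<longleftrightarrow>
      mp.nzd V (mp.gen V I (take i xs)) (xs ! i)" if "i < length xs" for i
  proof -
    have x: "xs ! i \<in> polys_in V" using that xs by auto
    show ?thesis
      unfolding carrier_quot_module seq mp.nzd_def ball_simps
      using x by (auto simp: smult_coset coset_mem_image_iff[OF ideal sub] simp del: quot_module_simps)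
  qed
  moreover have "coset ` mp.gen V I xs = coset ` polys_in V \<longleftrightarrow> mp.gen V I xs = polys_in V"
  proof
    assume eq: "coset ` mp.gen V I xs = coset ` polys_in V"
    have "p \<in> mp.gen V I xs" if "p \<in> polys_in V" for p
      using coset_mem_image_iff[OF ideal[of "length xs"] sub that] eq that by auto
    then show "mp.gen V I xs = polys_in V"
      using ideal[of "length xs"] mp.ideal_sub by auto
  qed simp
  ultimately show ?thesis
    unfolding regular_sequence_def mp.wreg_iff_nth
    using seq[of "length xs"] by (auto simp: carrier_quot_module simp del: quot_module_simps)
qed

end

section \<open>Monomial ideals and the bounds on depth\<close>

lemma genideal_mpoly_ring:
  assumes "S \<subseteq> polys_in V"
  shows "mp.is_ideal V (Idl\<^bsub>mpoly_ring V\<^esub> S)" "S \<subseteq> Idl\<^bsub>mpoly_ring V\<^esub> S"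
    and "mp.is_ideal V J \<Longrightarrow> S \<subseteq> J \<Longrightarrow> Idl\<^bsub>mpoly_ring V\<^esub> S \<subseteq> J"
proof -
  interpret R: cring "mpoly_ring V :: ('a, 'b) mpoly ring" by (rule cring_mpoly_ring)
  show "mp.is_ideal V (Idl\<^bsub>mpoly_ring V\<^esub> S)" "S \<subseteq> Idl\<^bsub>mpoly_ring V\<^esub> S"
    using R.genideal_ideal[of S] R.genideal_self[of S] assms by (simp_all add: ideal_mpoly_ring_iff)
  show "mp.is_ideal V J \<Longrightarrow> S \<subseteq> J \<Longrightarrow> Idl\<^bsub>mpoly_ring V\<^esub> S \<subseteq> J"
    by (rule R.genideal_minimal) (simp_all add: ideal_mpoly_ring_iff)
qed

text \<open>Each term of a polynomial on the right is a multiple of a generator, so membership can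
  be checked term by term.\<close>

lemma genideal_monomials:
  assumes T: "\<And>t. t \<in> T \<Longrightarrow> Poly_Mapping.keys t \<subseteq> V"
  shows "Idl\<^bsub>mpoly_ring V\<^esub> (monomial ` T) = (mono_ideal V {t + u | t u. t \<in> T} :: ('v, 'k::field) mpoly set)"
    (is "?L = ?R")
proof
  have sub: "monomial ` T \<subseteq> (polys_in V :: ('v, 'k) mpoly set)"
    using T by (auto simp: monomial_def intro: single_mem_polys_in)
  note gen = genideal_mpoly_ring[OF sub]
  show "?L \<subseteq> ?R"
  proof (rule gen(3)[OF is_ideal_mono_ideal])
    show "s + t \<in> {t + u |t u. t \<in> T}" if "t \<in> {t + u |t u. t \<in> T}" for s t
      using that by clarsimp (metis add.left_commute)
    show "monomial ` T \<subseteq> ?R"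
      using sub by (auto simp: mono_ideal_def monomial_def) (metis add_0_right)
  qed
  show "?R \<subseteq> ?L"
  proof
    fix p :: "('v, 'k) mpoly" assume p: "p \<in> ?R"
    show "p \<in> ?L"
    proof (rule mem_ideal_if_terms[OF gen(1)])
      fix t assume t: "t \<in> Poly_Mapping.keys p"
      then obtain s u where su: "s \<in> T" "t = s + u" using p by (auto simp: mono_ideal_def)
      have "Poly_Mapping.keys t \<subseteq> V" using p t by (auto simp: mono_ideal_def polys_in_def)
      then have "Poly_Mapping.single u (Poly_Mapping.lookup p t) \<in> polys_in V"
        using su by (intro single_mem_polys_in) (simp add: keys_plus_nat)
      then have "Poly_Mapping.single u (Poly_Mapping.lookup p t) * monomial s \<in> ?L"
        using gen(2) su by (intro mp.ideal_mult[OF gen(1)]) auto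
      then show "Poly_Mapping.single t (Poly_Mapping.lookup p t) \<in> ?L"
        by (simp add: monomial_def mult_single su add.commute)
    qed
  qed
qed

lemma mono_ideal_cong:
  "(\<And>t. Poly_Mapping.keys t \<subseteq> V \<Longrightarrow> t \<in> S \<longleftrightarrow> t \<in> T) \<Longrightarrow> mono_ideal V S = mono_ideal V T"
  by (auto simp: mono_ideal_def polys_in_def subset_iff)

lemma irrelevant_ideal_eq:
  "irrelevant_ideal V = (mono_ideal V {t. t \<noteq> 0} :: ('v, 'k::field) mpoly set)"
proof -
  have "irrelevant_ideal V =
      (Idl\<^bsub>mpoly_ring V\<^esub> (monomial ` (\<lambda>x. Poly_Mapping.single x 1) ` V) :: ('v, 'k) mpoly set)"
    by (simp add: irrelevant_ideal_def indet_def image_image)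
  also have "\<dots> = mono_ideal V {t + u | t u. t \<in> (\<lambda>x. Poly_Mapping.single x 1) ` V}"
    by (rule genideal_monomials) auto
  also have "\<dots> = mono_ideal V {t. t \<noteq> 0}"
  proof (rule mono_ideal_cong)
    fix t :: "'v \<Rightarrow>\<^sub>0 nat" assume t: "Poly_Mapping.keys t \<subseteq> V"
    show "t \<in> {t + u | t u. t \<in> (\<lambda>x. Poly_Mapping.single x 1) ` V} \<longleftrightarrow> t \<in> {t. t \<noteq> 0}"
    proof
      assume "t \<in> {t + u | t u. t \<in> (\<lambda>x. Poly_Mapping.single x 1) ` V}"
      then obtain x u where "t = Poly_Mapping.single x 1 + u" by auto
      then have "x \<in> Poly_Mapping.keys t" by (simp add: keys_plus_nat)
      then show "t \<in> {t. t \<noteq> 0}" by auto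
    next
      assume "t \<in> {t. t \<noteq> 0}"
      then have "Poly_Mapping.keys t \<noteq> {}" by simp
      then obtain x where x: "x \<in> Poly_Mapping.keys t" by blast
      then have "t = Poly_Mapping.single x 1 + (t - Poly_Mapping.single x 1)"
        by (intro poly_mapping_eqI)
           (auto simp: lookup_add lookup_minus lookup_single when_def in_keys_iff)
      with x t show "t \<in> {t + u | t u. t \<in> (\<lambda>x. Poly_Mapping.single x 1) ` V}" by blast
    qed
  qed
  finally show ?thesis .
qed

theorem depth_quot_le_facet:
  assumes "finite V" "down_closed D" "W \<in> D" "W \<subseteq> V" "\<And>x. x \<in> V - W \<Longrightarrow> insert x W \<notin> D"
  shows "depth_quot V (sr_ideal V D :: ('v, 'k::field) mpoly set) \<le> enat (card W)"
  unfolding depth_quot_def depth_def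
proof (rule Sup_least)
  let ?I = "sr_ideal V D :: ('v, 'k) mpoly set"
  fix d assume "d \<in> {enat (length xs) |xs. set xs \<subseteq> irrelevant_ideal V \<and>
      regular_sequence (quot_module (mpoly_ring V) ?I) xs}"
  then obtain xs where xs: "d = enat (length xs)" "set xs \<subseteq> mono_ideal V {t. t \<noteq> 0}"
    "regular_sequence (quot_module (mpoly_ring V) ?I) xs"
    by (auto simp: irrelevant_ideal_eq)
  have "mp.is_ideal V ?I" "set xs \<subseteq> polys_in V"
    using assms(2) xs(2) by (auto simp: is_ideal_sr_ideal mono_ideal_def)
  then have "mp.wreg V ?I xs" using xs(3) by (simp add: regular_sequence_quot_module_iff)
  then show "d \<le> enat (card W)" using wreg_length_le_facet[OF assms xs(2)] xs(1) by simp
qed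

text \<open>The witness e_1, ..., e_r starts at index 1 because e_0 = 1. As \<open>{}\<close> is a
  face, the ideal and the sequence lie in the irrelevant ideal, which keeps the last quotient
  nonzero.\<close>

theorem depth_quot_ge_decomposable:
  assumes "finite V" "down_closed D" "{} \<in> D" "decomposable V r D"
  shows "enat r \<le> depth_quot V (sr_ideal V D :: ('v, 'k::field) mpoly set)"
  unfolding depth_quot_def depth_def
proof (rule Sup_upper, intro CollectI exI conjI)
  let ?I = "sr_ideal V D :: ('v, 'k) mpoly set" and ?es = "map (esym V) [1..<Suc r] :: ('v, 'k) mpoly list"
  let ?m = "mono_ideal V {t. t \<noteq> 0} :: ('v, 'k) mpoly set"
  show "enat r = enat (length ?es)" by simp
  have es: "set ?es \<subseteq> polys_in V" using assms(1) esym_mem by auto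
  have m: "mp.is_ideal V ?m"
  proof (rule is_ideal_mono_ideal)
    show "s + t \<in> {t. t \<noteq> 0}" if "t \<in> {t. t \<noteq> 0}" for s t :: "'v \<Rightarrow>\<^sub>0 nat"
      using that keys_plus_nat[of s t] by auto
  qed
  have "esym V i \<in> ?m" if "1 \<le> i" for i
  proof -
    have "t \<noteq> 0" if "t \<in> Poly_Mapping.keys (esym V i :: ('v, 'k) mpoly)" for t
      using homogeneous_esym[OF assms(1), of i] that \<open>1 \<le> i\<close> by (fastforce simp: homogeneous_def tdeg_def)
    then show ?thesis using esym_mem[OF assms(1)] by (auto simp: mono_ideal_def)
  qed
  then have esm: "set ?es \<subseteq> ?m" by auto
  then show "set ?es \<subseteq> irrelevant_ideal V" by (simp add: irrelevant_ideal_eq)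
  have "t \<noteq> 0" if "Poly_Mapping.keys t \<notin> D" for t :: "'v \<Rightarrow>\<^sub>0 nat"
    using that assms(3) by auto
  then have "?I \<subseteq> ?m" unfolding sr_ideal_def mono_ideal_def by blast
  then have "mp.gen V ?I ?es \<subseteq> ?m" using esm by (rule mp.gen_minimal[OF m])
  moreover have "1 \<notin> ?m" by (simp add: mono_ideal_def)
  moreover have "1 \<in> (polys_in V :: ('v, 'k) mpoly set)" by simp
  ultimately have "mp.gen V ?I ?es \<noteq> polys_in V" by blast
  then show "regular_sequence (quot_module (mpoly_ring V) ?I) ?es"
    using wreg_esym_decomposable[OF assms(1,4,2)]
    by (simp only: regular_sequence_quot_module_iff[OF is_ideal_sr_ideal[OF assms(2)] es] simp_thms not_False_eq_True)
qed

text \<open>Lexicographic leading terms for variables without a given order: one coordinate of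
  \<open>U\<close> after the other is maximised in \<open>S\<close> and in \<open>T\<close>, and a
  sum of two maximal choices determines both summands.\<close>

lemma exists_unique_sum:
  fixes S T :: "('v \<Rightarrow>\<^sub>0 nat) set"
  assumes "finite U" "finite S" "S \<noteq> {}" "finite T" "T \<noteq> {}"
    and "\<And>a a' x. a \<in> S \<Longrightarrow> a' \<in> S \<Longrightarrow> x \<notin> U \<Longrightarrow> Poly_Mapping.lookup a x = Poly_Mapping.lookup a' x"
    and "\<And>a a' x. a \<in> T \<Longrightarrow> a' \<in> T \<Longrightarrow> x \<notin> U \<Longrightarrow> Poly_Mapping.lookup a x = Poly_Mapping.lookup a' x"
  shows "\<exists>a\<in>S. \<exists>b\<in>T. \<forall>a'\<in>S. \<forall>b'\<in>T. a' + b' = a + b \<longrightarrow> a' = a \<and> b' = b"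
  using assms
proof (induction U arbitrary: S T rule: finite_induct)
  case empty
  obtain a b where ab: "a \<in> S" "b \<in> T" using empty by blast
  have "a' = a" if "a' \<in> S" for a' by (rule poly_mapping_eqI) (rule empty.prems(5)[OF that ab(1)], simp)
  moreover have "b' = b" if "b' \<in> T" for b' by (rule poly_mapping_eqI) (rule empty.prems(6)[OF that ab(2)], simp)
  ultimately show ?case using ab by blast
next
  case (insert x U)
  let ?l = "\<lambda>a. Poly_Mapping.lookup a x"
  define m where "m = Max (?l ` S)"
  define n where "n = Max (?l ` T)"
  have m: "m \<in> ?l ` S" "\<And>a. a \<in> S \<Longrightarrow> ?l a \<le> m"
    unfolding m_def using insert.prems(1,2) by (auto intro: Max_in)
  have n: "n \<in> ?l ` T" "\<And>a. a \<in> T \<Longrightarrow> ?l a \<le> n"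
    unfolding n_def using insert.prems(3,4) by (auto intro: Max_in)
  let ?S = "{a \<in> S. ?l a = m}" and ?T = "{b \<in> T. ?l b = n}"
  have "\<exists>a\<in>?S. \<exists>b\<in>?T. \<forall>a'\<in>?S. \<forall>b'\<in>?T. a' + b' = a + b \<longrightarrow> a' = a \<and> b' = b"
  proof (rule insert.IH)
    show "finite ?S" "?S \<noteq> {}" "finite ?T" "?T \<noteq> {}"
      using insert.prems(1,3) m(1) n(1) by auto
    show "Poly_Mapping.lookup a z = Poly_Mapping.lookup a' z" if "a \<in> ?S" "a' \<in> ?S" "z \<notin> U" for a a' z
      using that insert.prems(5)[of a a' z] by (cases "z = x") auto
    show "Poly_Mapping.lookup a z = Poly_Mapping.lookup a' z" if "a \<in> ?T" "a' \<in> ?T" "z \<notin> U" for a a' z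
      using that insert.prems(6)[of a a' z] by (cases "z = x") auto
  qed
  then obtain a b where ab: "a \<in> ?S" "b \<in> ?T"
    and uniq: "\<And>a' b'. a' \<in> ?S \<Longrightarrow> b' \<in> ?T \<Longrightarrow> a' + b' = a + b \<Longrightarrow> a' = a \<and> b' = b" by blast
  have "a' = a \<and> b' = b" if ab': "a' \<in> S" "b' \<in> T" "a' + b' = a + b" for a' b'
  proof -
    have "?l a' + ?l b' = m + n"
      using ab arg_cong[OF ab'(3), of ?l] by (simp add: lookup_add)
    then have "?l a' = m" "?l b' = n" using m(2)[OF ab'(1)] n(2)[OF ab'(2)] by linarith+
    then show ?thesis using uniq ab' by blast
  qed
  then show ?case using ab by blast
qed

text \<open>The quotient is the domain K[S]: the parts of \<open>p\<close> and \<open>q\<close>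
  supported in \<open>S\<close> have leading terms whose product survives in \<open>p * q\<close>.
  Terms that leave \<open>S\<close> cannot interfere, since supports only grow when exponents are
  added.\<close>

lemma sr_ideal_Pow_prime:
  fixes p q :: "('v, 'k::field) mpoly"
  assumes "finite S" "p \<in> polys_in V" "q \<in> polys_in V" "p * q \<in> sr_ideal V (Pow S)"
  shows "p \<in> sr_ideal V (Pow S) \<or> q \<in> sr_ideal V (Pow S)"
proof (rule ccontr)
  assume contra: "\<not> ?thesis"
  let ?A = "{t \<in> Poly_Mapping.keys p. Poly_Mapping.keys t \<subseteq> S}"
  let ?B = "{t \<in> Poly_Mapping.keys q. Poly_Mapping.keys t \<subseteq> S}"
  have ne: "?A \<noteq> {}" "?B \<noteq> {}"
    using contra assms(2,3) by (auto simp: mem_sr_ideal_iff)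
  have z: "Poly_Mapping.lookup t x = 0" if "Poly_Mapping.keys t \<subseteq> S" "x \<notin> S" for t :: "'v \<Rightarrow>\<^sub>0 nat" and x
    using that by (auto simp: in_keys_iff subset_iff)
  have "\<exists>a\<in>?A. \<exists>b\<in>?B. \<forall>a'\<in>?A. \<forall>b'\<in>?B. a' + b' = a + b \<longrightarrow> a' = a \<and> b' = b"
    by (rule exists_unique_sum[OF assms(1)]) (use ne z in auto)
  then obtain a b where ab: "a \<in> ?A" "b \<in> ?B"
    and uniq: "\<And>a' b'. a' \<in> ?A \<Longrightarrow> b' \<in> ?B \<Longrightarrow> a' + b' = a + b \<Longrightarrow> a' = a \<and> b' = b" by blast
  have kab: "Poly_Mapping.keys (a + b) \<subseteq> S" using ab by (simp add: keys_plus_nat)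
  have "Poly_Mapping.lookup (p * q) (a + b) = Poly_Mapping.lookup p a * Poly_Mapping.lookup q b"
  proof (rule lookup_mult_unique)
    fix a' b' assume *: "a' \<in> Poly_Mapping.keys p" "b' \<in> Poly_Mapping.keys q" "a' + b' = a + b"
    then have sub: "Poly_Mapping.keys a' \<union> Poly_Mapping.keys b' \<subseteq> S"
      using kab keys_plus_nat[of a' b'] by simp
    show "a' = a \<and> b' = b" by (rule uniq) (use sub * in simp_all)
  qed (use ab in auto)
  then have "a + b \<in> Poly_Mapping.keys (p * q)" using ab by (simp add: in_keys_iff)
  then show False using assms(4) kab by (auto simp: mem_sr_ideal_iff)
qed

lemma sr_ideal_antimono: "D \<subseteq> D' \<Longrightarrow> sr_ideal V D' \<subseteq> sr_ideal V D"
  unfolding sr_ideal_def mono_ideal_def by blast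

text \<open>Removing the vertices of \<open>W\<close> one at a time enlarges the prime ideal of the
  face step by step, from the ideal of \<open>W\<close> to that of the empty face.\<close>

theorem krull_dim_ge_face:
  assumes finV: "finite V" and D: "down_closed D" and W: "W \<in> D" "W \<subseteq> V"
  shows "enat (card W) \<le> krull_dim (mpoly_ring V Quot (sr_ideal V D :: ('v, 'k::field) mpoly set))"
proof -
  let ?R = "mpoly_ring V :: ('v, 'k) mpoly ring" and ?I = "sr_ideal V D :: ('v, 'k) mpoly set"
  interpret R: cring ?R by (rule cring_mpoly_ring)
  have I: "mp.is_ideal V ?I" using D by (rule is_ideal_sr_ideal)
  then interpret I: ideal ?I ?R by (simp add: ideal_mpoly_ring_iff)
  interpret Q: cring "?R Quot ?I" by (rule I.quotient_is_cring) (rule R.is_cring)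
  let ?c = "\<lambda>p. ?I +>\<^bsub>?R\<^esub> p" and ?P = "\<lambda>S. sr_ideal V (Pow S) :: ('v, 'k) mpoly set"
  have idP: "mp.is_ideal V (?P S)" for S by (simp add: is_ideal_sr_ideal)
  have IP: "?I \<subseteq> ?P S" if "S \<subseteq> W" for S
  proof -
    have "Pow S \<subseteq> D" using that W(1) D unfolding down_closed_def by blast
    then show ?thesis by (rule sr_ideal_antimono)
  qed
  have mem: "?c p \<in> ?c ` ?P S \<longleftrightarrow> p \<in> ?P S" if "S \<subseteq> W" "p \<in> polys_in V" for p S
    by (rule coset_mem_image_iff[OF I idP IP[OF that(1)] that(2)])
  have car: "carrier (?R Quot ?I) = ?c ` polys_in V"
    using carrier_quot_module[OF I] by simp
  have prime: "primeideal (?c ` ?P S) (?R Quot ?I)" if S: "S \<subseteq> W" for S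
  proof (rule primeidealI)
    show "ideal (?c ` ?P S) (?R Quot ?I)"
      using R.ring_ideal_imp_quot_ideal[OF I.is_ideal, of "?P S"] idP by (simp add: ideal_mpoly_ring_iff)
    show "cring (?R Quot ?I)" by (rule Q.is_cring)
    have one: "1 \<in> (polys_in V :: ('v, 'k) mpoly set)" "1 \<notin> ?P S"
      by (simp_all add: mem_sr_ideal_iff)
    then have "?c 1 \<notin> ?c ` ?P S" using mem[OF S] by blast
    then show "carrier (?R Quot ?I) \<noteq> ?c ` ?P S" unfolding car using one(1) by blast
    fix a b assume "a \<in> carrier (?R Quot ?I)" "b \<in> carrier (?R Quot ?I)"
      and ab: "a \<otimes>\<^bsub>?R Quot ?I\<^esub> b \<in> ?c ` ?P S"
    then obtain p q where pq: "p \<in> polys_in V" "q \<in> polys_in V" "a = ?c p" "b = ?c q"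
      unfolding car by blast
    have "?c (p * q) = a \<otimes>\<^bsub>?R Quot ?I\<^esub> b"
      using ring_hom_mult[OF I.rcos_ring_hom, of p q] pq by simp
    then have "p * q \<in> ?P S" using ab mem[OF S, of "p * q"] pq(1,2) by simp
    then have "p \<in> ?P S \<or> q \<in> ?P S"
      using sr_ideal_Pow_prime[of S p V q] pq S W finV by (meson finite_subset)
    then show "a \<in> ?c ` ?P S \<or> b \<in> ?c ` ?P S" using pq by blast
  qed
  obtain ws where ws: "set ws = W" "distinct ws"
    using finite_distinct_list W(2) finV finite_subset by metis
  \<comment> \<open>\<open>Q 0\<close> belongs to \<open>W\<close> and \<open>Q (length ws)\<close>
    to the empty face, which makes \<open>card W\<close> strict inclusions.\<close>
  define Q where "Q i = ?c ` ?P (set (drop i ws))" for i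
  have sub: "set (drop i ws) \<subseteq> W" for i using set_drop_subset ws(1) by fast
  have "Q i \<subset> Q (Suc i)" if i: "i < length ws" for i
  proof
    have drop: "drop i ws = ws ! i # drop (Suc i) ws" using i by (simp add: Cons_nth_drop_Suc)
    have "set (drop (Suc i) ws) \<subseteq> set (drop i ws)" using drop by auto
    then have "?P (set (drop i ws)) \<subseteq> ?P (set (drop (Suc i) ws))"
      by (intro sr_ideal_antimono Pow_mono)
    then show "Q i \<subseteq> Q (Suc i)" unfolding Q_def by blast
    \<comment> \<open>The variable removed in this step lies in the larger prime only.\<close>
    let ?x = "indet (ws ! i) :: ('v, 'k) mpoly"
    have "ws ! i \<notin> set (drop (Suc i) ws)" using drop ws(2) by (metis distinct.simps(2) distinct_drop)
    moreover have "ws ! i \<in> set (drop i ws)" using drop by simp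
    moreover have xV: "?x \<in> polys_in V" using i ws(1) W(2) by (intro indet_mem) auto
    ultimately have "?x \<in> ?P (set (drop (Suc i) ws))" "?x \<notin> ?P (set (drop i ws))"
      by (simp_all add: mem_sr_ideal_iff indet_def monomial_def)
    then have "?c ?x \<in> Q (Suc i)" "?c ?x \<notin> Q i"
      unfolding Q_def using mem[OF sub xV] by auto
    then show "Q i \<noteq> Q (Suc i)" by blast
  qed
  moreover have "primeideal (Q i) (?R Quot ?I)" for i unfolding Q_def by (rule prime[OF sub])
  ultimately have "enat (length ws) \<in> {enat n | n. \<exists>P. (\<forall>i\<le>n. primeideal (P i) (?R Quot ?I)) \<and> (\<forall>i<n. P i \<subset> P (Suc i))}"
    by blast
  moreover have "length ws = card W" using ws distinct_card by metis
  ultimately show ?thesis unfolding krull_dim_def by (metis (no_types, lifting) Sup_upper)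
qed


section \<open>Matchings in whiskered forests\<close>

lemma card2_iff_pair: "card e = 2 \<and> x \<in> e \<longleftrightarrow> (\<exists>z. z \<noteq> x \<and> e = {x, z})"
  by (auto simp: card_2_iff)

lemma card2_eq_pair: "card e = 2 \<Longrightarrow> x \<in> e \<Longrightarrow> z \<in> e \<Longrightarrow> x \<noteq> z \<Longrightarrow> e = {x, z}"
  by (auto simp: card_2_iff)

text \<open>The end \<open>a\<close> of a longest path is a leaf: a neighbour other than
  \<open>b\<close> would close a cycle if it is on the path and lengthen the path otherwise.\<close>

lemma exists_leaf:
  assumes fin: "finite (\<Union>E)" and E2: "\<And>e. e \<in> E \<Longrightarrow> card e = 2"
    and acyc: "\<nexists>c. graph_cycle E c" and ne: "E \<noteq> {}"
  obtains a b where "a \<noteq> b" "{a, b} \<in> E" "\<And>e. e \<in> E \<Longrightarrow> a \<in> e \<Longrightarrow> e = {a, b}"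
proof -
  define path where "path p \<longleftrightarrow>
    distinct p \<and> 2 \<le> length p \<and> (\<forall>i. Suc i < length p \<longrightarrow> {p ! i, p ! Suc i} \<in> E)" for p
  obtain e where "e \<in> E" using ne by auto
  then obtain u v where uv: "u \<noteq> v" "{u, v} \<in> E" using E2[of e] by (auto simp: card_2_iff)
  then have "path [u, v]" by (auto simp: path_def)
  moreover have "length p < Suc (card (\<Union>E))" if "path p" for p
  proof -
    have "p ! i \<in> \<Union>E" if "i < length p" for i
    proof (cases "Suc i < length p")
      case True
      then show ?thesis using \<open>path p\<close> by (auto simp: path_def)
    next
      case False
      then have "Suc (i - 1) < length p" "i = Suc (i - 1)" using that \<open>path p\<close> by (auto simp: path_def)
      then have "{p ! (i - 1), p ! i} \<in> E" using \<open>path p\<close> unfolding path_def by metis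
      then show ?thesis by auto
    qed
    then have "set p \<subseteq> \<Union>E" by (metis in_set_conv_nth subsetI)
    then show ?thesis using \<open>path p\<close> fin distinct_card[of p] card_mono[of "\<Union>E" "set p"]
      by (auto simp: path_def)
  qed
  ultimately obtain p where p: "path p" and max: "\<And>q. path q \<Longrightarrow> length q \<le> length p"
    using ex_has_greatest_nat[of path "[u, v]" length "Suc (card (\<Union>E))"]
    by (metis less_imp_le)
  then obtain a b ps where p_eq: "p = a # b # ps"
    unfolding path_def by (cases p; cases "tl p") auto
  have ab: "a \<noteq> b" "{a, b} \<in> E" using p unfolding path_def p_eq by auto
  have "e = {a, b}" if e: "e \<in> E" "a \<in> e" for e
  proof (rule ccontr)
    assume neq: "e \<noteq> {a, b}"
    obtain w where w: "w \<noteq> a" "e = {a, w}" using e E2[of e] card2_iff_pair[of e a] by auto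
    have "w \<noteq> b" using neq w by auto
    show False
    proof (cases "w \<in> set p")
      case True
      then obtain j where j: "j < length p" "p ! j = w" by (auto simp: in_set_conv_nth)
      \<comment> \<open>As \<open>w\<close> is neither of the first two vertices, the initial
        segment up to \<open>w\<close> has at least three vertices.\<close>
      then have "2 \<le> j" using w \<open>w \<noteq> b\<close> unfolding p_eq by (cases j; cases "j - 1") auto
      have "graph_cycle E (take (Suc j) p)"
        unfolding graph_cycle_def
      proof (intro conjI allI impI)
        show "3 \<le> length (take (Suc j) p)" using j \<open>2 \<le> j\<close> by simp
        show "distinct (take (Suc j) p)" using p by (simp add: path_def)
        fix i assume i: "i < length (take (Suc j) p)"
        show "{take (Suc j) p ! i, take (Suc j) p ! (Suc i mod length (take (Suc j) p))} \<in> E"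
        proof (cases "i = j")
          case True
          have "take (Suc j) p ! j = w" "length (take (Suc j) p) = Suc j"
            using j by simp_all
          moreover have "take (Suc j) p ! 0 = a"
            by (simp add: p_eq)
          ultimately show ?thesis using True e w by (simp add: insert_commute)
        next
          case False
          then show ?thesis using i j p by (simp add: path_def)
        qed
      qed
      then show False using acyc by blast
    next
      case False
      have "path (w # p)"
        unfolding path_def
      proof (intro conjI allI impI)
        fix i assume "Suc i < length (w # p)"
        then show "{(w # p) ! i, (w # p) ! Suc i} \<in> E"
          using p e w by (cases i) (auto simp: path_def p_eq insert_commute)
      qed (use False p in \<open>auto simp: path_def\<close>)
      then show False using max[of "w # p"] by simp
    qed
  qed
  then show ?thesis using that ab by blast
qed

definition has_matching :: "'v set set \<Rightarrow> nat \<Rightarrow> 'v set \<Rightarrow> bool" where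
  "has_matching E k W \<longleftrightarrow> (\<exists>M. matching E M \<and> finite M \<and> card M = k \<and> \<Union>M \<subseteq> W)"

lemma has_matching_mono: "has_matching E k W \<Longrightarrow> E \<subseteq> E' \<Longrightarrow> W \<subseteq> W' \<Longrightarrow> has_matching E' k W'"
  unfolding has_matching_def matching_def by blast

lemma has_matching_0: "has_matching E 0 W"
  by (auto simp: has_matching_def matching_def intro!: exI[of _ "{}"])

text \<open>Weak duality of matchings and vertex covers: choosing a vertex of \<open>C\<close> on
  each edge is injective on disjoint edges.\<close>

lemma has_matching_le_cover:
  assumes "has_matching E k W" "finite C" "\<And>e. e \<in> E \<Longrightarrow> e \<subseteq> W \<Longrightarrow> e \<inter> C \<noteq> {}"
  shows "k \<le> card C"
proof -
  obtain M where M: "M \<subseteq> E" "disjoint M" "card M = k" "\<Union>M \<subseteq> W"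
    using assms(1) by (auto simp: has_matching_def matching_def)
  have "\<forall>e\<in>M. \<exists>x. x \<in> e \<inter> C" using assms(3) M by blast
  then obtain f where f: "\<And>e. e \<in> M \<Longrightarrow> f e \<in> e \<inter> C" by metis
  have "inj_on f M"
  proof (rule inj_onI)
    fix e e' assume "e \<in> M" "e' \<in> M" "f e = f e'"
    then show "e = e'" using f[of e] f[of e'] M(2) by (auto dest: disjointD)
  qed
  then show ?thesis using card_inj_on_le[of f M C] f M(3) assms(2) by auto
qed

text \<open>An exchange: the matching edge at \<open>a\<close>, or any edge if there is none, is
  given up for the pendant edge. The other edges avoid \<open>b\<close> as well, since the only edge
  at \<open>b\<close> contains \<open>a\<close>.\<close>

lemma has_matching_pendant:
  assumes ab: "{a, b} \<in> E" and pend: "\<And>e. e \<in> E \<Longrightarrow> b \<in> e \<Longrightarrow> e = {a, b}" and W: "a \<in> W" "b \<in> W"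
  shows "has_matching E (Suc k) W \<longleftrightarrow> has_matching {e \<in> E. a \<notin> e \<and> b \<notin> e} k W"
proof
  assume "has_matching E (Suc k) W"
  then obtain M where M: "M \<subseteq> E" "disjoint M" "finite M" "card M = Suc k" "\<Union>M \<subseteq> W"
    by (auto simp: has_matching_def matching_def)
  obtain e where e: "e \<in> M" "\<And>e'. e' \<in> M \<Longrightarrow> a \<in> e' \<Longrightarrow> e' = e"
  proof (cases "\<exists>e\<in>M. a \<in> e")
    case True
    then show ?thesis using that M(2) by (metis disjointD disjoint_iff)
  next
    case False
    moreover obtain e where "e \<in> M" using M(4) by fastforce
    ultimately show ?thesis using that by blast
  qed
  have "M - {e} \<subseteq> {e \<in> E. a \<notin> e \<and> b \<notin> e}"
    using M(1) e(2) pend by blast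
  moreover have "disjoint (M - {e})" using M(2) by (auto simp: disjoint_def)
  ultimately show "has_matching {e \<in> E. a \<notin> e \<and> b \<notin> e} k W"
    unfolding has_matching_def matching_def using M e(1) by (intro exI[of _ "M - {e}"]) auto
next
  assume "has_matching {e \<in> E. a \<notin> e \<and> b \<notin> e} k W"
  then obtain M where M: "M \<subseteq> {e \<in> E. a \<notin> e \<and> b \<notin> e}" "disjoint M" "finite M" "card M = k" "\<Union>M \<subseteq> W"
    by (auto simp: has_matching_def matching_def)
  have "disjoint (insert {a, b} M)" using M(1,2) by (auto simp: disjoint_def)
  moreover have "{a, b} \<notin> M" using M(1) by auto
  ultimately show "has_matching E (Suc k) W"
    unfolding has_matching_def matching_def
    using M ab W by (intro exI[of _ "insert {a, b} M"]) auto
qed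

text \<open>\<open>C\<close> collects the vertices chosen by passing to stars.\<close>

definition matching_free :: "'v set \<Rightarrow> 'v set \<Rightarrow> 'v set set \<Rightarrow> nat \<Rightarrow> 'v set set" where
  "matching_free U C E k = {W. W \<subseteq> U \<and> \<not> has_matching E k (C \<union> W)}"

lemma down_closed_matching_free: "down_closed (matching_free U C E k)"
  unfolding down_closed_def matching_free_def
  by (auto dest: has_matching_mono[OF _ subset_refl Un_mono[OF subset_refl]])

lemma star_matching_free: "x \<in> U \<Longrightarrow> star x (matching_free U C E k) = matching_free U (insert x C) E k"
  by (auto simp: star_def matching_free_def)

lemma del_matching_free: "del x (matching_free U C E k) = matching_free (U - {x}) C E k"
  by (auto simp: del_def matching_free_def)

text \<open>With both ends chosen, the pendant edge is always available; it accounts for one of the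
  \<open>k\<close> edges and uses up its two vertices.\<close>

lemma matching_free_pendant:
  assumes "{a, b} \<in> E" "\<And>e. e \<in> E \<Longrightarrow> b \<in> e \<Longrightarrow> e = {a, b}" "a \<in> C" "b \<in> C" "k > 0"
  shows "matching_free U C E k = matching_free U C {e \<in> E. a \<notin> e \<and> b \<notin> e} (k - 1)"
  using has_matching_pendant[OF assms(1,2), of "C \<union> _" "k - 1"] assms(3-5)
  by (auto simp: matching_free_def)

lemma has_matching_restrict:
  assumes "\<And>e. e \<in> E \<Longrightarrow> e \<subseteq> W \<Longrightarrow> e \<in> E' \<and> e \<subseteq> W'"
  shows "has_matching E k W \<Longrightarrow> has_matching E' k W'"
  unfolding has_matching_def matching_def using assms by (metis Union_least Union_upper subset_iff)

lemma matching_free_delete: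
  assumes "x \<notin> U" "x \<notin> C"
  shows "matching_free U C E k = matching_free U C {e \<in> E. x \<notin> e} k"
proof -
  have "has_matching E k (C \<union> W) \<longleftrightarrow> has_matching {e \<in> E. x \<notin> e} k (C \<union> W)" if "W \<subseteq> U" for W
    using assms that by (intro iffI; elim has_matching_restrict[rotated]) auto
  then show ?thesis by (auto simp: matching_free_def)
qed

lemma matching_free_drop:
  assumes "\<And>e. e \<in> E \<Longrightarrow> x \<notin> e"
  shows "matching_free U (insert x C) E k = matching_free U C E k"
proof -
  have "has_matching E k (insert x C \<union> W) \<longleftrightarrow> has_matching E k (C \<union> W)" for W
    using assms by (intro iffI; elim has_matching_restrict[rotated]) auto
  then show ?thesis by (auto simp: matching_free_def)
qed

text \<open>A vertex cover with fewer than \<open>k\<close> vertices excludes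
  \<open>k\<close>-matchings altogether; this is where the simplices of the decomposition come
  from.\<close>

lemma matching_free_eq_Pow:
  assumes "finite C'" "\<And>e. e \<in> E \<Longrightarrow> e \<inter> C' \<noteq> {}" "card C' < k"
  shows "matching_free U C E k = Pow U"
proof -
  have "\<not> has_matching E k W" for W
  proof
    assume "has_matching E k W"
    then have "k \<le> card C'"
      by (rule has_matching_le_cover[OF _ assms(1)]) (rule assms(2))
    with assms(3) show False by simp
  qed
  then show ?thesis by (auto simp: matching_free_def)
qed

section \<open>Whiskered graphs and their decomposition\<close>

definition whiskered :: "('v \<Rightarrow> 'v) \<Rightarrow> 'v set \<Rightarrow> 'v set set \<Rightarrow> 'v set set" where
  "whiskered y A F = F \<union> (\<lambda>x. {x, y x}) ` A"

definition whisker_base :: "('v \<Rightarrow> 'v) \<Rightarrow> 'v set \<Rightarrow> 'v set set \<Rightarrow> bool" where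
  "whisker_base y A F \<longleftrightarrow> finite A \<and> inj_on y A \<and> y ` A \<inter> A = {} \<and>
     (\<forall>e\<in>F. e \<subseteq> A \<and> card e = 2) \<and> (\<nexists>c. graph_cycle F c)"

lemma whisker_base_restrict:
  assumes "whisker_base y A F" "\<And>e. e \<in> F' \<Longrightarrow> e \<in> F \<and> e \<subseteq> A'" "A' \<subseteq> A"
  shows "whisker_base y A' F'"
proof -
  have "graph_cycle F c" if "graph_cycle F' c" for c
    using that assms(2) by (auto simp: graph_cycle_def)
  moreover have "y ` A' \<inter> A' = {}"
    using assms(1,3) unfolding whisker_base_def by blast
  ultimately show ?thesis
    using assms unfolding whisker_base_def by (meson finite_subset inj_on_subset)
qed

text \<open>Vertices of \<open>U\<close> outside \<open>A\<close> and its tips lie in no edge; they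
  are cone points left behind by earlier choices. For 1 \<le> k \<le> card A, the number card U + k
  - card A - 1 is the size of a facet made of \<open>U - A\<close> and k - 1 vertices of
  \<open>A\<close>. Every recursive call keeps this number, so the first inequality persists; the
  second one is the bound for the simplex reached when \<open>k\<close> exceeds
  \<open>card A\<close>.\<close>

lemma decomposable_matching_free_whiskered:
  assumes "finite V" "whisker_base y A F" "A \<union> y ` A \<subseteq> U" "U \<subseteq> V"
    and "r + 1 + card A \<le> card U + k" "r \<le> card U"
  shows "decomposable V r (matching_free U {} (whiskered y A F) k)"
  using assms(2-)
proof (induction "card A" arbitrary: A F U k rule: less_induct)
  case less
  have finA: "finite A" and inj: "inj_on y A" and disj: "y ` A \<inter> A = {}"
    and F: "\<And>e. e \<in> F \<Longrightarrow> e \<subseteq> A \<and> card e = 2" and acyc: "\<nexists>c. graph_cycle F c"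
    using less.prems(1) by (auto simp: whisker_base_def)
  have finU: "finite U" using less.prems assms(1) finite_subset by blast
  let ?E = "whiskered y A F"
  consider "k = 0" | "card A < k" | "0 < k" "k \<le> card A" by linarith
  then show ?case
  proof cases
    case 1
    then have "matching_free U {} ?E k = {}" by (simp add: matching_free_def has_matching_0)
    then show ?thesis by (simp add: decomposable.void)
  next
    case 2
    have "e \<inter> A \<noteq> {}" if "e \<in> ?E" for e
    proof (cases "e \<in> F")
      case True
      then show ?thesis using F[of e] by (auto simp: card_2_iff)
    next
      case False
      then show ?thesis using that by (auto simp: whiskered_def)
    qed
    then have "matching_free U {} ?E k = Pow U" by (rule matching_free_eq_Pow[OF finA _ 2])
    then show ?thesis using less.prems by (simp add: decomposable.simplex)
  next
    case 3
    have finF: "finite (\<Union>F)" using F finA by (meson Sup_least finite_subset)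
    \<comment> \<open>A leaf or an isolated vertex of the base: apart from its whisker, at most one
      edge at \<open>x1\<close> exists.\<close>
    obtain x1 where x1: "x1 \<in> A"
      and leaf: "(\<forall>e\<in>F. x1 \<notin> e) \<or> (\<exists>x2. x2 \<noteq> x1 \<and> {x1, x2} \<in> F \<and> (\<forall>e\<in>F. x1 \<in> e \<longrightarrow> e = {x1, x2}))"
    proof (cases "F = {}")
      case True
      then show ?thesis using 3 that by fastforce
    next
      case False
      obtain a b where ab: "a \<noteq> b" "{a, b} \<in> F" "\<And>e. e \<in> F \<Longrightarrow> a \<in> e \<Longrightarrow> e = {a, b}"
        using exists_leaf[OF finF _ acyc False] F by blast
      show ?thesis
      proof (rule that[of a])
        show "a \<in> A" using F[OF ab(2)] by blast
        show "(\<forall>e\<in>F. a \<notin> e) \<or> (\<exists>x2. x2 \<noteq> a \<and> {a, x2} \<in> F \<and> (\<forall>e\<in>F. a \<in> e \<longrightarrow> e = {a, x2}))"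
          by (intro disjI2 exI[of _ b] conjI ballI impI) (rule ab ab(1)[symmetric] | assumption)+
      qed
    qed
    let ?y1 = "y x1"
    have y1: "?y1 \<notin> A" "?y1 \<in> U" "x1 \<in> U" using x1 disj less.prems by auto
    have yy: "?y1 = y z \<longleftrightarrow> x1 = z" if "z \<in> A" for z using inj x1 that by (rule inj_on_eq_iff)
    have Fy: "?y1 \<notin> e" if "e \<in> F" for e using F[OF that] y1 by blast
    have cA: "card A = Suc (card (A - {x1}))" using card_Suc_Diff1[OF finA x1] by simp
    have yA: "y z \<noteq> x" if "z \<in> A" "x \<in> A" for z x using disj that by auto
    let ?A1 = "A - {x1}" and ?F1 = "{e \<in> F. x1 \<notin> e}"
    let ?E1 = "whiskered y ?A1 ?F1" and ?E' = "whiskered y ?A1 F"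
    have wb1: "whisker_base y ?A1 ?F1"
      using F by (intro whisker_base_restrict[OF less.prems(1)]) auto
    have E1: "{e \<in> ?E. x1 \<notin> e} = ?E1"
      using x1 yA by (auto simp: whiskered_def)
    have E': "{e \<in> ?E. ?y1 \<notin> e} = ?E'"
      using x1 y1 by (auto simp: whiskered_def Fy yy)
    have E1': "{e \<in> ?E. x1 \<notin> e \<and> ?y1 \<notin> e} = ?E1"
      using x1 y1 yA by (auto simp: whiskered_def Fy yy)
    have E1_avoid: "x1 \<notin> e" "?y1 \<notin> e" if "e \<in> ?E1" for e
      using that E1' by blast+
    have drop1: "matching_free W (insert x1 C) ?E1 j = matching_free W C ?E1 j"
      "matching_free W (insert ?y1 C) ?E1 j = matching_free W C ?E1 j" for W C j
      by (rule matching_free_drop, rule E1_avoid, assumption)+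
    have pend: "e = {x1, ?y1}" if "e \<in> ?E" "?y1 \<in> e" for e
      using that Fy y1 by (auto simp: whiskered_def yy)
    have wE: "{x1, ?y1} \<in> ?E" using x1 by (simp add: whiskered_def)
    have sub1: "?A1 \<union> y ` ?A1 \<subseteq> U - {x1}" "?A1 \<union> y ` ?A1 \<subseteq> U - {?y1}"
      using less.prems(2) yA y1 x1 yy by (auto simp: eq_commute[of "y _" ?y1])
    show ?thesis
    proof (rule decomposable.split[of x1])
      show "x1 \<in> V" using y1 less.prems by auto
      \<comment> \<open>Without \<open>x1\<close> its tip lies in no edge and becomes a cone point;
        \<open>A\<close> and \<open>U\<close> lose one vertex each. Here r \<le> card U - 1 because
        of \<open>k \<le> card A\<close>.\<close>
      have "del x1 (matching_free U {} ?E k) = matching_free (U - {x1}) {} ?E1 k"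
        unfolding del_matching_free by (subst matching_free_delete[of x1]) (simp_all add: E1)
      also have "decomposable V r \<dots>"
        using less.prems 3 cA y1 finU by (intro less.hyps wb1 sub1) auto
      finally show "decomposable V r (del x1 (matching_free U {} ?E k))" .
      have st1: "star x1 (matching_free U {} ?E k) = matching_free U {x1} ?E k"
        using y1 by (simp add: star_matching_free)
      show "decomposable V r (star x1 (matching_free U {} ?E k))"
        unfolding st1
      proof (rule decomposable.split[of ?y1])
        show "?y1 \<in> V" using y1 less.prems by auto
        \<comment> \<open>Both ends of the pendant whisker are chosen: \<open>k\<close> and
          \<open>card A\<close> drop by one, \<open>U\<close> stays.\<close>
        have "star ?y1 (matching_free U {x1} ?E k) = matching_free U {?y1, x1} ?E k"
          using y1 by (simp add: star_matching_free)
        also have "\<dots> = matching_free U {?y1, x1} ?E1 (k - 1)"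
          unfolding E1'[symmetric] by (rule matching_free_pendant[OF wE pend]) (use 3 in simp_all)
        also have "\<dots> = matching_free U {} ?E1 (k - 1)"
          by (simp only: drop1)
        also have "decomposable V r \<dots>"
          using less.prems 3 cA sub1 by (intro less.hyps wb1) auto
        finally show "decomposable V r (star ?y1 (matching_free U {x1} ?E k))" .
        have del1: "del ?y1 (matching_free U {x1} ?E k) = matching_free (U - {?y1}) {x1} ?E' k"
          unfolding del_matching_free
          by (subst matching_free_delete[of ?y1]) (use y1 x1 in \<open>auto simp: E'\<close>)
        show "decomposable V r (del ?y1 (matching_free U {x1} ?E k))"
          unfolding del1
        \<comment> \<open>The deletion of two vertices below needs r \<le> card U - 2, which follows
          from \<open>k < card A\<close>. If \<open>k = card A\<close>, the vertices of
          \<open>A\<close> other than \<open>x1\<close> cover all edges and are fewer than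
          \<open>k\<close>, so a simplex is reached at once.\<close>
        proof (cases "k = card A")
          case True
          have "e \<inter> ?A1 \<noteq> {}" if "e \<in> ?E'" for e
          proof (cases "e \<in> F")
            case True
            then show ?thesis using F[of e] by (auto simp: card_2_iff)
          next
            case False
            then show ?thesis using that by (auto simp: whiskered_def)
          qed
          then have "matching_free (U - {?y1}) {x1} ?E' k = Pow (U - {?y1})"
            by (rule matching_free_eq_Pow[rotated]) (use finA cA True in auto)
          moreover have "r \<le> card (U - {?y1})" using y1 finU True less.prems by simp
          ultimately show "decomposable V r (matching_free (U - {?y1}) {x1} ?E' k)"
            using less.prems by (auto intro!: decomposable.simplex)
        next
          case False
          then have k: "k < card A" using 3 by simp
          show "decomposable V r (matching_free (U - {?y1}) {x1} ?E' k)"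
            using leaf
          proof
            assume "\<forall>e\<in>F. x1 \<notin> e"
            then have "?F1 = F" by auto
            then have "matching_free (U - {?y1}) {x1} ?E' k = matching_free (U - {?y1}) {x1} ?E1 k"
              by (simp only:)
            also have "\<dots> = matching_free (U - {?y1}) {} ?E1 k"
              by (simp only: drop1)
            also have "decomposable V r \<dots>"
              using less.prems 3 cA y1 finU k by (intro less.hyps wb1 sub1) auto
            finally show ?thesis .
          next
            assume "\<exists>x2. x2 \<noteq> x1 \<and> {x1, x2} \<in> F \<and> (\<forall>e\<in>F. x1 \<in> e \<longrightarrow> e = {x1, x2})"
            then obtain x2 where x2: "x2 \<noteq> x1" "{x1, x2} \<in> F" "\<And>e. e \<in> F \<Longrightarrow> x1 \<in> e \<Longrightarrow> e = {x1, x2}"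
              by blast
            then have x2A: "x2 \<in> A" using F by auto
            let ?A2 = "A - {x1, x2}" and ?F2 = "{e \<in> F. x1 \<notin> e \<and> x2 \<notin> e}"
            let ?E2 = "whiskered y ?A2 ?F2"
            have wb2: "whisker_base y ?A2 ?F2"
              using F by (intro whisker_base_restrict[OF less.prems(1)]) auto
            have "?A2 = ?A1 - {x2}" by blast
            moreover have "Suc (card (?A1 - {x2})) = card ?A1"
              by (rule card_Suc_Diff1) (use finA x2A x2(1) in auto)
            ultimately have cA2: "card A = Suc (Suc (card ?A2))"
              using cA by (simp only:)
            have E2: "{e \<in> ?E'. x2 \<notin> e \<and> x1 \<notin> e} = ?E2"
              using yA x2A x1 by (auto simp: whiskered_def)
            have E2_avoid: "x1 \<notin> e" "x2 \<notin> e" if "e \<in> ?E2" for e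
              using that unfolding E2[symmetric] by simp_all
            have drop2: "matching_free W (insert x1 C) ?E2 j = matching_free W C ?E2 j"
              "matching_free W (insert x2 C) ?E2 j = matching_free W C ?E2 j" for W C j
              by (rule matching_free_drop, rule E2_avoid, assumption)+
            have pend2: "e = {x2, x1}" if e: "e \<in> ?E'" "x1 \<in> e" for e
            proof -
              have "e \<in> F" using e yA x1 by (auto simp: whiskered_def)
              then show ?thesis using x2(3)[OF _ e(2)] by (simp only: insert_commute)
            qed
            \<comment> \<open>Deleting \<open>x2\<close> removes the last edge at
              \<open>x1\<close>.\<close>
            have "{e \<in> ?E'. x2 \<notin> e} = {e \<in> ?E'. x2 \<notin> e \<and> x1 \<notin> e}"
              using pend2 by blast
            then have E2': "{e \<in> ?E'. x2 \<notin> e} = ?E2"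
              by (simp only: E2)
            have wE2: "{x2, x1} \<in> ?E'" using x2(2) by (simp add: whiskered_def insert_commute)
            have x2U: "x2 \<in> U - {?y1}" using x2A less.prems(2) y1 by auto
            have sub2: "?A2 \<union> y ` ?A2 \<subseteq> U - {?y1}" "?A2 \<union> y ` ?A2 \<subseteq> U - {?y1} - {x2}"
              using sub1 yA x2A by auto
            show ?thesis
            proof (rule decomposable.split[of x2])
              show "x2 \<in> V" using x2U less.prems by auto
              \<comment> \<open>Without its tip, \<open>x1\<close> is a leaf with neighbour
                \<open>x2\<close>, and both are chosen: their edge counts for one of the
                \<open>k\<close>, and two base vertices disappear, while \<open>U\<close> has lost
                only the tip of \<open>x1\<close>.\<close>
              have "star x2 (matching_free (U - {?y1}) {x1} ?E' k) = matching_free (U - {?y1}) {x2, x1} ?E' k"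
                using x2U by (simp add: star_matching_free)
              also have "\<dots> = matching_free (U - {?y1}) {x2, x1} ?E2 (k - 1)"
                unfolding E2[symmetric] by (rule matching_free_pendant[OF wE2 pend2]) (use 3 in simp_all)
              also have "\<dots> = matching_free (U - {?y1}) {} ?E2 (k - 1)"
                by (simp only: drop2)
              also have "decomposable V r \<dots>"
                using less.prems 3 cA2 y1 finU k by (intro less.hyps wb2 sub2) auto
              finally show "decomposable V r (star x2 (matching_free (U - {?y1}) {x1} ?E' k))" .
              have "del x2 (matching_free (U - {?y1}) {x1} ?E' k) = matching_free (U - {?y1} - {x2}) {x1} ?E2 k"
                unfolding del_matching_free
                by (subst matching_free_delete[of x2]) (use x2(1) in \<open>simp_all add: E2'\<close>)
              also have "\<dots> = matching_free (U - {?y1} - {x2}) {} ?E2 k"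
                by (simp only: drop2)
              also have "decomposable V r \<dots>"
              proof (intro less.hyps wb2 sub2)
                have "card (U - {?y1} - {x2}) = card U - 2" using y1 x2U finU by simp
                then show "r + 1 + card ?A2 \<le> card (U - {?y1} - {x2}) + k" "r \<le> card (U - {?y1} - {x2})"
                  using less.prems cA2 k by linarith+
              qed (use less.prems cA2 in auto)
              finally show "decomposable V r (del x2 (matching_free (U - {?y1}) {x1} ?E' k))" .
            qed
          qed
        qed
      qed
    qed
  qed
qed


section \<open>Well-covered forests\<close>

definition stable_set :: "'v set set \<Rightarrow> 'v set \<Rightarrow> bool" where
  "stable_set E W \<longleftrightarrow> (\<forall>e\<in>E. \<not> e \<subseteq> W)"

text \<open>The facets of the independence complex.\<close>

definition maximal_stable :: "'v set \<Rightarrow> 'v set set \<Rightarrow> 'v set \<Rightarrow> bool" where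
  "maximal_stable V E W \<longleftrightarrow>
     W \<subseteq> V \<and> stable_set E W \<and> (\<forall>x\<in>V - W. \<not> stable_set E (insert x W))"

lemma stable_setD: "stable_set E W \<Longrightarrow> e \<in> E \<Longrightarrow> e \<subseteq> W \<Longrightarrow> False"
  by (auto simp: stable_set_def)

lemma exists_maximal_stable:
  assumes "finite V" "W \<subseteq> V" "stable_set E W"
  obtains S where "maximal_stable V E S" "W \<subseteq> S"
proof -
  define C where "C = {S. W \<subseteq> S \<and> S \<subseteq> V \<and> stable_set E S}"
  have "finite C" "W \<in> C" using assms by (simp_all add: C_def)
  then obtain S where S: "S \<in> C" "\<forall>T\<in>C. S \<subseteq> T \<longrightarrow> S = T"
    using finite_has_maximal2[of C W] by blast
  have "\<not> stable_set E (insert x S)" if x: "x \<in> V - S" for x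
  proof
    assume "stable_set E (insert x S)"
    then have "insert x S \<in> C" using S(1) x by (auto simp: C_def)
    then have "S = insert x S" using S(2) by blast
    then show False using x by blast
  qed
  then show ?thesis using that[of S] S(1) by (simp add: maximal_stable_def C_def)
qed

text \<open>Removing a leaf and its neighbour from a well-covered forest leaves a well-covered forest;
  no vertex becomes isolated, since two leaves at the same vertex could be exchanged for it.\<close>

lemma well_covered_forest_perfect_matching:
  assumes "finite V" "\<And>e. e \<in> E \<Longrightarrow> e \<subseteq> V \<and> card e = 2" "\<nexists>c. graph_cycle E c"
    and "\<And>v. v \<in> V \<Longrightarrow> \<exists>e\<in>E. v \<in> e"
    and "\<And>S. maximal_stable V E S \<Longrightarrow> card S = s"
  shows "\<exists>M. matching E M \<and> \<Union>M = V \<and> card M = s"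
  using assms
proof (induction "card V" arbitrary: V E s rule: less_induct)
  case less
  have finV: "finite V" and E: "\<And>e. e \<in> E \<Longrightarrow> e \<subseteq> V" "\<And>e. e \<in> E \<Longrightarrow> card e = 2"
    and acyc: "\<nexists>c. graph_cycle E c"
    using less.prems(1,2,3) by auto
  note noiso = less.prems(4) and wc = less.prems(5)
  show ?case
  proof (cases "V = {}")
    case True
    have "E = {}"
    proof (rule ccontr)
      assume "E \<noteq> {}"
      then obtain e where "e \<in> E" by blast
      then show False using E[of e] True by simp
    qed
    then have "maximal_stable V E {}"
      using True by (simp add: maximal_stable_def stable_set_def)
    then have "s = 0" using wc[of "{}"] by simp
    then show ?thesis using True by (intro exI[of _ "{}"]) (simp add: matching_def)
  next
    case False
    then have "E \<noteq> {}" using noiso by blast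
    moreover have "finite (\<Union>E)"
      using E(1) finV by (meson Sup_least finite_subset)
    ultimately obtain a b where ab: "a \<noteq> b" "{a, b} \<in> E" and leaf: "\<And>e. e \<in> E \<Longrightarrow> a \<in> e \<Longrightarrow> e = {a, b}"
      using exists_leaf[OF _ E(2) acyc] by blast
    have abV: "a \<in> V" "b \<in> V" using E(1)[OF ab(2)] by auto
    let ?V = "V - {a, b}" and ?E = "{e \<in> E. a \<notin> e \<and> b \<notin> e}"
    \<comment> \<open>Adding the leaf \<open>a\<close> makes a maximal stable set of the smaller
      graph maximal in the whole graph, so all of them have s - 1 elements.\<close>
    have lift: "maximal_stable V E (insert a S)" and aS: "a \<notin> S" if S: "maximal_stable ?V ?E S" for S
    proof -
      have S': "S \<subseteq> ?V" "stable_set ?E S" using S by (auto simp: maximal_stable_def)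
      then show "a \<notin> S" by auto
      have "\<not> e \<subseteq> insert a S" if e: "e \<in> E" for e
      proof
        assume sub: "e \<subseteq> insert a S"
        have "b \<notin> insert a S" using S'(1) ab(1) by auto
        then have "b \<notin> e" using sub by blast
        then have "a \<notin> e" using leaf[OF e] by auto
        then have "e \<in> ?E" "e \<subseteq> S" using e sub \<open>b \<notin> e\<close> by auto
        then show False using S'(2) stable_setD by metis
      qed
      moreover have "\<not> stable_set E (insert x (insert a S))" if x: "x \<in> V - insert a S" for x
      proof (cases "x = b")
        case True
        then have "{a, b} \<subseteq> insert x (insert a S)" by simp
        then show ?thesis using ab(2) stable_setD by metis
      next
        case False
        then have "x \<in> ?V - S" using x by auto
        then have "\<not> stable_set ?E (insert x S)" using S by (simp add: maximal_stable_def)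
        then obtain e where "e \<in> E" "e \<subseteq> insert x S" by (auto simp: stable_set_def)
        then have "e \<subseteq> insert x (insert a S)" by blast
        then show ?thesis using \<open>e \<in> E\<close> stable_setD by metis
      qed
      moreover have "insert a S \<subseteq> V" using S'(1) abV by blast
      ultimately show "maximal_stable V E (insert a S)"
        by (simp add: maximal_stable_def stable_set_def)
    qed
    have cardS: "Suc (card S) = s" if S: "maximal_stable ?V ?E S" for S
    proof -
      have "finite S" using S finV by (auto simp: maximal_stable_def intro: finite_subset)
      then show ?thesis using wc[OF lift[OF S]] aS[OF S] by simp
    qed
    have "stable_set ?E {}" using E(2) by (fastforce simp: stable_set_def)
    then obtain S0 where "maximal_stable ?V ?E S0"
      using exists_maximal_stable[of ?V "{}" ?E] finV by auto
    then have s: "s > 0" using cardS by auto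
    have "\<exists>M. matching ?E M \<and> \<Union>M = ?V \<and> card M = s - 1"
    proof (rule less.hyps)
      show "card ?V < card V" using finV abV by (intro psubset_card_mono) auto
      show "finite ?V" using finV by simp
      show "e \<subseteq> ?V \<and> card e = 2" if "e \<in> ?E" for e using that E[of e] by auto
      show "\<nexists>c. graph_cycle ?E c" using acyc by (auto simp: graph_cycle_def)
      show "card S = s - 1" if "maximal_stable ?V ?E S" for S using cardS[OF that] by simp
      show "\<exists>e\<in>?E. v \<in> e" if v: "v \<in> ?V" for v
      proof (rule ccontr)
        assume no: "\<not> (\<exists>e\<in>?E. v \<in> e)"
        have va: "v \<noteq> a" and vb: "v \<noteq> b" and vV: "v \<in> V" using v by auto
        \<comment> \<open>A vertex isolated by the removal has \<open>b\<close> as its only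
          neighbour.\<close>
        have bv: "b \<in> e" if e: "e \<in> E" "v \<in> e" for e
        proof (rule ccontr)
          assume "b \<notin> e"
          moreover have "a \<notin> e" using leaf[OF e(1)] e(2) va vb by auto
          ultimately show False using no e by auto
        qed
        obtain e0 where e0: "e0 \<in> E" "v \<in> e0" using noiso[OF vV] by blast
        then have e0': "e0 = {b, v}" using card2_eq_pair[of e0 b v] bv[OF e0] E(2)[OF e0(1)] vb by auto
        have "stable_set E {b}"
          unfolding stable_set_def
        proof (intro ballI notI)
          fix e assume "e \<in> E" "e \<subseteq> {b}"
          then show False using E(2)[of e] card_mono[of "{b}" e] by simp
        qed
        then obtain T where T: "maximal_stable V E T" "b \<in> T"
          using exists_maximal_stable[OF finV, of "{b}" E] abV by auto
        then have Ti: "stable_set E T" and TV: "T \<subseteq> V" by (simp_all add: maximal_stable_def)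
        have finT: "finite T" using TV finV finite_subset by blast
        have aT: "a \<notin> T" using stable_setD[OF Ti ab(2)] T(2) by auto
        have vT: "v \<notin> T" using stable_setD[OF Ti e0(1)] T(2) e0' by auto
        \<comment> \<open>Trading \<open>b\<close> for the two leaves \<open>a\<close> and
          \<open>v\<close> keeps the set stable and enlarges it, against the equality of all
          sizes.\<close>
        let ?T = "insert a (insert v (T - {b}))"
        have "stable_set E ?T"
          unfolding stable_set_def
        proof (intro ballI notI)
          fix e assume e: "e \<in> E" "e \<subseteq> ?T"
          have "b \<notin> ?T" using ab(1) vb by auto
          then have be: "b \<notin> e" using e(2) by blast
          have "v \<notin> e" using bv[OF e(1)] be by blast
          moreover have "a \<notin> e" using leaf[OF e(1)] be by blast
          ultimately have "e \<subseteq> T" using e(2) by blast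
          then show False using stable_setD[OF Ti e(1)] by blast
        qed
        then obtain T' where T': "maximal_stable V E T'" "?T \<subseteq> T'"
          using exists_maximal_stable[OF finV, of ?T E] TV abV vV by blast
        have "finite T'" using T'(1) finV finite_subset by (auto simp: maximal_stable_def)
        then have "card ?T \<le> card T'" using T'(2) card_mono by blast
        moreover have "card ?T = Suc (card T)"
        proof -
          have "card ?T = Suc (Suc (card (T - {b})))" using finT aT vT va by simp
          then show ?thesis using card_Suc_Diff1[OF finT T(2)] by simp
        qed
        ultimately show False using wc[OF T(1)] wc[OF T'(1)] by simp
      qed
    qed
    then obtain M where M: "matching ?E M" "\<Union>M = ?V" "card M = s - 1" by blast
    have M': "M \<subseteq> ?E" "disjoint M" using M(1) by (simp_all add: matching_def)
    have "finite M" using M(2) finV by (metis finite_Diff finite_UnionD)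
    have nM: "{a, b} \<notin> M" using M'(1) by auto
    have "matching E (insert {a, b} M)"
      unfolding matching_def
    proof
      show "insert {a, b} M \<subseteq> E" using M'(1) ab(2) by blast
      show "disjoint (insert {a, b} M)" using M' by (auto simp: disjoint_def)
    qed
    moreover have "\<Union>(insert {a, b} M) = V" using M(2) abV by auto
    moreover have "card (insert {a, b} M) = s" using \<open>finite M\<close> nM M(3) s by simp
    ultimately show ?thesis by blast
  qed
qed

lemma graph_cycle_3:
  assumes "distinct [a, b, c]" "{a, b} \<in> E" "{b, c} \<in> E" "{c, a} \<in> E"
  shows "graph_cycle E [a, b, c]"
proof -
  have "{[a, b, c] ! i, [a, b, c] ! (Suc i mod 3)} \<in> E" if "i < 3" for i
  proof -
    from that consider "i = 0" | "i = 1" | "i = 2" by linarith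
    then show ?thesis by cases (simp_all add: assms(2-4))
  qed
  then show ?thesis using assms(1) by (simp add: graph_cycle_def)
qed

lemma graph_cycle_4:
  assumes "distinct [a, b, c, d]" "{a, b} \<in> E" "{b, c} \<in> E" "{c, d} \<in> E" "{d, a} \<in> E"
  shows "graph_cycle E [a, b, c, d]"
proof -
  have "{[a, b, c, d] ! i, [a, b, c, d] ! (Suc i mod 4)} \<in> E" if "i < 4" for i
  proof -
    from that consider "i = 0" | "i = 1" | "i = 2" | "i = 3" by linarith
    then show ?thesis by cases (simp_all add: assms(2-5))
  qed
  then show ?thesis using assms(1) by (simp add: graph_cycle_def)
qed

text \<open>In a perfect matching of a well-covered forest every edge \<open>xz\<close> is pendant: otherwise further
  neighbours \<open>z'\<close> of \<open>x\<close> and \<open>x'\<close> of \<open>z\<close> extend to a stable set missing \<open>xz\<close>.\<close>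

lemma matching_edge_pendant:
  assumes finV: "finite V" and E: "\<And>e. e \<in> E \<Longrightarrow> e \<subseteq> V" "\<And>e. e \<in> E \<Longrightarrow> card e = 2"
    and acyc: "\<nexists>c. graph_cycle E c"
    and wc: "\<And>S. maximal_stable V E S \<Longrightarrow> card S = s"
    and M: "matching E M" "\<Union>M = V" "card M = s" and e: "e \<in> M"
  shows "\<exists>b\<in>e. \<forall>f\<in>E. b \<in> f \<longrightarrow> f = e"
proof (rule ccontr)
  assume contra: "\<not> ?thesis"
  have ME: "M \<subseteq> E" and disj: "disjoint M" using M(1) by (simp_all add: matching_def)
  have finM: "finite M" using M(2) finV by (metis finite_UnionD)
  have "e \<in> E" using e ME by blast
  then obtain x z where xz: "x \<noteq> z" "e = {x, z}" using E(2)[of e] by (auto simp: card_2_iff)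
  obtain e1 where e1: "e1 \<in> E" "x \<in> e1" "e1 \<noteq> e" using contra xz(2) by blast
  obtain e2 where e2: "e2 \<in> E" "z \<in> e2" "e2 \<noteq> e" using contra xz(2) by blast
  obtain z' where z': "z' \<noteq> x" "e1 = {x, z'}" using card2_iff_pair[of e1 x] E(2)[OF e1(1)] e1(2) by blast
  obtain x' where x': "x' \<noteq> z" "e2 = {z, x'}" using card2_iff_pair[of e2 z] E(2)[OF e2(1)] e2(2) by blast
  have ne: "z' \<noteq> z" "x' \<noteq> x" using e1(3) e2(3) z' x' xz by (auto simp: insert_commute)
  have edges: "{x, z} \<in> E" "{z, x'} \<in> E" "{z', x} \<in> E"
    using \<open>e \<in> E\<close> e1(1) e2(1) xz(2) x'(2) z'(2) by (simp_all add: insert_commute)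
  \<comment> \<open>Coincidence of the two neighbours would close a triangle, adjacency a cycle of
    length four.\<close>
  have "x' \<noteq> z'"
  proof
    assume eq: "x' = z'"
    have "graph_cycle E [x, z, x']"
      using edges eq xz(1) x'(1) ne by (intro graph_cycle_3) auto
    then show False using acyc by blast
  qed
  have "{x', z'} \<notin> E"
  proof
    assume "{x', z'} \<in> E"
    then have "graph_cycle E [x, z, x', z']"
      using edges \<open>x' \<noteq> z'\<close> xz(1) x'(1) z'(1) ne by (intro graph_cycle_4) auto
    then show False using acyc by blast
  qed
  have "stable_set E {x', z'}"
    unfolding stable_set_def
  proof (intro ballI notI)
    fix f assume f: "f \<in> E" "f \<subseteq> {x', z'}"
    then have "f = {x', z'}"
      using card_subset_eq[of "{x', z'}" f] E(2)[OF f(1)] \<open>x' \<noteq> z'\<close> by simp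
    then show False using f(1) \<open>{x', z'} \<notin> E\<close> by simp
  qed
  moreover have "{x', z'} \<subseteq> V" using E(1)[OF edges(2)] E(1)[OF edges(3)] by simp
  ultimately obtain S where S: "maximal_stable V E S" "{x', z'} \<subseteq> S"
    using exists_maximal_stable[OF finV] by metis
  have Si: "stable_set E S" and SV: "S \<subseteq> V" using S(1) by (simp_all add: maximal_stable_def)
  have xS: "x \<notin> S" using stable_setD[OF Si edges(3)] S(2) by auto
  have zS: "z \<notin> S" using stable_setD[OF Si edges(2)] S(2) by auto
  \<comment> \<open>The edges of \<open>M\<close> cover \<open>V\<close>, and each contains at most
    one vertex of \<open>S\<close>; as \<open>e\<close> contains none, \<open>S\<close> is smaller
    than \<open>M\<close>.\<close>
  have "\<forall>v\<in>S. \<exists>f\<in>M. v \<in> f" using SV M(2) by blast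
  then obtain g where g: "\<And>v. v \<in> S \<Longrightarrow> g v \<in> M \<and> v \<in> g v" by metis
  have "inj_on g S"
  proof (rule inj_onI, rule ccontr)
    fix u v assume uv: "u \<in> S" "v \<in> S" "g u = g v" "u \<noteq> v"
    have "g u \<in> E" using g[OF uv(1)] ME by blast
    moreover have "g u = {u, v}"
      using card2_eq_pair[of "g u" u v] E(2)[OF \<open>g u \<in> E\<close>] g[OF uv(1)] g[OF uv(2)] uv(3,4) by auto
    ultimately show False using stable_setD[OF Si, of "g u"] uv(1,2) by auto
  qed
  moreover have "g ` S \<subseteq> M - {e}"
  proof
    fix f assume "f \<in> g ` S"
    then obtain v where v: "v \<in> S" "f = g v" by blast
    then have "f \<noteq> e" using g[OF v(1)] xS zS xz(2) by auto
    then show "f \<in> M - {e}" using g[OF v(1)] v(2) by blast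
  qed
  ultimately have "card S \<le> card (M - {e})" using finM by (intro card_inj_on_le) auto
  also have "\<dots> < card M" using finM e by (intro psubset_card_mono) auto
  finally show False using wc[OF S(1)] M(3) by simp
qed

text \<open>Each matching edge has an end \<open>l e\<close> that lies in no other edge; the other
  ends \<open>h e\<close> form the base. An edge that leaves the base contains some
  \<open>l f\<close> and is therefore the whisker \<open>f\<close>.\<close>

theorem well_covered_forest_whiskered:
  assumes finV: "finite V" and E: "\<And>e. e \<in> E \<Longrightarrow> e \<subseteq> V \<and> card e = 2"
    and acyc: "\<nexists>c. graph_cycle E c"
    and noiso: "\<And>v. v \<in> V \<Longrightarrow> \<exists>e\<in>E. v \<in> e"
    and wc: "\<And>S. maximal_stable V E S \<Longrightarrow> card S = s"
  obtains y A F where "whisker_base y A F" "A \<union> y ` A = V" "E = whiskered y A F" "card A = s"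
proof -
  have E': "\<And>e. e \<in> E \<Longrightarrow> e \<subseteq> V" "\<And>e. e \<in> E \<Longrightarrow> card e = 2" using E by auto
  obtain M where M: "matching E M" "\<Union>M = V" "card M = s"
    using well_covered_forest_perfect_matching[OF assms] by blast
  have ME: "M \<subseteq> E" and disj: "disjoint M" using M(1) by (simp_all add: matching_def)
  have "\<forall>e\<in>M. \<exists>b\<in>e. \<forall>f\<in>E. b \<in> f \<longrightarrow> f = e"
    using matching_edge_pendant[OF finV E' acyc wc M] by blast
  then obtain l where l: "\<And>e. e \<in> M \<Longrightarrow> l e \<in> e" "\<And>e f. e \<in> M \<Longrightarrow> f \<in> E \<Longrightarrow> l e \<in> f \<Longrightarrow> f = e"
    by metis
  have "\<exists>x. x \<noteq> l e \<and> e = {x, l e}" if e: "e \<in> M" for e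
  proof -
    have "card e = 2" using e ME E'(2) by blast
    then obtain z where "z \<noteq> l e" "e = {l e, z}" using card2_iff_pair[of e "l e"] l(1)[OF e] by blast
    then show ?thesis by (intro exI[of _ z]) (simp add: insert_commute)
  qed
  then obtain h where h: "\<And>e. e \<in> M \<Longrightarrow> h e \<noteq> l e" "\<And>e. e \<in> M \<Longrightarrow> e = {h e, l e}" by metis
  have same: "e = f" if "e \<in> M" "f \<in> M" "v \<in> e" "v \<in> f" for e f v
    using that disj by (meson disjointD disjoint_iff)
  have he: "h e \<in> e" if "e \<in> M" for e using h(2)[OF that] by (metis insertI1)
  have injh: "inj_on h M"
    by (rule inj_onI) (metis same he)
  define A where "A = h ` M"
  define y where "y x = l (the_inv_into M h x)" for x
  have yh: "y (h e) = l e" if "e \<in> M" for e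
    using the_inv_into_f_f[OF injh that] by (simp add: y_def)
  define F where "F = {e \<in> E. e \<subseteq> A}"
  have lA: "l e \<notin> A" if e: "e \<in> M" for e
  proof
    assume "l e \<in> A"
    then obtain f where f: "f \<in> M" "l e = h f" by (auto simp: A_def)
    then have "l e \<in> f" using he by simp
    then have "f = e" using l(2)[OF e] f(1) ME by blast
    then show False using h(1)[OF e] f(2) by simp
  qed
  have finM: "finite M" using M(2) finV by (metis finite_UnionD)
  have yA: "y ` A = l ` M" unfolding A_def image_image by (rule image_cong) (simp_all add: yh)
  have whisk: "(\<lambda>x. {x, y x}) ` A = M"
  proof -
    have "(\<lambda>x. {x, y x}) ` A = (\<lambda>e. {h e, l e}) ` M"
      unfolding A_def image_image by (rule image_cong) (simp_all add: yh)
    also have "\<dots> = (\<lambda>e. e) ` M"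
      by (rule image_cong[OF refl]) (rule h(2)[symmetric])
    finally show ?thesis by simp
  qed
  show ?thesis
  proof (rule that[of y A F])
    show "whisker_base y A F"
      unfolding whisker_base_def
    proof (intro conjI)
      show "finite A" using finM by (simp add: A_def)
      show "inj_on y A"
      proof (rule inj_onI)
        fix u v assume "u \<in> A" "v \<in> A" "y u = y v"
        then obtain e f where ef: "e \<in> M" "f \<in> M" "u = h e" "v = h f" "l e = l f"
          by (auto simp: A_def yh)
        then have "e = f" using same[OF ef(1,2) l(1)[OF ef(1)]] l(1)[OF ef(2)] by simp
        then show "u = v" using ef by simp
      qed
      show "y ` A \<inter> A = {}" unfolding yA using lA by blast
      show "\<forall>e\<in>F. e \<subseteq> A \<and> card e = 2" using E'(2) by (simp add: F_def)
      show "\<nexists>c. graph_cycle F c" using acyc by (auto simp: F_def graph_cycle_def)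
    qed
    show "A \<union> y ` A = V"
    proof -
      have "A \<union> y ` A = (\<Union>e\<in>M. {h e, l e})" unfolding yA unfolding A_def by auto
      also have "\<dots> = (\<Union>e\<in>M. e)"
        by (rule SUP_cong[OF refl]) (rule h(2)[symmetric])
      finally show ?thesis using M(2) by simp
    qed
    then have VA: "V = A \<union> l ` M" using yA by simp
    show "E = whiskered y A F"
      unfolding whiskered_def whisk
    proof
      show "F \<union> M \<subseteq> E" using ME by (auto simp: F_def)
      show "E \<subseteq> F \<union> M"
      proof
        fix e assume e: "e \<in> E"
        show "e \<in> F \<union> M"
        proof (cases "e \<subseteq> A")
          case True
          then show ?thesis using e by (simp add: F_def)
        next
          case False
          then obtain f where "f \<in> M" "l f \<in> e" using E'(1)[OF e] VA by blast
          then have "e = f" using l(2) e by blast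
          then show ?thesis using \<open>f \<in> M\<close> by simp
        qed
      qed
    qed
    show "card A = s" using card_image[OF injh] M(3) by (simp add: A_def)
  qed
qed


section \<open>Square-free powers of edge ideals\<close>

lemma has_matching_1:
  "has_matching E 1 W \<longleftrightarrow> (\<exists>e\<in>E. e \<subseteq> W)"
proof
  assume "has_matching E 1 W"
  then obtain M where M: "M \<subseteq> E" "card M = 1" "\<Union>M \<subseteq> W"
    by (auto simp: has_matching_def matching_def)
  then obtain e where "M = {e}" by (auto simp: card_1_singleton_iff)
  then show "\<exists>e\<in>E. e \<subseteq> W" using M by auto
next
  assume "\<exists>e\<in>E. e \<subseteq> W"
  then obtain e where "e \<in> E" "e \<subseteq> W" by blast
  then show "has_matching E 1 W"
    unfolding has_matching_def matching_def by (intro exI[of _ "{e}"]) simp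
qed

lemma ind_split:
  assumes "finite S" "S \<subseteq> Poly_Mapping.keys t"
  shows "t = ind S + (t - ind S)"
proof (rule poly_mapping_eqI)
  fix x
  show "Poly_Mapping.lookup t x = Poly_Mapping.lookup (ind S + (t - ind S)) x"
    using assms by (cases "x \<in> S") (auto simp: lookup_add lookup_minus lookup_ind in_keys_iff)
qed

lemma edge_ideal_eq_genideal:
  assumes "\<And>e. e \<in> E \<Longrightarrow> card e = 2"
  shows "edge_ideal V E = Idl\<^bsub>mpoly_ring V\<^esub> (monomial ` ind ` E)"
proof -
  have "{indet x * indet y | x y. {x, y} \<in> E} = (monomial ` ind ` E :: ('a, 'b) mpoly set)"
  proof (intro equalityI subsetI)
    fix p :: "('a, 'b) mpoly" assume "p \<in> {indet x * indet y | x y. {x, y} \<in> E}"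
    then obtain x y where xy: "p = indet x * indet y" "{x, y} \<in> E" by blast
    then have "x \<noteq> y" using assms[of "{x, y}"] by auto
    then have "p = monomial (ind {x, y})" using xy(1) by (simp add: monomial_ind)
    then show "p \<in> monomial ` ind ` E" using xy(2) by blast
  next
    fix p :: "('a, 'b) mpoly" assume "p \<in> monomial ` ind ` E"
    then obtain e where e: "e \<in> E" "p = monomial (ind e)" by blast
    then obtain x y where "x \<noteq> y" "e = {x, y}" using assms[of e] by (auto simp: card_2_iff)
    then show "p \<in> {indet x * indet y | x y. {x, y} \<in> E}"
      using e by (auto simp: monomial_ind)
  qed
  then show ?thesis by (simp add: edge_ideal_def)
qed

text \<open>Exponents of the products of \<open>k\<close> edges, repetitions allowed: the generators
  of the ordinary power I^k.\<close>

primrec edge_products :: "'v set set \<Rightarrow> nat \<Rightarrow> ('v \<Rightarrow>\<^sub>0 nat) set" where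
  "edge_products E 0 = {0}"
| "edge_products E (Suc k) = {s + ind e | s e. s \<in> edge_products E k \<and> e \<in> E}"

text \<open>In a square-free product no vertex occurs twice, so the \<open>k\<close> factors are
  pairwise disjoint and, being nonempty, distinct.\<close>

lemma edge_product_squarefree:
  assumes "\<And>e. e \<in> E \<Longrightarrow> card e = 2" "s \<in> edge_products E k" "squarefree_exponent s"
  shows "has_matching E k (Poly_Mapping.keys s)"
  using assms(2,3)
proof (induction k arbitrary: s)
  case 0
  then show ?case by (simp add: has_matching_0)
next
  case (Suc k)
  then obtain t e where te: "t \<in> edge_products E k" "e \<in> E" "s = t + ind e" by auto
  have e2: "card e = 2" using assms(1) te(2) by blast
  then have fe: "finite e" "e \<noteq> {}" by (auto simp: card_2_iff)
  have le: "Poly_Mapping.lookup t x + Poly_Mapping.lookup (ind e) x \<le> 1" for x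
    using Suc.prems(2) by (simp add: squarefree_exponent_def te(3) lookup_add)
  have disj: "x \<notin> e" if "x \<in> Poly_Mapping.keys t" for x
    using le[of x] that fe(1) by (auto simp: lookup_ind in_keys_iff)
  have "squarefree_exponent t"
    unfolding squarefree_exponent_def using le by (meson add_leD1)
  then obtain M where M: "M \<subseteq> E" "disjoint M" "finite M" "card M = k" "\<Union>M \<subseteq> Poly_Mapping.keys t"
    using Suc.IH[OF te(1)] by (auto simp: has_matching_def matching_def)
  have eM: "e \<inter> f = {}" if "f \<in> M" for f using disj M(5) that by blast
  then have "e \<notin> M" using fe(2) by blast
  moreover have "disjoint (insert e M)"
    using M(2) eM by (simp add: pairwise_insert disjnt_def Int_commute)
  moreover have "\<Union>(insert e M) \<subseteq> Poly_Mapping.keys s"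
    using M(5) fe(1) by (auto simp: te(3) keys_plus_nat keys_ind)
  ultimately show ?case
    unfolding has_matching_def matching_def using M te(2)
    by (intro exI[of _ "insert e M"]) simp
qed

lemma ind_Union_matching:
  assumes "finite M" "M \<subseteq> E" "disjoint M" "\<And>e. e \<in> E \<Longrightarrow> card e = 2"
  shows "ind (\<Union>M) \<in> edge_products E (card M)"
  using assms(1-3)
proof (induction M rule: finite_induct)
  case empty
  then show ?case by (simp add: ind_def)
next
  case (insert e M)
  have fin: "finite f" if "f \<in> insert e M" for f
    using assms(4)[of f] insert.prems(1) that by (metis card.infinite subsetD zero_neq_numeral)
  have "e \<inter> \<Union>M = {}"
    using insert.prems(2) insert.hyps(2) by (auto simp: disjoint_def)
  then have "ind (\<Union>(insert e M)) = ind (\<Union>M) + ind e"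
    using fin insert.hyps(1) unfolding ind_def
    by (simp add: sum.union_disjoint add.commute)
  moreover have "disjoint M" using insert.prems(2) by (simp add: pairwise_insert)
  ultimately show ?case using insert by auto
qed

context
  fixes V :: "'v set" and E :: "'v set set"
  assumes finV: "finite V" and E: "\<And>e. e \<in> E \<Longrightarrow> e \<subseteq> V" "\<And>e. e \<in> E \<Longrightarrow> card e = 2"
begin

lemma finite_edge: "e \<in> E \<Longrightarrow> finite e"
  using E(1) finV finite_subset by blast

lemma keys_ind_edge: "t \<in> ind ` E \<Longrightarrow> Poly_Mapping.keys t \<subseteq> V"
proof -
  assume "t \<in> ind ` E"
  then obtain e where "e \<in> E" "t = ind e" by blast
  then show ?thesis using E(1)[of e] finite_edge[of e] by (simp add: keys_ind)
qed

lemma edge_ideal_eq_mono_ideal: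
  "edge_ideal V E = (mono_ideal V {t + u | t u. t \<in> ind ` E} :: ('v, 'k::field) mpoly set)"
  by (subst edge_ideal_eq_genideal[OF E(2)]) (simp_all add: genideal_monomials keys_ind_edge)

lemma edge_ideal_eq_sr_ideal:
  "edge_ideal V E = (sr_ideal V (matching_free V {} E 1) :: ('v, 'k::field) mpoly set)"
  unfolding edge_ideal_eq_mono_ideal sr_ideal_def
proof (rule mono_ideal_cong)
  fix v :: "'v \<Rightarrow>\<^sub>0 nat" assume v: "Poly_Mapping.keys v \<subseteq> V"
  have "v \<in> {t + u | t u. t \<in> ind ` E} \<longleftrightarrow> (\<exists>e\<in>E. e \<subseteq> Poly_Mapping.keys v)"
  proof
    assume "v \<in> {t + u | t u. t \<in> ind ` E}"
    then obtain e u where "e \<in> E" "v = ind e + u" by blast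
    then show "\<exists>e\<in>E. e \<subseteq> Poly_Mapping.keys v"
      using finite_edge by (intro bexI[of _ e]) (simp_all add: keys_plus_nat keys_ind)
  next
    assume "\<exists>e\<in>E. e \<subseteq> Poly_Mapping.keys v"
    then obtain e where "e \<in> E" "e \<subseteq> Poly_Mapping.keys v" by blast
    then show "v \<in> {t + u | t u. t \<in> ind ` E}"
      using ind_split[of e v] finite_edge[of e] by blast
  qed
  then show "v \<in> {t + u | t u. t \<in> ind ` E} \<longleftrightarrow> v \<in> {t. Poly_Mapping.keys t \<notin> matching_free V {} E 1}"
    using v by (simp add: matching_free_def has_matching_1[unfolded One_nat_def])
qed

text \<open>Every term of the power is a multiple of an edge product, and all edge products belong
  to the power; together this tells which monomials lie in it.\<close>

lemma
  fixes k :: nat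
  shows ideal_edge_ideal_power: "mp.is_ideal V ((edge_ideal V E :: ('v, 'k::field) mpoly set) [^]\<^bsub>ideals_set (mpoly_ring V)\<^esub> k)"
    and edge_ideal_power_subset: "(edge_ideal V E :: ('v, 'k) mpoly set) [^]\<^bsub>ideals_set (mpoly_ring V)\<^esub> k \<subseteq>
      mono_ideal V {s + u | s u. s \<in> edge_products E k}"
    and edge_ideal_power_superset:
      "s \<in> edge_products E k \<Longrightarrow> monomial s \<in> (edge_ideal V E :: ('v, 'k) mpoly set) [^]\<^bsub>ideals_set (mpoly_ring V)\<^esub> k"
proof -
  let ?R = "mpoly_ring V :: ('v, 'k) mpoly ring" and ?I = "edge_ideal V E :: ('v, 'k) mpoly set"
  interpret R: cring ?R by (rule cring_mpoly_ring)
  interpret S: Group.comm_monoid "ideals_set ?R" by (rule R.ideals_set_is_comm_monoid)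
  have sub: "monomial ` ind ` E \<subseteq> (polys_in V :: ('v, 'k) mpoly set)"
    using keys_ind_edge by (auto simp: monomial_def intro: single_mem_polys_in)
  have eq: "?I = Idl\<^bsub>?R\<^esub> (monomial ` ind ` E)"
    by (rule edge_ideal_eq_genideal) (rule E(2))
  note gen = genideal_mpoly_ring[OF sub, folded eq]
  have I: "?I \<in> carrier (ideals_set ?R)"
    using gen(1) by (simp add: ideals_set_def ideal_mpoly_ring_iff)
  have pow: "?I [^]\<^bsub>ideals_set ?R\<^esub> Suc j = ideal_prod ?R (?I [^]\<^bsub>ideals_set ?R\<^esub> j) ?I" for j
    by (simp add: S.nat_pow_Suc) (simp add: ideals_set_def)
  \<comment> \<open>The unit of the monoid of ideals is the whole ring, in accordance with
    \<open>edge_products E 0 = {0}\<close>.\<close>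
  have pow0: "?I [^]\<^bsub>ideals_set ?R\<^esub> (0::nat) = polys_in V"
    by (simp add: S.nat_pow_0) (simp add: ideals_set_def)
  have "?I [^]\<^bsub>ideals_set ?R\<^esub> k \<in> carrier (ideals_set ?R)"
    using I by (rule S.nat_pow_closed)
  then show "mp.is_ideal V (?I [^]\<^bsub>ideals_set ?R\<^esub> k)"
    by (simp add: ideals_set_def ideal_mpoly_ring_iff)
  show "?I [^]\<^bsub>ideals_set ?R\<^esub> k \<subseteq> mono_ideal V {s + u | s u. s \<in> edge_products E k}"
  proof (induction k)
    case 0
    show ?case unfolding pow0 by (auto simp: mono_ideal_def)
  next
    case (Suc j)
    let ?T = "{s + u | s u. s \<in> edge_products E (Suc j)}"
    have idl: "mp.is_ideal V (mono_ideal V ?T :: ('v, 'k) mpoly set)"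
    proof (rule is_ideal_mono_ideal)
      fix s t assume "t \<in> ?T"
      then obtain s' u where "t = s' + u" "s' \<in> edge_products E (Suc j)" by blast
      then have "s + t = s' + (s + u)" "s' \<in> edge_products E (Suc j)" by (simp_all add: add.left_commute)
      then show "s + t \<in> ?T" by blast
    qed
    show ?case
      unfolding pow
    proof
      fix p assume "p \<in> ideal_prod ?R (?I [^]\<^bsub>ideals_set ?R\<^esub> j) ?I"
      then show "p \<in> mono_ideal V ?T"
      proof (induction rule: ideal_prod.induct)
        case (prod a b)
        have a: "a \<in> polys_in V" "Poly_Mapping.keys a \<subseteq> {s + u | s u. s \<in> edge_products E j}"
          using prod(1) Suc.IH by (auto simp: mono_ideal_def)
        have b: "b \<in> polys_in V" "Poly_Mapping.keys b \<subseteq> {t + u | t u. t \<in> ind ` E}"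
          using prod(2) by (simp_all add: edge_ideal_eq_mono_ideal mono_ideal_def)
        have "Poly_Mapping.keys (a * b) \<subseteq> ?T"
        proof
          fix t assume "t \<in> Poly_Mapping.keys (a * b)"
          then obtain t1 t2 where t: "t1 \<in> Poly_Mapping.keys a" "t2 \<in> Poly_Mapping.keys b" "t = t1 + t2"
            using Poly_Mapping.keys_mult[of a b] by blast
          then obtain s u e u' where su: "t1 = s + u" "s \<in> edge_products E j" "t2 = ind e + u'" "e \<in> E"
            using a(2) b(2) by blast
          have "t = (s + ind e) + (u + u')" by (simp add: t su add_ac)
          moreover have "s + ind e \<in> edge_products E (Suc j)" using su by auto
          ultimately show "t \<in> ?T" by blast
        qed
        then show ?case using a b by (simp add: mono_ideal_def)
      next
        case (sum p q)
        then show ?case using mp.ideal_add[OF idl] by simp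
      qed
    qed
  qed
  show "monomial s \<in> ?I [^]\<^bsub>ideals_set ?R\<^esub> k" if "s \<in> edge_products E k"
    using that
  proof (induction k arbitrary: s)
    case 0
    then show ?case unfolding pow0 by (simp add: monomial_zero)
  next
    case (Suc j)
    then obtain t e where te: "t \<in> edge_products E j" "e \<in> E" "s = t + ind e" by auto
    have "monomial t \<otimes>\<^bsub>?R\<^esub> monomial (ind e) \<in> ideal_prod ?R (?I [^]\<^bsub>ideals_set ?R\<^esub> j) ?I"
      using Suc.IH[OF te(1)] gen(2) te(2) by (intro ideal_prod.prod) auto
    then show ?case unfolding pow by (simp add: te(3) monomial_add)
  qed
qed

text \<open>A square-free monomial of I^k is a multiple of a product of \<open>k\<close> edges,
  which as a divisor is square-free too and thus comes from a \<open>k\<close>-matching. Conversely,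
  the vertex set of a \<open>k\<close>-matching gives a square-free monomial of I^k.\<close>

theorem squarefree_power_eq_sr_ideal:
  "squarefree_power V (edge_ideal V E :: ('v, 'k::field) mpoly set) k = sr_ideal V (matching_free V {} E k)"
proof -
  let ?P = "(edge_ideal V E :: ('v, 'k) mpoly set) [^]\<^bsub>ideals_set (mpoly_ring V)\<^esub> k"
  let ?T = "{t. squarefree_exponent t \<and> monomial t \<in> ?P}"
  have PV: "?P \<subseteq> polys_in V" using mp.ideal_sub[OF ideal_edge_ideal_power] by blast
  have TV: "Poly_Mapping.keys t \<subseteq> V" if "t \<in> ?T" for t
  proof -
    have "(monomial t :: ('v, 'k) mpoly) \<in> polys_in V" using that PV by blast
    then show ?thesis by (simp add: polys_in_def monomial_def)
  qed
  have "squarefree_power V (edge_ideal V E :: ('v, 'k) mpoly set) k = Idl\<^bsub>mpoly_ring V\<^esub> (monomial ` ?T)"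
    unfolding squarefree_power_def by (rule arg_cong[where f = "genideal (mpoly_ring V)"]) blast
  also have "\<dots> = mono_ideal V {t + u | t u. t \<in> ?T}"
    by (rule genideal_monomials) (rule TV)
  also have "\<dots> = sr_ideal V (matching_free V {} E k)"
    unfolding sr_ideal_def
  proof (rule mono_ideal_cong)
    fix v :: "'v \<Rightarrow>\<^sub>0 nat" assume v: "Poly_Mapping.keys v \<subseteq> V"
    have "v \<in> {t + u | t u. t \<in> ?T} \<longleftrightarrow> has_matching E k (Poly_Mapping.keys v)"
    proof
      assume "v \<in> {t + u | t u. t \<in> ?T}"
      then obtain t u where tu: "v = t + u" "squarefree_exponent t" "monomial t \<in> ?P" by blast
      then have "(monomial t :: ('v, 'k) mpoly) \<in> mono_ideal V {s + u | s u. s \<in> edge_products E k}"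
        using edge_ideal_power_subset by blast
      then obtain s u' where s: "t = s + u'" "s \<in> edge_products E k"
        by (auto simp: mono_ideal_def monomial_def)
      have "squarefree_exponent s"
        using tu(2) unfolding squarefree_exponent_def s(1) lookup_add by (meson add_leD1)
      then have "has_matching E k (Poly_Mapping.keys s)"
        using edge_product_squarefree[OF E(2) s(2)] by blast
      then show "has_matching E k (Poly_Mapping.keys v)"
        by (rule has_matching_mono) (auto simp: tu(1) s(1) keys_plus_nat)
    next
      assume "has_matching E k (Poly_Mapping.keys v)"
      then obtain M where M: "M \<subseteq> E" "disjoint M" "finite M" "card M = k" "\<Union>M \<subseteq> Poly_Mapping.keys v"
        by (auto simp: has_matching_def matching_def)
      have fin: "finite (\<Union>M)" using M(5) finite_keys finite_subset by blast
      have "ind (\<Union>M) \<in> edge_products E k"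
        using ind_Union_matching[OF M(3,1,2) E(2)] M(4) by simp
      then have "monomial (ind (\<Union>M)) \<in> ?P" by (rule edge_ideal_power_superset)
      moreover have "squarefree_exponent (ind (\<Union>M))"
        using fin by (simp add: squarefree_exponent_def lookup_ind)
      ultimately have "ind (\<Union>M) \<in> ?T" by blast
      then show "v \<in> {t + u | t u. t \<in> ?T}" using ind_split[OF fin M(5)] by blast
    qed
    then show "v \<in> {t + u | t u. t \<in> ?T} \<longleftrightarrow> v \<in> {t. Poly_Mapping.keys t \<notin> matching_free V {} E k}"
      using v by (simp add: matching_free_def)
  qed
  finally show ?thesis .
qed

end


section \<open>Cohen-Macaulay forests\<close>

lemma has_matching_whiskers:
  assumes "whisker_base y A F" "B \<subseteq> A" "B \<union> y ` B \<subseteq> W"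
  shows "has_matching (whiskered y A F) (card B) W"
proof -
  let ?w = "\<lambda>x. {x, y x}"
  have A: "finite A" "inj_on y A" "y ` A \<inter> A = {}" using assms(1) by (auto simp: whisker_base_def)
  have disj: "x = z" if "x \<in> A" "z \<in> A" "{x, y x} \<inter> {z, y z} \<noteq> {}" for x z
  proof -
    have "y x \<noteq> z" "y z \<noteq> x" using that(1,2) A(3) by auto
    then have "x = z \<or> y x = y z" using that(3) by auto
    then show ?thesis using A(2) that(1,2) by (auto dest: inj_onD)
  qed
  have inj: "inj_on ?w B"
  proof (rule inj_onI)
    fix x z assume xz: "x \<in> B" "z \<in> B" "?w x = ?w z"
    then have "?w x \<inter> ?w z \<noteq> {}" by simp
    then show "x = z" using disj xz assms(2) by blast
  qed
  have "disjoint (?w ` B)"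
    unfolding disjoint_def
  proof (intro ballI impI)
    fix e f assume "e \<in> ?w ` B" "f \<in> ?w ` B" "e \<noteq> f"
    then obtain x z where "x \<in> B" "z \<in> B" "e = ?w x" "f = ?w z" "x \<noteq> z" by blast
    then show "e \<inter> f = {}" using disj[of x z] assms(2) by blast
  qed
  moreover have "finite (?w ` B)" using A(1) assms(2) finite_subset by blast
  moreover have "card (?w ` B) = card B" using inj by (rule card_image)
  moreover have "?w ` B \<subseteq> whiskered y A F" using assms(2) by (auto simp: whiskered_def)
  moreover have "\<Union>(?w ` B) \<subseteq> W" using assms(3) by auto
  ultimately show ?thesis unfolding has_matching_def matching_def by blast
qed

text \<open>No edge joins two whisker tips, so every edge has an end in \<open>A\<close>; for an
  edge inside \<open>B\<close> and the tips, that end lies in \<open>B\<close>.\<close>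

lemma whiskered_subset_cover:
  assumes "whisker_base y A F" "e \<in> whiskered y A F" "e \<subseteq> B \<union> y ` A" "B \<subseteq> A"
  shows "e \<inter> B \<noteq> {}"
proof -
  have A: "y ` A \<inter> A = {}" "\<And>e. e \<in> F \<Longrightarrow> e \<subseteq> A \<and> card e = 2"
    using assms(1) by (auto simp: whisker_base_def)
  obtain x where x: "x \<in> e" "x \<in> A"
  proof (cases "e \<in> F")
    case True
    then have "e \<subseteq> A" "e \<noteq> {}" using A(2)[OF True] by auto
    then show ?thesis using that by blast
  next
    case False
    then show ?thesis using that assms(2) by (auto simp: whiskered_def)
  qed
  then show ?thesis using A(1) assms(3) by blast
qed

theorem depth_quot_whiskered:
  assumes finV: "finite V" and wb: "whisker_base y A F" and V: "V = A \<union> y ` A" and k: "1 \<le> k" "k \<le> card A"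
  shows "depth_quot V (sr_ideal V (matching_free V {} (whiskered y A F) k) :: ('v, 'k::field) mpoly set)
    = enat (card A + k - 1)"
proof (rule antisym)
  let ?E = "whiskered y A F" and ?D = "matching_free V {} (whiskered y A F) k"
  have A: "finite A" "inj_on y A" "y ` A \<inter> A = {}" using wb by (auto simp: whisker_base_def)
  have cV: "card V = 2 * card A"
    unfolding V using A by (simp add: card_Un_disjoint Int_commute card_image)
  show "depth_quot V (sr_ideal V ?D :: ('v, 'k) mpoly set) \<le> enat (card A + k - 1)"
  proof -
    have "k - 1 \<le> card A" using k by simp
    then obtain B where B: "B \<subseteq> A" "card B = k - 1"
      by (rule obtain_subset_with_card_n)
    have finB: "finite B" using B(1) A(1) finite_subset by blast
    \<comment> \<open>All whisker tips and k - 1 base vertices: \<open>B\<close> covers the edges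
      inside \<open>W\<close>, and each further base vertex completes a \<open>k\<close>-th
      whisker.\<close>
    define W where "W = B \<union> y ` A"
    have WV: "W \<subseteq> V" using B(1) by (auto simp: W_def V)
    have "B \<inter> y ` A = {}" using A(3) B(1) by blast
    then have cW: "card W = card A + k - 1"
      using A finB B(2) k by (simp add: W_def card_Un_disjoint card_image)
    have "\<not> has_matching ?E k W"
    proof
      assume "has_matching ?E k W"
      then have "k \<le> card B"
        by (rule has_matching_le_cover[OF _ finB])
           (rule whiskered_subset_cover[OF wb _ _ B(1)], simp_all add: W_def)
      with B(2) k show False by linarith
    qed
    then have WD: "W \<in> ?D" using WV by (simp add: matching_free_def)
    have facet: "insert x W \<notin> ?D" if x: "x \<in> V - W" for x
    proof -
      have xA: "x \<in> A" "x \<notin> B" using x by (auto simp: V W_def)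
      have "card (insert x B) = k" using finB xA B(2) k by simp
      moreover have "has_matching ?E (card (insert x B)) (insert x W)"
        by (rule has_matching_whiskers[OF wb]) (use xA B(1) in \<open>auto simp: W_def\<close>)
      ultimately show ?thesis by (simp add: matching_free_def)
    qed
    show ?thesis
      using depth_quot_le_facet[OF finV down_closed_matching_free WD WV facet] cW by simp
  qed
  have "\<not> has_matching ?E k {}"
  proof
    assume "has_matching ?E k {}"
    then have "k \<le> card ({} :: 'v set)"
      by (rule has_matching_le_cover)
         (use whiskered_subset_cover[OF wb, of _ "{}"] in auto)
    with k show False by simp
  qed
  then have "{} \<in> ?D" by (simp add: matching_free_def)
  \<comment> \<open>For \<open>U = V\<close> the number card U + k - card A - 1 equals card A + k -
    1, so the lower bound meets the facet \<open>W\<close>.\<close>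
  moreover have "decomposable V (card A + k - 1) ?D"
    by (rule decomposable_matching_free_whiskered[OF finV wb]) (use V cV k in auto)
  ultimately show "enat (card A + k - 1) \<le> depth_quot V (sr_ideal V ?D :: ('v, 'k) mpoly set)"
    by (intro depth_quot_ge_decomposable[OF finV down_closed_matching_free])
qed

text \<open>\<open>A\<close> covers all edges, and the whiskers form a matching of the same
  size.\<close>

lemma matching_number_whiskered:
  assumes "whisker_base y A F" "finite (whiskered y A F)"
  shows "matching_number (whiskered y A F) = card A"
  unfolding matching_number_def
proof (rule Max_eqI)
  let ?E = "whiskered y A F"
  have "{card M | M. matching ?E M} \<subseteq> card ` Pow ?E" by (auto simp: matching_def)
  then show "finite {card M | M. matching ?E M}" using assms(2) finite_subset by blast
  show "n \<le> card A" if n: "n \<in> {card M | M. matching ?E M}" for n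
  proof -
    obtain M where M: "matching ?E M" "n = card M" using n by blast
    then have "finite M" using assms(2) finite_subset by (auto simp: matching_def)
    then have "has_matching ?E n (A \<union> y ` A \<union> \<Union>M)"
      unfolding has_matching_def using M by blast
    moreover have "e \<inter> A \<noteq> {}" if e: "e \<in> ?E" for e
    proof (rule whiskered_subset_cover[OF assms(1) e _ subset_refl])
      show "e \<subseteq> A \<union> y ` A"
      proof (cases "e \<in> F")
        case True
        then show ?thesis using assms(1) by (auto simp: whisker_base_def)
      next
        case False
        then show ?thesis using e by (auto simp: whiskered_def)
      qed
    qed
    moreover have "finite A" using assms(1) by (simp add: whisker_base_def)
    ultimately show ?thesis using has_matching_le_cover[of ?E n _ A] by blast
  qed
  have "has_matching ?E (card A) (A \<union> y ` A)"
    by (rule has_matching_whiskers[OF assms(1)]) simp_all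
  then obtain M where "matching ?E M" "card M = card A"
    by (auto simp: has_matching_def)
  then show "card A \<in> {card M | M. matching ?E M}"
    by (intro CollectI exI[of _ M]) simp
qed

theorem theorem3p5:
  fixes V :: "'v set" and E :: "'v set set" and m :: nat
  assumes "forest_graph V E"
    and "\<nexists>v. isolated_vertex V E v"
    and "cohen_macaulay_graph TYPE('k::field) V E"
    and "graph_dim TYPE('k) V E = enat m"
  shows "matching_number E = m \<and>
    (\<forall>k. 1 \<le> k \<and> k \<le> matching_number E \<longrightarrow>
      depth_quot V (squarefree_power V (edge_ideal V E :: ('v, 'k) mpoly set) k)
        = enat (m + k - 1))"
proof -
  have finV: "finite V" and E: "\<And>e. e \<in> E \<Longrightarrow> e \<subseteq> V \<and> card e = 2" and acyc: "\<nexists>c. graph_cycle E c"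
    using assms(1) by (auto simp: forest_graph_def simple_graph_def)
  have E': "\<And>e. e \<in> E \<Longrightarrow> e \<subseteq> V" "\<And>e. e \<in> E \<Longrightarrow> card e = 2" using E by auto
  have noiso: "\<exists>e\<in>E. v \<in> e" if "v \<in> V" for v
    using assms(2) that by (auto simp: isolated_vertex_def)
  let ?D = "matching_free V {} E 1"
  note edge = edge_ideal_eq_sr_ideal[OF finV E', where ?'k = 'k]
  \<comment> \<open>A 1-matching is an edge, so for k = 1 the complex is the independence
    complex.\<close>
  have D_iff: "W \<in> ?D \<longleftrightarrow> W \<subseteq> V \<and> stable_set E W" for W
    by (simp add: matching_free_def has_matching_1[unfolded One_nat_def] stable_set_def)
  have dim: "graph_dim TYPE('k) V E = krull_dim (mpoly_ring V Quot (sr_ideal V ?D :: ('v, 'k) mpoly set))"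
    by (simp only: graph_dim_def edge)
  have dep: "depth_quot V (sr_ideal V ?D :: ('v, 'k) mpoly set) = enat m"
    using assms(3,4) by (simp only: cohen_macaulay_graph_def edge)
  have wc: "card S = m" if S: "maximal_stable V E S" for S
  proof -
    have SV: "S \<subseteq> V" and SD: "S \<in> ?D" using S by (simp_all only: maximal_stable_def D_iff)
    have facet: "insert x S \<notin> ?D" if "x \<in> V - S" for x
      using S that by (simp only: maximal_stable_def D_iff) blast
    have "enat m \<le> enat (card S)"
      using depth_quot_le_facet[OF finV down_closed_matching_free SD SV facet, where ?'k = 'k] dep by simp
    moreover have "enat (card S) \<le> enat m"
      using krull_dim_ge_face[OF finV down_closed_matching_free SD SV, where ?'k = 'k] dim assms(4) by simp
    ultimately show ?thesis by simp
  qed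
  obtain y A F where wb: "whisker_base y A F" and V: "A \<union> y ` A = V"
    and Ew: "E = whiskered y A F" and cA: "card A = m"
    using well_covered_forest_whiskered[OF finV E acyc noiso wc] by blast
  have "finite E" using E'(1) finV by (meson Pow_iff finite_Pow_iff finite_subset subsetI)
  then have nu: "matching_number E = m"
    using matching_number_whiskered[OF wb] by (simp add: Ew cA)
  moreover have "depth_quot V (squarefree_power V (edge_ideal V E :: ('v, 'k) mpoly set) k) = enat (m + k - 1)"
    if "1 \<le> k" "k \<le> m" for k
    using depth_quot_whiskered[OF finV wb V[symmetric] that(1), where ?'k = 'k] that(2) cA
    by (simp only: squarefree_power_eq_sr_ideal[OF finV E'] Ew[symmetric])
  ultimately show ?thesis by simp
qed

end
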